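(* Let $\mathbb{F}\in\{\mathbb{R},\mathbb{C}\}$, with $\alpha=1$ if $\mathbb{F}=\mathbb{R}$ and $\alpha=0$ if $\mathbb{F}=\mathbb{C}$. Let $A\in\mathbb{F}^{m\times n}$ be an arbitrary matrix, and let $1\le k\le s\le\min\{m,n\}$ be integers with $s\ge 2k+\alpha$. Draw independent standard normal matrices $\Upsilon\in\mathbb{F}^{k\times m}$, $\Omega\in\mathbb{F}^{k\times n}$, $\Phi\in\mathbb{F}^{s\times m}$, $\Psi\in\mathbb{F}^{s\times n}$. Form the sketch $X=\Upsilon A$, $Y=A\Omega^*$, $Z=\Phi A\Psi^*$, and let $\hat A=QCP^*$ be the initial rank-$k$ approximation constructed from $(X,Y,Z)$ as described in the context. For a truncation rank $r\ge 1$, let $[\![\hat A]\!]_r$ be a best rank-$r$ approximation of $\hat A$. Then $$\mathbb{E}\,\|A-[\![\hat A]\!]_r\|_2\;\le\;\tau_{r+1}(A)+2\left[\frac{s-\alpha}{s-k-\alpha}\cdot\min_{\varrho<k-\alpha}\frac{k+\varrho-\alpha}{k-\varrho-\alpha}\cdot\tau_{\varrho+1}^2(A)\right]^{1/2},$$ where the minimum is over natural numbers $\varrho\ge 0$ with $\varrho<k-\alpha$ (and covers the product of both factors to its right), and the expectation is over $\Upsilon,\Omega,\Phi,\Psi$.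
   Context: Notation: $^*$ is the (conjugate) transpose, $^\dagger$ the Moore–Penrose pseudoinverse, and $\|\cdot\|_2$ is the Schatten 2-norm (Frobenius norm). A standard normal matrix over $\mathbb{R}$ has independent $N(0,1)$ entries; over $\mathbb{C}$ its entries are independent and of the form $g_1+\mathrm{i}g_2$ with $g_1,g_2$ independent real $N(0,1)$ variables. Tail energy: for an integer $r\ge 0$, $\tau_{r+1}^2(A)=\min_{\operatorname{rank}(B)\le r}\|A-B\|_2^2=\sum_{j>r}\sigma_j^2(A)$, where $\sigma_j$ is the $j$th largest singular value; $\tau_{r+1}(A)\ge 0$ is its square root. Best rank-$r$ approximation: $[\![M]\!]_r$ denotes any (simultaneous) best approximation of $M$ by matrices of rank at most $r$ with respect to the Schatten norms (i.e. an $r$-truncated SVD); in particular it minimizes $\|M-B\|_2$ over $\operatorname{rank}(B)\le r$. Construction of $\hat A$: compute thin QR factorizations $X^*=PR_1$ with $P\in\mathbb{F}^{n\times k}$ and $Y=QR_2$ with $Q\in\mathbb{F}^{m\times k}$, where $P,Q$ have orthonormal columns (the QR factorization is a fixed procedure, so $P$ is a (measurable) function of $X$ only and $Q$ is a (measurable) function of $Y$ only). Set $C=(\Phi Q)^\dagger Z\,((\Psi P)^\dagger)^*\in\mathbb{F}^{k\times k}$ and $\hat A=QCP^*$. Then $[\![\hat A]\!]_r=Q[\![C]\!]_rP^*$. *)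

theory Defs
  imports "HOL-Probability.Probability" "Jordan_Normal_Form.Conjugate"
begin

text \<open>
  An \<open>m \<times> n\<close> matrix over the real or complex scalars is an element of \<open>'a^'n^'m\<close>. On this type
  the library's \<^const>\<open>norm\<close> is the square root of the sum of the squared absolute values of all
  entries, i.e. the Frobenius (Schatten 2-) norm. The function \<^const>\<open>conjugate\<close> is the identity on
  the reals and complex conjugation on the complex numbers.
\<close>

definition adj :: "'a::conjugatable_field^'n^'m \<Rightarrow> 'a^'m^'n" where
  "adj M = (\<chi> i j. conjugate (M $ j $ i))"

definition is_pinv :: "'a::conjugatable_field^'n^'m \<Rightarrow> 'a^'m^'n \<Rightarrow> bool" where
  "is_pinv M G \<longleftrightarrow> M ** G ** M = M \<and> G ** M ** G = G
     \<and> adj (M ** G) = M ** G \<and> adj (G ** M) = G ** M"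

text \<open>Over the real and the complex numbers the four Penrose equations have exactly one solution.\<close>

definition pinv :: "'a::conjugatable_field^'n^'m \<Rightarrow> 'a^'m^'n" where
  "pinv M = (THE G. is_pinv M G)"

subsection \<open>Singular values, Schatten norms, best low-rank approximation\<close>

definition orthonormal_family :: "nat \<Rightarrow> (nat \<Rightarrow> 'a::conjugatable_field^'n) \<Rightarrow> bool" where
  "orthonormal_family q u \<longleftrightarrow>
     (\<forall>a<q. \<forall>b<q. (\<Sum>i\<in>UNIV. conjugate (u a $ i) * u b $ i) = (if a = b then 1 else 0))"

text \<open>Singular values are numbered from 0, so \<open>\<sigma> j\<close> is the \<open>(j+1)\<close>-st largest one.\<close>

definition is_svd ::
  "'a::{real_normed_field,conjugatable_field}^'n^'m
     \<Rightarrow> (nat \<Rightarrow> real) \<Rightarrow> (nat \<Rightarrow> 'a^'m) \<Rightarrow> (nat \<Rightarrow> 'a^'n) \<Rightarrow> bool" where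
  "is_svd M \<sigma> u v \<longleftrightarrow>
     orthonormal_family (min CARD('m) CARD('n)) u \<and>
     orthonormal_family (min CARD('m) CARD('n)) v \<and>
     (\<forall>j. 0 \<le> \<sigma> j) \<and> decseq \<sigma> \<and> (\<forall>j \<ge> min CARD('m) CARD('n). \<sigma> j = 0) \<and>
     M = (\<chi> i l. \<Sum>j<min CARD('m) CARD('n). of_real (\<sigma> j) * u j $ i * conjugate (v j $ l))"

text \<open>Every real or complex matrix has an SVD, and all its SVDs share the same sequence \<open>\<sigma>\<close>.\<close>

definition singular_value :: "'a::{real_normed_field,conjugatable_field}^'n^'m \<Rightarrow> nat \<Rightarrow> real" where
  "singular_value M = (SOME \<sigma>. \<exists>u v. is_svd M \<sigma> u v)"

definition schatten_norm ::
  "ereal \<Rightarrow> 'a::{real_normed_field,conjugatable_field}^'n^'m \<Rightarrow> real" where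
  "schatten_norm p M =
     (if p = \<infinity> then singular_value M 0
      else (\<Sum>j<min CARD('m) CARD('n). singular_value M j powr real_of_ereal p)
             powr (1 / real_of_ereal p))"

definition best_rank_approx ::
  "nat \<Rightarrow> 'a::{real_normed_field,conjugatable_field}^'n^'m \<Rightarrow> 'a^'n^'m \<Rightarrow> bool" where
  "best_rank_approx r M B \<longleftrightarrow> rank B \<le> r \<and>
     (\<forall>p\<ge>1. \<forall>B'. rank B' \<le> r \<longrightarrow> schatten_norm p (M - B) \<le> schatten_norm p (M - B'))"

text \<open>
  The squared tail energy \<open>\<tau>\<^sub>j\<^sup>2\<close> is indexed as in \<open>\<tau>\<^sub>r\<^sub>+\<^sub>1\<close>: index \<open>r + 1\<close> stands for
  approximation by matrices of rank at most \<open>r\<close>. The infimum is attained for \<open>j \<ge> 1\<close>;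
  \<open>j = 0\<close> is meaningless.
\<close>

definition tail_energy_sq ::
  "nat \<Rightarrow> 'a::{real_normed_field,conjugatable_field}^'n^'m \<Rightarrow> real" where
  "tail_energy_sq j A = (INF B\<in>{B. rank B < j}. (norm (A - B))\<^sup>2)"

definition tail_energy ::
  "nat \<Rightarrow> 'a::{real_normed_field,conjugatable_field}^'n^'m \<Rightarrow> real" where
  "tail_energy j A = sqrt (tail_energy_sq j A)"

subsection \<open>Gaussian matrices\<close>

text \<open>
  \<^const>\<open>Basis\<close> is \<open>{1}\<close> for the reals and \<open>{1, \<i>}\<close> for the complex numbers, with
  \<open>z \<bullet> 1 = Re z\<close> and \<open>z \<bullet> \<i> = Im z\<close>. So a real standard normal scalar is \<open>N(0,1)\<close>, and a complex
  one has independent \<open>N(0,1)\<close> real and imaginary parts (hence \<open>\<bar>z\<bar>\<^sup>2\<close> has expectation 2).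
\<close>

definition std_normal :: "'w measure \<Rightarrow> ('w \<Rightarrow> 'a::euclidean_space) \<Rightarrow> bool" where
  "std_normal M g \<longleftrightarrow>
     prob_space.indep_vars M (\<lambda>_. borel) (\<lambda>b \<omega>. g \<omega> \<bullet> b) Basis \<and>
     (\<forall>b\<in>Basis. distributed M lborel (\<lambda>\<omega>. g \<omega> \<bullet> b) std_normal_density)"

definition std_normal_matrix :: "'w measure \<Rightarrow> ('w \<Rightarrow> 'a::euclidean_space^'n^'m) \<Rightarrow> bool" where
  "std_normal_matrix M G \<longleftrightarrow>
     prob_space.indep_vars M (\<lambda>_. borel) (\<lambda>(i, j) \<omega>. G \<omega> $ i $ j) UNIV \<and>
     (\<forall>i j. std_normal M (\<lambda>\<omega>. G \<omega> $ i $ j))"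

definition generated_events :: "'w measure \<Rightarrow> ('w \<Rightarrow> 'b::topological_space) \<Rightarrow> 'w set set" where
  "generated_events M X = {X -` S \<inter> space M | S. S \<in> sets borel}"

text \<open>
  Mutual independence of the four matrices. The library constant \<open>indep_vars\<close> requires all
  variables to have the same type, hence the use of the events generated by each matrix.
\<close>

definition indep_std_normal_matrices ::
  "'w measure \<Rightarrow> ('w \<Rightarrow> 'a::euclidean_space^'m^'k) \<Rightarrow> ('w \<Rightarrow> 'a^'n^'k)
     \<Rightarrow> ('w \<Rightarrow> 'a^'m^'s) \<Rightarrow> ('w \<Rightarrow> 'a^'n^'s) \<Rightarrow> bool" where
  "indep_std_normal_matrices M \<Upsilon> \<Omega> \<Phi> \<Psi> \<longleftrightarrow>
     std_normal_matrix M \<Upsilon> \<and> std_normal_matrix M \<Omega> \<and>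
     std_normal_matrix M \<Phi> \<and> std_normal_matrix M \<Psi> \<and>
     prob_space.indep_sets M
       (\<lambda>i. [generated_events M \<Upsilon>, generated_events M \<Omega>,
             generated_events M \<Phi>, generated_events M \<Psi>] ! i) {..<4::nat}"

subsection \<open>The initial approximation\<close>

text \<open>
  A thin QR procedure is a Borel measurable choice of the orthonormal factor. The linear order on
  the column index type \<open>'k\<close> only serves to say that the other factor is upper triangular.
\<close>

definition thin_qr ::
  "('a::{real_normed_field,euclidean_space,conjugatable_field}^'k::{finite,linorder}^'m
       \<Rightarrow> 'a^'k::{finite,linorder}^'m) \<Rightarrow> bool" where
  "thin_qr qr \<longleftrightarrow> qr \<in> borel_measurable borel \<and>
     (\<forall>M. adj (qr M) ** qr M = mat 1 \<and>
          (\<exists>R :: 'a^'k::{finite,linorder}^'k::{finite,linorder}. (\<forall>i j. j < i \<longrightarrow> R $ i $ j = 0) \<and> M = qr M ** R))"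

definition initial_approx ::
  "('a::conjugatable_field^'k^'n \<Rightarrow> 'a^'k^'n) \<Rightarrow> ('a^'k^'m \<Rightarrow> 'a^'k^'m)
     \<Rightarrow> 'a^'m^'s \<Rightarrow> 'a^'n^'s \<Rightarrow> 'a^'n^'k \<Rightarrow> 'a^'k^'m \<Rightarrow> 'a^'s^'s \<Rightarrow> 'a^'n^'m" where
  "initial_approx qrP qrQ \<Phi> \<Psi> X Y Z =
     (let P = qrP (adj X);
          Q = qrQ Y;
          C = pinv (\<Phi> ** Q) ** Z ** adj (pinv (\<Psi> ** P))
      in Q ** C ** adj P)"

end

theory Submission
  imports Defs
begin

text \<open>
  Truncation loses little: comparing with a best rank-\<open>r\<close> approximation of \<open>A\<close>, the triangle
  inequality gives \<open>\<parallel>A - B\<parallel> \<le> \<tau> + 2 \<parallel>A - H\<parallel>\<close> for a best rank-\<open>r\<close> approximation \<open>B\<close> of \<open>H\<close>.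
  It remains to bound the mean square error of the initial approximation. Everything rests on two
  properties of a Gaussian matrix \<open>G\<close> and an orthogonal projector \<open>\<P>\<close> of rank \<open>p\<close>. First, \<open>G \<P>\<close> and
  \<open>G (1 - \<P>)\<close> are independent, by rotation invariance. Second, the pseudoinverse of \<open>G \<P>\<close> has
  mean square norm at most \<open>p / d\<close> with \<open>d = \<beta> s - \<beta> p + \<beta> - 2\<close>, where \<open>\<beta>\<close> is the real dimension of the
  scalars; this follows by applying Gaussian integration by parts to the field
  \<open>G (\<P> G\<^sup>* G \<P> + \<epsilon>)\<^sup>-\<^sup>1\<close> and letting \<open>\<epsilon> \<rightarrow> 0\<close>. Together they bound the mean square of
  \<open>C + S (G \<P>)\<^sup>\<dagger> G (1 - \<P>) N\<close> by \<open>\<parallel>C\<parallel>\<^sup>2 + (\<beta> p / d) \<parallel>N\<parallel>\<^sup>2\<close> for contractions \<open>S\<close>. Two applications,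
  to \<open>\<Phi>\<close> and \<open>\<Psi>\<close>, control the core matrix, and two more, to \<open>\<Upsilon>\<close> and \<open>\<Omega>\<close>, control the
  range and the co-range.
\<close>

text \<open>The constant d is what remains of a divergence. For the field \<open>G ** W\<close>,
  with W the resolvent, it has three parts: \<beta> s tr W from the outer G and, from the two
  factors of the Gram matrix, (2 - \<beta>) times the squared norm of \<open>G ** W\<close> and
  \<beta> tr(G W adj G) tr W. Bounding that norm by tr W and tr(G W adj G) by p leaves d tr W. The
  middle part is antilinear and cancels over the complex numbers; this is the origin of \<alpha>,
  isolated in \<open>Basis_sum_conj\<close>. Projectors replace unitary changes of coordinates,
  because \<rho> is a number and there is no matrix type of that size. The regularization is forced
  by the pseudoinverse being neither bounded nor continuous. The hypothesis on s says that \<kappa>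
  = k / (s - k - \<alpha>) is at most 1, which absorbs the term with \<kappa> squared where both
  sketches of the core err at once. The factor (k + \<rho> - \<alpha>) / (k - \<rho> - \<alpha>) is
  1 + 2 \<rho> / (k - \<rho> - \<alpha>): the tail itself, and one share for each of the range and
  the co-range.\<close>

text \<open>With \<open>\<alpha>\<close> as in the informal statement, \<open>card Basis = 2 - \<alpha>\<close>.\<close>

class rc_field = real_normed_field + euclidean_space + conjugatable_field +
  assumes inner_conj_mult: "inner (conjugate c * x) y = inner x (c * y)"
    and conj_mult_self: "conjugate z * z = (norm z)\<^sup>2 *\<^sub>R 1"
    and self_conj_imp_real: "conjugate z = z \<Longrightarrow> z = inner z 1 *\<^sub>R 1"
    and Basis_sum_conj: "(\<Sum>b\<in>Basis. inner b (z * conjugate b * z)) = (2 - real (card Basis)) * (norm z)\<^sup>2"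
    and card_Basis_le_2: "card Basis \<le> 2"

instance real :: rc_field
  by standard (auto simp: power2_eq_square)

instance complex :: rc_field
proof
  show "conjugate z * z = (norm z)\<^sup>2 *\<^sub>R 1" for z :: complex
    by (simp only: scaleR_conv_of_real complex_norm_square) (simp add: mult.commute)
  show "conjugate z = z \<Longrightarrow> z = inner z 1 *\<^sub>R 1" for z :: complex
    by (simp add: complex_eq_iff)
  show "(\<Sum>b\<in>Basis. inner b (z * conjugate b * z)) = (2 - real (card (Basis::complex set))) * (norm z)\<^sup>2"
    for z :: complex
    by (simp add: Basis_complex_def algebra_simps)
qed (simp_all add: inner_complex_def algebra_simps)

subsection \<open>Matrix algebra\<close>

lemma conjugate_one [simp]: "conjugate (1::'a::rc_field) = 1"
  using conj_mult_self[of "1::'a"] by simp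

lemma conjugate_of_real [simp]: "conjugate (of_real r :: 'a::rc_field) = of_real r"
proof (cases "r = 0")
  case False
  have "conjugate (of_real r :: 'a) * of_real r = of_real r * of_real r"
    using conj_mult_self[of "of_real r :: 'a"] by (simp add: power2_eq_square scaleR_conv_of_real)
  with False show ?thesis by simp
qed simp

lemma inner_mult_conj: "inner x (conjugate c * y) = inner (c * x) (y::'a::rc_field)"
  using inner_conj_mult[of c y x] by (simp only: inner_commute)

lemma norm_conjugate [simp]: "norm (conjugate z) = norm (z::'a::rc_field)"
proof (cases "z = 0")
  case False
  have "norm (conjugate z * z) = (norm z)\<^sup>2"
    unfolding conj_mult_self by (simp add: norm_power)
  then have "norm (conjugate z) * norm z = norm z * norm z"
    by (simp add: norm_mult power2_eq_square)
  with False show ?thesis by simp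
qed simp

lemma conj_inner [simp]: "inner (conjugate x) (conjugate y) = inner x (y::'a::rc_field)"
  unfolding dot_norm norm_conjugate by (simp only: conjugate_dist_add[symmetric] norm_conjugate)

lemma linear_conjugate: "linear (conjugate :: 'a::rc_field \<Rightarrow> 'a)"
  by (rule linearI) (simp_all add: conjugate_dist_add scaleR_conv_of_real conjugate_dist_mul)

lemma adj_nth [simp]: "adj M $ i $ j = conjugate (M $ j $ i)"
  by (simp add: adj_def)

lemma adj_adj [simp]: "adj (adj M) = M"
  by (simp add: vec_eq_iff)

lemma adj_add: "adj (A + B) = adj A + adj (B::'a::conjugatable_field^'n^'m)"
  by (simp add: vec_eq_iff conjugate_dist_add)

lemma adj_minus: "adj (- A) = - adj (A::'a::conjugatable_field^'n^'m)"
  by (simp add: vec_eq_iff conjugate_neg)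

lemma adj_diff: "adj (A - B) = adj A - adj (B::'a::conjugatable_field^'n^'m)"
  using adj_add[of A "- B"] by (simp add: adj_minus)

lemma adj_zero [simp]: "adj (0::'a::conjugatable_field^'n^'m) = 0"
  by (simp add: vec_eq_iff)

lemma adj_scaleR: "adj (r *\<^sub>R A) = r *\<^sub>R adj (A::'a::rc_field^'n^'m)"
  by (simp add: vec_eq_iff linear_cmul[OF linear_conjugate])

lemma adj_mult: "adj (A ** B) = adj B ** adj (A::'a::conjugatable_field^'n^'m)"
  by (simp add: vec_eq_iff matrix_matrix_mult_def sum_conjugate conjugate_dist_mul mult.commute)

lemma adj_mat_1 [simp]: "adj (mat 1 :: 'a::rc_field^'n^'n) = mat 1"
  by (auto simp: vec_eq_iff mat_def)

lemma inner_adj [simp]: "inner (adj A) (adj B) = inner A (B::'a::rc_field^'n^'m)"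
  by (simp add: inner_vec_def) (rule sum.swap)

lemma norm_adj [simp]: "norm (adj A) = norm (A::'a::rc_field^'n^'m)"
  by (simp add: norm_eq_sqrt_inner)

text \<open>Because \<open>inner\<close> is the real part of the trace form, adjoints of complex
  matrices are also adjoints for the real Euclidean structure, and the Gaussian calculus can stay
  real.\<close>

lemma inner_mult_left: "inner (A ** B) C = inner B (adj A ** (C::'a::rc_field^'n^'m))"
proof -
  have "inner (A ** B) C = (\<Sum>i\<in>UNIV. \<Sum>j\<in>UNIV. \<Sum>k\<in>UNIV. inner (A$i$k * B$k$j) (C$i$j))"
    by (simp add: inner_vec_def matrix_matrix_mult_def inner_sum_left)
  also have "\<dots> = (\<Sum>k\<in>UNIV. \<Sum>j\<in>UNIV. \<Sum>i\<in>UNIV. inner (A$i$k * B$k$j) (C$i$j))"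
    by (subst sum.swap, subst (2) sum.swap, subst (1) sum.swap) (rule refl)
  also have "\<dots> = (\<Sum>k\<in>UNIV. \<Sum>j\<in>UNIV. \<Sum>i\<in>UNIV. inner (B$k$j) (conjugate (A$i$k) * C$i$j))"
    by (simp add: inner_mult_conj)
  also have "\<dots> = inner B (adj A ** C)"
    by (simp add: inner_vec_def matrix_matrix_mult_def inner_sum_right)
  finally show ?thesis .
qed

lemma inner_mult_right: "inner (A ** B) C = inner A ((C::'a::rc_field^'n^'m) ** adj B)"
  using inner_mult_left[of "adj B" "adj A" "adj C"] inner_adj[of "A ** B" C]
    inner_adj[of A "C ** adj B"] by (simp only: adj_mult adj_adj)

lemma matrix_diff_ldistrib: "A ** (B - C) = A ** B - A ** (C::'a::ring_1^'n^'m)"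
  by (simp add: vec_eq_iff matrix_matrix_mult_def right_diff_distrib sum_subtractf)

lemma matrix_diff_rdistrib: "(A - B) ** C = A ** C - B ** (C::'a::ring_1^'n^'m)"
  by (simp add: vec_eq_iff matrix_matrix_mult_def left_diff_distrib sum_subtractf)

lemma matrix_add_rdistrib': "(A + B) ** C = A ** C + B ** (C::'a::ring_1^'n^'m)"
  by (simp add: vec_eq_iff matrix_matrix_mult_def distrib_right sum.distrib)

lemma matrix_scaleR_left: "(r *\<^sub>R A) ** B = r *\<^sub>R (A ** (B::'a::real_algebra_1^'n^'m))"
  by (simp add: vec_eq_iff matrix_matrix_mult_def scaleR_sum_right)

lemma matrix_scaleR_right: "A ** (r *\<^sub>R B) = r *\<^sub>R (A ** (B::'a::real_algebra_1^'n^'m))"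
  by (simp add: vec_eq_iff matrix_matrix_mult_def scaleR_sum_right)

lemma matrix_minus_left: "(- A) ** B = - (A ** (B::'a::ring_1^'n^'m))"
  by (simp add: vec_eq_iff matrix_matrix_mult_def sum_negf)

lemma matrix_minus_right: "A ** (- B) = - (A ** (B::'a::ring_1^'n^'m))"
  by (simp add: vec_eq_iff matrix_matrix_mult_def sum_negf)

lemmas matrix_ring_simps = matrix_add_ldistrib matrix_add_rdistrib' matrix_diff_ldistrib
  matrix_diff_rdistrib matrix_scaleR_left matrix_scaleR_right matrix_minus_left matrix_minus_right

lemmas matrix_algebra = matrix_ring_simps matrix_mul_assoc

lemmas adj_simps = adj_add adj_diff adj_minus adj_scaleR adj_mult

lemma norm_matrix_mult: "norm (A ** B) \<le> norm A * norm (B::'a::rc_field^'n^'m)"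
proof -
  have "(norm (A ** B))\<^sup>2 = (\<Sum>i\<in>UNIV. \<Sum>j\<in>UNIV. (norm (\<Sum>k\<in>UNIV. A$i$k * B$k$j))\<^sup>2)"
    by (simp add: norm_vec_def L2_set_def matrix_matrix_mult_def sum_nonneg)
  also have "\<dots> \<le> (\<Sum>i\<in>UNIV. \<Sum>j\<in>UNIV. (\<Sum>k\<in>UNIV. (norm (A$i$k))\<^sup>2) * (\<Sum>k\<in>UNIV. (norm (B$k$j))\<^sup>2))"
  proof (intro sum_mono)
    fix i j
    have "norm (\<Sum>k\<in>UNIV. A$i$k * B$k$j) \<le> (\<Sum>k\<in>UNIV. norm (A$i$k) * norm (B$k$j))"
      by (rule order_trans[OF norm_sum]) (simp add: norm_mult)
    then have "(norm (\<Sum>k\<in>UNIV. A$i$k * B$k$j))\<^sup>2 \<le> (\<Sum>k\<in>UNIV. norm (A$i$k) * norm (B$k$j))\<^sup>2"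
      by (simp add: power_mono)
    also have "\<dots> \<le> (\<Sum>k\<in>UNIV. (norm (A$i$k))\<^sup>2) * (\<Sum>k\<in>UNIV. (norm (B$k$j))\<^sup>2)"
      by (rule Cauchy_Schwarz_ineq_sum)
    finally show "(norm (\<Sum>k\<in>UNIV. A$i$k * B$k$j))\<^sup>2
      \<le> (\<Sum>k\<in>UNIV. (norm (A$i$k))\<^sup>2) * (\<Sum>k\<in>UNIV. (norm (B$k$j))\<^sup>2)" .
  qed
  also have "\<dots> = (\<Sum>i\<in>UNIV. \<Sum>k\<in>UNIV. (norm (A$i$k))\<^sup>2) * (\<Sum>j\<in>UNIV. \<Sum>k\<in>UNIV. (norm (B$k$j))\<^sup>2)"
    by (simp add: sum_product)
  also have "(\<Sum>j\<in>UNIV. \<Sum>k\<in>UNIV. (norm (B$k$j))\<^sup>2) = (\<Sum>k\<in>UNIV. \<Sum>j\<in>UNIV. (norm (B$k$j))\<^sup>2)"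
    by (rule sum.swap)
  also have "(\<Sum>i\<in>UNIV. \<Sum>k\<in>UNIV. (norm (A$i$k))\<^sup>2) * \<dots> = (norm A * norm B)\<^sup>2"
    by (simp add: norm_vec_def L2_set_def sum_nonneg power_mult_distrib)
  finally show ?thesis
    by (rule power2_le_imp_le) simp
qed

lemma bounded_bilinear_matrix_mult:
  "bounded_bilinear ((**) :: 'a::rc_field^'n^'m \<Rightarrow> 'a^'p^'n \<Rightarrow> 'a^'p^'m)"
proof
  show "\<exists>K. \<forall>(a::'a^'n^'m) (b::'a^'p^'n). norm (a ** b) \<le> norm a * norm b * K"
    by (rule exI[of _ 1]) (simp add: norm_matrix_mult)
qed (simp_all add: matrix_ring_simps)

lemmas tendsto_matrix_mult [tendsto_intros] =
  bounded_bilinear.tendsto[OF bounded_bilinear_matrix_mult]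
lemmas continuous_on_matrix_mult [continuous_intros] =
  bounded_bilinear.continuous_on[OF bounded_bilinear_matrix_mult]

lemma bounded_linear_adj: "bounded_linear (adj :: 'a::rc_field^'n^'m \<Rightarrow> _)"
  by (rule bounded_linear_intro[where K=1]) (simp_all add: adj_simps)

lemmas tendsto_adj [tendsto_intros] = bounded_linear.tendsto[OF bounded_linear_adj]
lemmas continuous_on_adj [continuous_intros] = bounded_linear.continuous_on[OF bounded_linear_adj]

lemma borel_measurable_matrix_mult [measurable]:
  fixes f :: "'w \<Rightarrow> 'a::rc_field^'n^'m" and g :: "'w \<Rightarrow> 'a^'p^'n"
  assumes [measurable]: "f \<in> borel_measurable M" "g \<in> borel_measurable M"
  shows "(\<lambda>x. f x ** g x) \<in> borel_measurable M"
  by (rule borel_measurable_continuous_Pair[OF assms])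
    (intro continuous_intros)

lemma borel_measurable_adj [measurable]:
  fixes f :: "'w \<Rightarrow> 'a::rc_field^'n^'m"
  assumes "f \<in> borel_measurable M"
  shows "(\<lambda>x. adj (f x)) \<in> borel_measurable M"
  using assms by (rule borel_measurable_continuous_on[OF continuous_on_adj[OF continuous_on_id]])

subsection \<open>Orthogonal projectors\<close>

definition projector :: "'a::conjugatable_field^'n^'n \<Rightarrow> bool" where
  "projector \<P> \<longleftrightarrow> adj \<P> = \<P> \<and> \<P> ** \<P> = \<P>"

lemma projectorD: "projector \<P> \<Longrightarrow> adj \<P> = \<P>" "projector \<P> \<Longrightarrow> \<P> ** \<P> = \<P>"
  by (simp_all add: projector_def)

lemma projector_assoc: "projector \<P> \<Longrightarrow> A ** \<P> ** \<P> = A ** \<P>"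
  by (simp add: projectorD matrix_mul_assoc[symmetric])

lemma projector_compl: "projector \<P> \<Longrightarrow> projector (mat 1 - \<P> :: 'a::rc_field^'n^'n)"
  by (simp add: projector_def adj_diff matrix_ring_simps)

lemma norm_sq_split_left:
  fixes \<P> :: "'a::rc_field^'m^'m" and A :: "'a^'n^'m"
  assumes "projector \<P>"
  shows "(norm A)\<^sup>2 = (norm (\<P> ** A))\<^sup>2 + (norm (A - \<P> ** A))\<^sup>2"
proof -
  have "inner (\<P> ** A) (A - \<P> ** A) = 0"
    using projectorD[OF assms] by (simp add: inner_mult_left matrix_algebra)
  then have "(norm (\<P> ** A + (A - \<P> ** A)))\<^sup>2 = (norm (\<P> ** A))\<^sup>2 + (norm (A - \<P> ** A))\<^sup>2"
    by (rule norm_add_Pythagorean[unfolded orthogonal_def])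
  then show ?thesis by simp
qed

lemma norm_sq_split_right:
  fixes \<P> :: "'a::rc_field^'n^'n" and A :: "'a^'n^'m"
  assumes "projector \<P>"
  shows "(norm A)\<^sup>2 = (norm (A ** \<P>))\<^sup>2 + (norm (A - A ** \<P>))\<^sup>2"
proof -
  have "adj \<P> ** adj A = adj (A ** \<P>)" "adj A - adj (A ** \<P>) = adj (A - A ** \<P>)"
    by (simp_all only: adj_simps)
  then show ?thesis
    using norm_sq_split_left[OF assms, of "adj A"] projectorD[OF assms] by (simp only: norm_adj)
qed

lemma projector_norm_le_left:
  "projector \<P> \<Longrightarrow> norm (\<P> ** A) \<le> norm (A::'a::rc_field^'n^'m)"
  using norm_sq_split_left[of \<P> A] by (metis le_add_same_cancel1 norm_ge_zero power2_le_imp_le zero_le_power2)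

lemma projector_norm_le_right:
  "projector \<P> \<Longrightarrow> norm (A ** \<P>) \<le> norm (A::'a::rc_field^'n^'m)"
  using norm_sq_split_right[of \<P> A] by (metis le_add_same_cancel1 norm_ge_zero power2_le_imp_le zero_le_power2)

text \<open>\<open>inner X (mat 1)\<close> is the real part of the trace. For a projector it is the
  rank, and this is how ranks enter all the bounds.\<close>

lemma projector_inner_mat_1:
  "projector \<P> \<Longrightarrow> inner \<P> (mat 1) = (norm (\<P>::'a::rc_field^'n^'n))\<^sup>2"
  using inner_mult_left[of \<P> \<P> "mat 1"] by (simp add: projectorD power2_norm_eq_inner)

lemma inner_mat_1: "inner (mat 1) (mat 1 :: 'a::rc_field^'n^'n) = real CARD('n)"
proof -
  have "inner (mat 1) (mat 1 :: 'a^'n^'n) = (\<Sum>i\<in>UNIV. \<Sum>j\<in>(UNIV::'n set). if i = j then 1 else 0)"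
    unfolding inner_vec_def mat_def by (intro sum.cong refl) (simp add: power2_norm_eq_inner[symmetric])
  then show ?thesis by simp
qed

text \<open>Passes from a frame to its projector. The trace is cyclic, so \<open>Q ** adj Q\<close>
  has the trace of the identity on the columns.\<close>

lemma orthonormal_columns:
  fixes Q :: "'a::rc_field^'k^'m"
  assumes "adj Q ** Q = mat 1"
  shows "projector (Q ** adj Q)" "inner (Q ** adj Q) (mat 1) = real CARD('k)"
    and "norm (Q ** (B::'a^'n^'k)) = norm B" and "norm (adj Q ** (C::'a^'n^'m)) \<le> norm C"
proof -
  show P: "projector (Q ** adj Q)"
  proof -
    have "Q ** adj Q ** (Q ** adj Q) = Q ** (adj Q ** Q) ** adj Q"
      by (simp only: matrix_mul_assoc)
    then show ?thesis by (simp add: projector_def adj_mult assms)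
  qed
  have "inner (Q ** adj Q) (mat 1) = inner (adj Q) (adj Q)"
    using inner_mult_left[of Q "adj Q" "mat 1"] by simp
  also have "\<dots> = inner (adj Q ** Q) (mat 1)"
    using inner_mult_right[of "adj Q" Q "mat 1"] by simp
  finally show "inner (Q ** adj Q) (mat 1) = real CARD('k)"
    by (simp add: assms inner_mat_1)
  have n: "norm (Q ** (B::'a^'p^'k)) = norm B" for B :: "'a^'p^'k"
  proof -
    have "inner (Q ** B) (Q ** B) = inner B (adj Q ** Q ** B)"
      by (simp add: inner_mult_left matrix_mul_assoc)
    then show ?thesis by (simp add: assms norm_eq_sqrt_inner)
  qed
  then show "norm (Q ** B) = norm B" .
  have "norm (adj Q ** C) = norm (Q ** adj Q ** C)"
    using n[of "adj Q ** C"] by (simp add: matrix_mul_assoc)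
  also have "\<dots> \<le> norm C" by (rule projector_norm_le_left[OF P])
  finally show "norm (adj Q ** C) \<le> norm C" .
qed

subsection \<open>The standard Gaussian measure on a Euclidean space\<close>

definition gauss_density :: "'a::euclidean_space \<Rightarrow> real" where
  "gauss_density x = (1 / sqrt (2 * pi)) ^ DIM('a) * exp (- (norm x)\<^sup>2 / 2)"

text \<open>One measure for every Euclidean type, hence for matrices and for tuples of matrices
  alike. A complex entry contributes two independent real coordinates, in agreement with
  \<open>std_normal\<close>.\<close>

definition gauss :: "'a::euclidean_space measure" where
  "gauss = density lborel (\<lambda>x. ennreal (gauss_density x))"

lemma borel_measurable_gauss_density [measurable]: "gauss_density \<in> borel_measurable borel"
  unfolding gauss_density_def by measurable

lemma gauss_density_nonneg [simp]: "0 \<le> gauss_density x"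
  by (simp add: gauss_density_def)

lemma gauss_density_prod:
  "gauss_density (x::'a::euclidean_space) = (\<Prod>b\<in>Basis. std_normal_density (x \<bullet> b))"
proof -
  have "(norm x)\<^sup>2 = (\<Sum>b\<in>Basis. (x \<bullet> b)\<^sup>2)"
    unfolding power2_norm_eq_inner by (subst euclidean_inner) (simp add: power2_eq_square)
  then show ?thesis
    unfolding gauss_density_def std_normal_density_def prod.distrib
    by (simp add: exp_sum[symmetric] sum_divide_distrib sum_negf)
qed

lemma gauss_density_Pair: "gauss_density (x, y) = gauss_density x * gauss_density y"
  by (simp add: gauss_density_def norm_Pair power_add exp_add[symmetric] add_divide_distrib)

lemma space_gauss [simp]: "space gauss = UNIV"
  and sets_gauss [simp, measurable_cong]: "sets gauss = sets borel"
  by (simp_all add: gauss_def)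

lemma nn_integral_gauss:
  "f \<in> borel_measurable borel \<Longrightarrow>
    (\<integral>\<^sup>+x. f x \<partial>gauss) = (\<integral>\<^sup>+x. ennreal (gauss_density x) * f x \<partial>lborel)"
  unfolding gauss_def by (subst nn_integral_density) auto

lemma nn_integral_gauss_prod:
  fixes f :: "'a::euclidean_space \<Rightarrow> real \<Rightarrow> ennreal"
  assumes [measurable]: "\<And>b. b \<in> Basis \<Longrightarrow> f b \<in> borel_measurable borel"
  shows "(\<integral>\<^sup>+x. (\<Prod>b\<in>Basis. f b (x \<bullet> b)) \<partial>(gauss :: 'a measure))
    = (\<Prod>b\<in>Basis. \<integral>\<^sup>+t. ennreal (std_normal_density t) * f b t \<partial>lborel)"
proof -
  have "(\<integral>\<^sup>+x. (\<Prod>b\<in>Basis. f b (x \<bullet> b)) \<partial>(gauss :: 'a measure))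
    = (\<integral>\<^sup>+x. (\<Prod>b\<in>Basis. ennreal (std_normal_density (x \<bullet> b)) * f b (x \<bullet> b)) \<partial>lborel)"
    by (subst nn_integral_gauss) (auto simp: gauss_density_prod prod.distrib prod_ennreal)
  also have "\<dots> = (\<Prod>b\<in>Basis. \<integral>\<^sup>+t. ennreal (std_normal_density t) * f b t \<partial>lborel)"
    by (rule nn_integral_lborel_prod) auto
  finally show ?thesis .
qed

lemma nn_integral_std_normal_density: "(\<integral>\<^sup>+t. ennreal (std_normal_density t) \<partial>lborel) = 1"
  by (subst nn_integral_eq_integral) (auto intro: integrable_normal_density)

lemma prob_space_gauss: "prob_space (gauss :: 'a::euclidean_space measure)"
proof
  have "emeasure (gauss :: 'a measure) UNIV = (\<integral>\<^sup>+x. (\<Prod>b\<in>(Basis::'a set). 1) \<partial>(gauss :: 'a measure))"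
    by simp
  also have "\<dots> = 1"
    by (subst nn_integral_gauss_prod) (auto simp: nn_integral_std_normal_density)
  finally show "emeasure (gauss :: 'a measure) (space gauss) = 1" by simp
qed

lemma emeasure_gauss_UNIV [simp]: "emeasure (gauss :: 'a::euclidean_space measure) UNIV = 1"
proof -
  interpret prob_space "gauss :: 'a measure" by (rule prob_space_gauss)
  show ?thesis using emeasure_space_1 by simp
qed

lemma emeasure_gauss_box:
  "emeasure (gauss :: 'a::euclidean_space measure) (box l u) =
    (\<Prod>b\<in>Basis. \<integral>\<^sup>+t. ennreal (std_normal_density t) * indicator {l \<bullet> b<..<u \<bullet> b} t \<partial>lborel)"
proof -
  have *: "indicator (box l u) x = (\<Prod>b\<in>Basis. indicator {l \<bullet> b<..<u \<bullet> b} (x \<bullet> b) :: ennreal)" for x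
    by (auto simp: box_def indicator_def prod_zero_iff)
  have "emeasure (gauss :: 'a measure) (box l u) = (\<integral>\<^sup>+x. indicator (box l u) x \<partial>gauss)"
    by simp
  also have "\<dots> = (\<integral>\<^sup>+x. (\<Prod>b\<in>Basis. indicator {l \<bullet> b<..<u \<bullet> b} (x \<bullet> b)) \<partial>gauss)"
    by (simp only: *)
  also have "\<dots> = (\<Prod>b\<in>Basis. \<integral>\<^sup>+t. ennreal (std_normal_density t) * indicator {l \<bullet> b<..<u \<bullet> b} t \<partial>lborel)"
    by (rule nn_integral_gauss_prod) measurable
  finally show ?thesis .
qed

lemma gauss_eqI:
  fixes N :: "'a::euclidean_space measure"
  assumes "\<And>l u. emeasure N (box l u) = emeasure gauss (box l u)" and sets_eq: "sets N = sets borel"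
  shows "N = gauss"
proof (rule measure_eqI_generator_eq)
  let ?E = "range (\<lambda>(a, b). box a b::'a set)"
  show "Int_stable ?E"
    by (auto simp: Int_stable_def box_Int_box)
  show "?E \<subseteq> Pow UNIV" "sets N = sigma_sets UNIV ?E" "sets gauss = sigma_sets UNIV ?E"
    by (simp_all add: borel_eq_box sets_eq)
  let ?A = "\<lambda>n::nat. box (- (real n *\<^sub>R One)) (real n *\<^sub>R One) :: 'a set"
  show "range ?A \<subseteq> ?E" "(\<Union>i. ?A i) = UNIV"
    unfolding UN_box_eq_UNIV by auto
  interpret prob_space "gauss :: 'a measure" by (rule prob_space_gauss)
  show "emeasure N (?A i) \<noteq> \<infinity>" for i
    by (simp add: assms emeasure_eq_measure)
  show "emeasure N X = emeasure gauss X" if "X \<in> ?E" for X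
    using that by (auto simp: assms)
qed

subsection \<open>Rotation invariance\<close>

lemma borel_measurable_linear:
  fixes T :: "'a::euclidean_space \<Rightarrow> 'b::euclidean_space"
  shows "linear T \<Longrightarrow> T \<in> borel_measurable borel"
  by (intro borel_measurable_continuous_onI linear_continuous_on) (simp add: linear_conv_bounded_linear)

lemma nn_integral_lborel_translate:
  fixes f :: "'a::euclidean_space \<Rightarrow> ennreal"
  assumes [measurable]: "f \<in> borel_measurable borel"
  shows "(\<integral>\<^sup>+x. f (c + x) \<partial>lborel) = (\<integral>\<^sup>+x. f x \<partial>lborel)"
  by (subst (2) lborel_distr_plus[of c, symmetric]) (simp add: nn_integral_distr)

lemma nn_integral_lborel_reflect:
  fixes f :: "'a::euclidean_space \<Rightarrow> ennreal"
  assumes [measurable]: "f \<in> borel_measurable borel"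
  shows "(\<integral>\<^sup>+x. f (c - x) \<partial>lborel) = (\<integral>\<^sup>+x. f x \<partial>lborel)"
  by (subst (2) lborel_affine[of "-1" c]) (simp_all add: nn_integral_density nn_integral_distr)

text \<open>
  The double integral of \<open>indicator A (T z) * indicator B (T z + y)\<close> for the unit ball \<open>B\<close>
  compares the image of the Lebesgue measure with the Lebesgue measure itself.
\<close>

lemma lborel_isometry:
  fixes T :: "'a::euclidean_space \<Rightarrow> 'a"
  assumes T: "linear T" and nT: "\<And>x. norm (T x) = norm x"
  shows "distr lborel borel T = lborel"
proof (rule measure_eqI)
  fix A assume "A \<in> sets (distr lborel borel T)"
  then have [measurable]: "A \<in> sets borel" by simp
  have [measurable]: "T \<in> borel_measurable borel"
    by (rule borel_measurable_linear[OF T])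
  have "inj T"
    using linear_injective_0[OF T] nT by (metis norm_eq_zero)
  then obtain S where S: "\<And>x. T (S x) = x"
    using linear_injective_imp_surjective[OF T] by (metis surj_def)
  \<comment> \<open>The unit ball is invariant under \<open>T\<close> and has finite positive
    measure, so its measure cancels at the end.\<close>
  define B where "B = (ball 0 1 :: 'a set)"
  have [measurable]: "B \<in> sets borel" by (simp add: B_def)
  have B: "indicator B (T z) = (indicator B z :: ennreal)" for z
    by (simp add: B_def indicator_def nT)
  have "emeasure (distr lborel borel T) A = (\<integral>\<^sup>+z. indicator A z \<partial>distr lborel borel T)"
    by simp
  also have "\<dots> = (\<integral>\<^sup>+z. indicator A (T z) \<partial>lborel)"
    by (rule nn_integral_distr) simp_all
  finally have "emeasure (distr lborel borel T) A * emeasure lborel B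
    = (\<integral>\<^sup>+z. indicator A (T z) * (\<integral>\<^sup>+y. indicator B y \<partial>lborel) \<partial>lborel)"
    by (simp add: nn_integral_multc)
  also have "\<dots> = (\<integral>\<^sup>+z. indicator A (T z) * (\<integral>\<^sup>+y. indicator B (T z + y) \<partial>lborel) \<partial>lborel)"
    by (subst nn_integral_lborel_translate) simp_all
  also have "\<dots> = (\<integral>\<^sup>+z. (\<integral>\<^sup>+y. indicator A (T z) * indicator B (T z + y) \<partial>lborel) \<partial>lborel)"
    by (subst nn_integral_cmult) simp_all
  also have "\<dots> = (\<integral>\<^sup>+y. (\<integral>\<^sup>+z. indicator A (T z) * indicator B (T z + y) \<partial>lborel) \<partial>lborel)"
    by (rule lborel_pair.Fubini') measurable
  also have "\<dots> = (\<integral>\<^sup>+y. (\<integral>\<^sup>+z. indicator A (T z - y) * indicator B (T z) \<partial>lborel) \<partial>lborel)"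
  proof (rule nn_integral_cong)
    fix y
    \<comment> \<open>Translating z by \<open>- S y\<close> moves the shift by y from the factor
      with \<open>B\<close> to the factor with \<open>A\<close>.\<close>
    have Tz: "T (- S y + z) = T z - y" for z
      using linear_diff[OF T, of z "S y"] by (simp add: S)
    have "(\<integral>\<^sup>+z. indicator A (T z) * indicator B (T z + y) \<partial>lborel)
      = (\<integral>\<^sup>+z. indicator A (T (- S y + z)) * indicator B (T (- S y + z) + y) \<partial>lborel)"
      by (rule nn_integral_lborel_translate[symmetric]) measurable
    then show "(\<integral>\<^sup>+z. indicator A (T z) * indicator B (T z + y) \<partial>lborel)
      = (\<integral>\<^sup>+z. indicator A (T z - y) * indicator B (T z) \<partial>lborel)"
      unfolding Tz by simp
  qed
  also have "\<dots> = (\<integral>\<^sup>+z. (\<integral>\<^sup>+y. indicator A (T z - y) * indicator B (T z) \<partial>lborel) \<partial>lborel)"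
    by (rule lborel_pair.Fubini') measurable
  also have "\<dots> = (\<integral>\<^sup>+z. (\<integral>\<^sup>+y. indicator A (T z - y) \<partial>lborel) * indicator B z \<partial>lborel)"
    by (subst nn_integral_multc) (simp_all add: B)
  also have "\<dots> = emeasure lborel A * emeasure lborel B"
    by (subst nn_integral_lborel_reflect) (simp_all add: nn_integral_cmult)
  finally have eq: "emeasure (distr lborel borel T) A * emeasure lborel B = emeasure lborel A * emeasure lborel B" .
  have "emeasure lborel B \<noteq> 0"
    by (simp add: B_def emeasure_ball unit_ball_vol_pos[THEN less_imp_neq, THEN not_sym])
  moreover have "emeasure lborel B \<noteq> \<top>"
    by (simp add: B_def emeasure_ball)
  ultimately show "emeasure (distr lborel borel T) A = emeasure lborel A"
    using eq mult_divide_eq_ennreal by metis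
qed simp

lemma gauss_isometry:
  fixes T :: "'a::euclidean_space \<Rightarrow> 'a"
  assumes T: "linear T" and nT: "\<And>x. norm (T x) = norm x"
  shows "distr gauss borel T = gauss"
proof -
  have [measurable]: "T \<in> borel_measurable borel"
    by (rule borel_measurable_linear[OF T])
  have "distr gauss borel T = distr (density lborel (\<lambda>x. ennreal (gauss_density (T x)))) borel T"
    by (simp add: gauss_def gauss_density_def nT)
  also have "\<dots> = density (distr lborel borel T) (\<lambda>x. ennreal (gauss_density x))"
    by (rule density_distr[symmetric]) measurable
  also have "\<dots> = gauss"
    by (simp add: lborel_isometry[OF T nT] gauss_def)
  finally show ?thesis .
qed

lemma nn_integral_gauss_isometry:
  fixes T :: "'a::euclidean_space \<Rightarrow> 'a"
  assumes T: "linear T" and nT: "\<And>x. norm (T x) = norm x" and f: "f \<in> borel_measurable borel"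
  shows "(\<integral>\<^sup>+x. f (T x) \<partial>gauss) = (\<integral>\<^sup>+x. f x \<partial>gauss)"
  using nn_integral_distr[of T gauss borel f] borel_measurable_linear[OF T] f
  by (simp add: gauss_isometry[OF T nT])

lemma nn_integral_gauss_Pair:
  fixes f :: "'a::euclidean_space \<times> 'b::euclidean_space \<Rightarrow> ennreal"
  assumes f [measurable]: "f \<in> borel_measurable borel"
  shows "(\<integral>\<^sup>+z. f z \<partial>gauss) = (\<integral>\<^sup>+x. (\<integral>\<^sup>+y. f (x, y) \<partial>gauss) \<partial>gauss)"
proof -
  have [measurable]: "f \<in> borel_measurable (borel \<Otimes>\<^sub>M borel)"
    using f by (simp add: borel_prod)
  have "(\<integral>\<^sup>+z. f z \<partial>gauss) = (\<integral>\<^sup>+z. ennreal (gauss_density z) * f z \<partial>(lborel \<Otimes>\<^sub>M lborel))"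
    by (simp add: nn_integral_gauss lborel_prod)
  also have "\<dots> = (\<integral>\<^sup>+x. \<integral>\<^sup>+y. ennreal (gauss_density (x, y)) * f (x, y) \<partial>lborel \<partial>lborel)"
    by (rule lborel.nn_integral_fst[symmetric]) (simp add: lborel_prod)
  also have "\<dots> = (\<integral>\<^sup>+x. ennreal (gauss_density x) * (\<integral>\<^sup>+y. ennreal (gauss_density y) * f (x, y) \<partial>lborel) \<partial>lborel)"
    by (subst nn_integral_cmult[symmetric]) (simp_all add: gauss_density_Pair ennreal_mult mult.assoc)
  also have "\<dots> = (\<integral>\<^sup>+x. (\<integral>\<^sup>+y. f (x, y) \<partial>gauss) \<partial>gauss)"
    by (subst (1 2) nn_integral_gauss) simp_all
  finally show ?thesis .
qed

text \<open>
  Encodes the independence of the components in a subspace and in its orthogonal complement.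
\<close>

lemma nn_integral_gauss_resample:
  fixes p :: "'a::euclidean_space \<Rightarrow> 'a"
  assumes p: "linear p" and pp: "\<And>x. p (p x) = p x" and sa: "\<And>x y. p x \<bullet> y = x \<bullet> p y"
    and [measurable]: "f \<in> borel_measurable borel"
  shows "(\<integral>\<^sup>+x. f x \<partial>gauss) = (\<integral>\<^sup>+x. (\<integral>\<^sup>+y. f (p x + (y - p y)) \<partial>gauss) \<partial>gauss)"
proof -
  have [measurable]: "p \<in> borel_measurable borel"
    by (rule borel_measurable_linear[OF p])
  \<comment> \<open>Two independent copies exchange their components in the kernel of
    \<open>p\<close>; this exchange is an isometry of the product space.\<close>
  define R where "R z = (p (fst z) + (snd z - p (snd z)), p (snd z) + (fst z - p (fst z)))" for z
  have R: "linear R"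
    unfolding R_def by (rule linearI) (simp_all add: linear_add[OF p] linear_cmul[OF p] algebra_simps)
  have nR: "norm (R z) = norm z" for z
  proof -
    have *: "(norm (p x + (y - p y)))\<^sup>2 = (norm (p x))\<^sup>2 + (norm (y - p y))\<^sup>2" for x y
      by (rule norm_add_Pythagorean) (simp add: orthogonal_def inner_diff_right sa pp)
    have **: "(norm x)\<^sup>2 = (norm (p x))\<^sup>2 + (norm (x - p x))\<^sup>2" for x
      using *[of x x] by simp
    obtain x y where "z = (x, y)" by (cases z)
    then show ?thesis
      by (simp add: R_def norm_Pair * **[of x] **[of y])
  qed
  have [measurable]: "fst \<in> borel_measurable (borel :: ('a \<times> 'a) measure)"
    "snd \<in> borel_measurable (borel :: ('a \<times> 'a) measure)"
    by (auto intro!: borel_measurable_continuous_onI continuous_intros)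
  have fst1: "(\<integral>\<^sup>+x. g x \<partial>gauss) = (\<integral>\<^sup>+z. g (fst z) \<partial>(gauss::('a \<times> 'a) measure))"
    if [measurable]: "g \<in> borel_measurable borel" for g :: "'a \<Rightarrow> ennreal"
  proof -
    interpret prob_space "gauss :: 'a measure" by (rule prob_space_gauss)
    show ?thesis
      using emeasure_space_1 by (subst nn_integral_gauss_Pair) simp_all
  qed
  have "(\<integral>\<^sup>+x. f x \<partial>gauss) = (\<integral>\<^sup>+z. f (fst (R z)) \<partial>gauss)"
    by (subst nn_integral_gauss_isometry[OF R nR, of "\<lambda>z. f (fst z)"]) (simp_all add: fst1)
  also have "\<dots> = (\<integral>\<^sup>+x. (\<integral>\<^sup>+y. f (p x + (y - p y)) \<partial>gauss) \<partial>gauss)"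
    by (subst nn_integral_gauss_Pair) (simp_all add: R_def)
  finally show ?thesis .
qed

subsection \<open>Moments and Gaussian integration by parts\<close>

lemma nn_integral_gauss_coord_sq:
  assumes b: "b \<in> Basis"
  shows "(\<integral>\<^sup>+x. ennreal ((x \<bullet> b)\<^sup>2) \<partial>(gauss :: 'a::euclidean_space measure)) = 1"
proof -
  define f where "f b' t = (if b' = b then ennreal (t\<^sup>2) else 1)" for b' :: 'a and t
  have [measurable]: "f b' \<in> borel_measurable borel" for b'
    unfolding f_def by measurable
  have "(\<integral>\<^sup>+x. ennreal ((x \<bullet> b)\<^sup>2) \<partial>(gauss :: 'a measure))
    = (\<integral>\<^sup>+x. (\<Prod>b'\<in>Basis. f b' (x \<bullet> b')) \<partial>(gauss :: 'a measure))"
    using b by (simp add: f_def prod.delta)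
  also have "\<dots> = (\<Prod>b'\<in>Basis. \<integral>\<^sup>+t. ennreal (std_normal_density t) * f b' t \<partial>lborel)"
    by (rule nn_integral_gauss_prod) measurable
  also have "\<dots> = (\<Prod>b'\<in>(Basis::'a set). 1)"
  proof (rule prod.cong)
    fix b' :: 'a
    have "(\<integral>\<^sup>+t. ennreal (std_normal_density t * t\<^sup>2) \<partial>lborel) = 1"
      using std_normal_moment_even[of 1]
      by (subst nn_integral_eq_integral) (auto simp: has_bochner_integral_iff)
    then show "(\<integral>\<^sup>+t. ennreal (std_normal_density t) * f b' t \<partial>lborel) = 1"
      by (cases "b' = b") (simp_all add: f_def ennreal_mult nn_integral_std_normal_density)
  qed simp
  finally show ?thesis by simp
qed

lemma integral_gauss_isometry:
  fixes T :: "'a::euclidean_space \<Rightarrow> 'a" and f :: "'a \<Rightarrow> real"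
  assumes T: "linear T" and nT: "\<And>x. norm (T x) = norm x" and f: "f \<in> borel_measurable borel"
  shows "(\<integral>x. f (T x) \<partial>gauss) = (\<integral>x. f x \<partial>gauss)"
  using integral_distr[of T gauss borel f] borel_measurable_linear[OF T] f
  by (simp add: gauss_isometry[OF T nT])

lemma abs_le_one_plus_square: "\<bar>t\<bar> \<le> 1 + t\<^sup>2" for t :: real
  using sum_squares_bound[of 1 "\<bar>t\<bar>"] by simp

lemma gauss_coord_moments:
  fixes e e' :: "'a::euclidean_space"
  assumes e: "e \<in> Basis" and e': "e' \<in> Basis"
  shows "has_bochner_integral gauss (\<lambda>x. x \<bullet> e) 0"
    and "has_bochner_integral gauss (\<lambda>x. (x \<bullet> e) * (x \<bullet> e')) (if e = e' then 1 else 0)"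
proof -
  interpret prob_space "gauss :: 'a measure" by (rule prob_space_gauss)
  have sq: "has_bochner_integral gauss (\<lambda>x. (x \<bullet> b)\<^sup>2) 1" if "b \<in> Basis" for b :: 'a
    using nn_integral_gauss_coord_sq[OF that]
    by (intro has_bochner_integral_nn_integral) auto
  note int = has_bochner_integral_iff[THEN iffD1, OF sq, THEN conjunct1]
  have i1: "integrable gauss (\<lambda>x. x \<bullet> e)"
  proof (rule Bochner_Integration.integrable_bound)
    show "integrable gauss (\<lambda>x. 1 + (x \<bullet> e)\<^sup>2)" using int[OF e] by simp
    show "AE x in gauss. norm (x \<bullet> e) \<le> norm (1 + (x \<bullet> e)\<^sup>2)" by (simp add: abs_le_one_plus_square)
  qed simp
  have i2: "integrable gauss (\<lambda>x. (x \<bullet> e) * (x \<bullet> e'))"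
  proof (rule Bochner_Integration.integrable_bound)
    show "integrable gauss (\<lambda>x. (x \<bullet> e)\<^sup>2 + (x \<bullet> e')\<^sup>2)" using int[OF e] int[OF e'] by simp
    have "\<bar>s * t\<bar> \<le> s\<^sup>2 + t\<^sup>2" for s t :: real
    proof -
      have "2 * \<bar>s * t\<bar> \<le> s\<^sup>2 + t\<^sup>2"
        using sum_squares_bound[of "\<bar>s\<bar>" "\<bar>t\<bar>"] by (simp add: abs_mult mult.assoc)
      then show ?thesis using abs_ge_zero[of "s * t"] by linarith
    qed
    then show "AE x in gauss. norm ((x \<bullet> e) * (x \<bullet> e')) \<le> norm ((x \<bullet> e)\<^sup>2 + (x \<bullet> e')\<^sup>2)" by simp
  qed simp
  \<comment> \<open>The reflection in the hyperplane orthogonal to \<open>e\<close> flips the sign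
    of \<open>x \<bullet> e\<close> and fixes the other coordinates, so the odd moments
    vanish.\<close>
  define R where "R x = x - (2 * (x \<bullet> e)) *\<^sub>R e" for x :: 'a
  have R: "linear R"
    unfolding R_def by (rule linearI) (simp_all add: inner_add_left algebra_simps)
  have nR: "norm (R x) = norm x" for x
    using e unfolding norm_eq_sqrt_inner R_def
    by (simp add: inner_diff_left inner_diff_right inner_commute algebra_simps)
  have Re: "R x \<bullet> e = - (x \<bullet> e)" for x
    using e by (simp add: R_def inner_diff_left)
  have "(\<integral>x. x \<bullet> e \<partial>gauss) = (\<integral>x. R x \<bullet> e \<partial>gauss)"
    by (rule integral_gauss_isometry[OF R nR, symmetric]) simp
  then show "has_bochner_integral gauss (\<lambda>x. x \<bullet> e) 0"
    using i1 by (simp add: Re has_bochner_integral_iff)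
  show "has_bochner_integral gauss (\<lambda>x. (x \<bullet> e) * (x \<bullet> e')) (if e = e' then 1 else 0)"
  proof (cases "e = e'")
    case True
    then show ?thesis using sq[OF e] by (simp add: power2_eq_square)
  next
    case False
    then have Re': "R x \<bullet> e' = x \<bullet> e'" for x
      using e e' by (simp add: R_def inner_diff_left inner_Basis)
    have "(\<integral>x. (x \<bullet> e) * (x \<bullet> e') \<partial>gauss) = (\<integral>x. (R x \<bullet> e) * (R x \<bullet> e') \<partial>gauss)"
      by (rule integral_gauss_isometry[OF R nR, symmetric]) simp
    then show ?thesis
      using i2 False by (simp add: Re Re' has_bochner_integral_iff)
  qed
qed

text \<open>Only the constant and the diagonal terms survive the expansion, as the coordinates are
  centred, uncorrelated and of unit variance. The sum over \<open>Basis\<close> is the squared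
  Hilbert-Schmidt norm of \<open>T\<close>.\<close>

lemma nn_integral_gauss_affine_sq:
  fixes T :: "'a::euclidean_space \<Rightarrow> 'b::euclidean_space"
  assumes T: "linear T"
  shows "(\<integral>\<^sup>+x. ennreal ((norm (c + T x))\<^sup>2) \<partial>gauss)
    = ennreal ((norm c)\<^sup>2 + (\<Sum>e\<in>Basis. (norm (T e))\<^sup>2))"
proof -
  interpret prob_space "gauss :: 'a measure" by (rule prob_space_gauss)
  have Tx: "T x = (\<Sum>e\<in>Basis. (x \<bullet> e) *\<^sub>R T e)" for x
    by (subst euclidean_representation[of x, symmetric])
      (simp only: linear_sum[OF T] linear_cmul[OF T])
  have "(norm (c + T x))\<^sup>2 = (norm c)\<^sup>2 + (2 * (\<Sum>e\<in>Basis. (x \<bullet> e) * (c \<bullet> T e))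
      + (\<Sum>e\<in>Basis. \<Sum>e'\<in>Basis. (x \<bullet> e) * (x \<bullet> e') * (T e \<bullet> T e')))" for x
  proof -
    have "(norm (c + T x))\<^sup>2 = c \<bullet> c + (2 * (c \<bullet> T x) + T x \<bullet> T x)"
      by (simp add: power2_norm_eq_inner inner_add_left inner_add_right inner_commute)
    also have "c \<bullet> T x = (\<Sum>e\<in>Basis. (x \<bullet> e) * (c \<bullet> T e))"
      by (subst Tx) (simp add: inner_sum_right)
    also have "T x \<bullet> T x = (\<Sum>e\<in>Basis. \<Sum>e'\<in>Basis. (x \<bullet> e) * (x \<bullet> e') * (T e \<bullet> T e'))"
      by (subst (1 2) Tx) (simp add: inner_sum_left inner_sum_right sum_distrib_left mult.left_commute mult.assoc inner_commute)
    finally show ?thesis by (simp add: power2_norm_eq_inner)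
  qed
  moreover have "has_bochner_integral gauss (\<lambda>x. (norm c)\<^sup>2 + (2 * (\<Sum>e\<in>Basis. (x \<bullet> e) * (c \<bullet> T e))
      + (\<Sum>e\<in>Basis. \<Sum>e'\<in>Basis. (x \<bullet> e) * (x \<bullet> e') * (T e \<bullet> T e'))))
    ((norm c)\<^sup>2 + (2 * (\<Sum>e\<in>(Basis::'a set). 0 * (c \<bullet> T e))
      + (\<Sum>e\<in>(Basis::'a set). \<Sum>e'\<in>Basis. (if e = e' then 1 else 0) * (T e \<bullet> T e'))))"
    using emeasure_space_1
    by (intro has_bochner_integral_add has_bochner_integral_mult_right has_bochner_integral_sum
        has_bochner_integral_mult_left gauss_coord_moments)
      (auto simp: has_bochner_integral_iff prob_space[simplified])
  ultimately have "has_bochner_integral gauss (\<lambda>x. (norm (c + T x))\<^sup>2)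
    ((norm c)\<^sup>2 + (\<Sum>e\<in>Basis. (norm (T e))\<^sup>2))"
    by (simp add: power2_norm_eq_inner sum.delta if_distrib[of "\<lambda>t. t * _"] cong: if_cong)
  then show ?thesis
    by (subst nn_integral_eq_integral) (auto simp: has_bochner_integral_iff)
qed

section \<open>Shifts of the Gaussian measure and integration by parts\<close>

lemma abs_exp_minus_1_le: "\<bar>exp a - 1\<bar> \<le> \<bar>a\<bar> * exp \<bar>a::real\<bar>"
proof (cases "0 \<le> a")
  case True
  have "(1 - a) * exp a \<le> exp (- a) * exp a"
    using exp_ge_add_one_self[of "- a"] by (intro mult_right_mono) auto
  with True show ?thesis by (simp add: exp_minus algebra_simps)
next
  case False
  have "1 - exp a \<le> - a" using exp_ge_add_one_self[of a] by linarith
  also have "\<dots> \<le> - a * exp (- a)" using False by (simp add: mult_le_cancel_left1)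
  finally show ?thesis using False by simp
qed

text \<open>The derivative of the exponential factor at t = 0 is \<open>x \<bullet> e\<close>, the
  weight in the integration by parts formula.\<close>

lemma gauss_density_shift:
  "norm e = 1 \<Longrightarrow> gauss_density (x - t *\<^sub>R e) = gauss_density x * exp (t * (x \<bullet> e) - t\<^sup>2 / 2)"
proof -
  assume "norm e = 1"
  then have "(norm (x - t *\<^sub>R e))\<^sup>2 = (norm x)\<^sup>2 - 2 * t * (x \<bullet> e) + t\<^sup>2"
    unfolding power2_norm_eq_inner
    by (simp add: inner_diff_left inner_diff_right norm_eq_1 inner_commute power2_eq_square algebra_simps)
  then have "exp (- (norm (x - t *\<^sub>R e))\<^sup>2 / 2) = exp (- (norm x)\<^sup>2 / 2 + (t * (x \<bullet> e) - t\<^sup>2 / 2))"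
    by (simp add: field_simps)
  then show ?thesis by (simp only: gauss_density_def exp_add mult.assoc)
qed

lemma nn_integral_gauss_exp:
  "norm e = 1 \<Longrightarrow> (\<integral>\<^sup>+x. ennreal (exp (t * (x \<bullet> e))) \<partial>(gauss :: 'a::euclidean_space measure)) = ennreal (exp (t\<^sup>2 / 2))"
proof -
  assume e: "norm (e::'a) = 1"
  interpret prob_space "gauss :: 'a measure" by (rule prob_space_gauss)
  have "(\<integral>\<^sup>+x. ennreal (exp (t * (x \<bullet> e))) \<partial>(gauss :: 'a measure))
    = (\<integral>\<^sup>+x. ennreal (exp (t\<^sup>2 / 2)) * ennreal (gauss_density (- (t *\<^sub>R e) + x)) \<partial>lborel)"
  proof (subst nn_integral_gauss, measurable, rule nn_integral_cong)
    fix x :: 'a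
    show "ennreal (gauss_density x) * ennreal (exp (t * (x \<bullet> e)))
      = ennreal (exp (t\<^sup>2 / 2)) * ennreal (gauss_density (- (t *\<^sub>R e) + x))"
      using gauss_density_shift[OF e, of x t]
      by (simp add: ennreal_mult[symmetric] exp_diff)
  qed
  also have "\<dots> = ennreal (exp (t\<^sup>2 / 2)) * (\<integral>\<^sup>+x. ennreal (gauss_density (x::'a)) \<partial>lborel)"
    by (simp add: nn_integral_cmult nn_integral_lborel_translate[of "\<lambda>x. ennreal (gauss_density x)" "- (t *\<^sub>R e)", simplified])
  also have "(\<integral>\<^sup>+x. ennreal (gauss_density (x::'a)) \<partial>lborel) = 1"
    using nn_integral_gauss[of "\<lambda>_::'a. 1"] emeasure_space_1 by simp
  finally show ?thesis by simp
qed

text \<open>Shifting the variable by t e equates the mean of h(x + t e) with the mean of h(x) exp(t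
  (x \<bullet> e) - t^2 / 2). The claim is the derivative of this identity at t = 0, taken under
  both integrals by dominated convergence.\<close>

lemma gauss_integration_by_parts:
  fixes h h' :: "'a::euclidean_space \<Rightarrow> real"
  assumes e: "norm e = 1"
    and [measurable]: "h \<in> borel_measurable borel" "h' \<in> borel_measurable borel"
    and C: "\<And>x. \<bar>h x\<bar> \<le> C" "\<And>x. \<bar>h' x\<bar> \<le> C"
    and D: "\<And>x. ((\<lambda>t. h (x + t *\<^sub>R e)) has_real_derivative h' x) (at 0)"
  shows "integrable gauss (\<lambda>x. (x \<bullet> e) * h x)" "integrable gauss h'"
    and "(\<integral>x. (x \<bullet> e) * h x \<partial>gauss) = (\<integral>x. h' x \<partial>gauss)"
proof -
  interpret prob_space "gauss :: 'a measure" by (rule prob_space_gauss)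
  define t where "t n = inverse (real (Suc n))" for n
  have t: "0 < t n" "t n \<le> 1" for n by (auto simp: t_def field_simps)
  have t0: "filterlim t (at 0) sequentially"
    unfolding filterlim_at using t LIMSEQ_inverse_real_of_nat
    by (auto simp: t_def[abs_def] less_imp_neq[symmetric])
  \<comment> \<open>\<open>A\<close> and \<open>B\<close> are the difference quotients of the two
    sides. With u = \<open>x \<bullet> e\<close>, the majorant \<open>w\<close> of \<open>B\<close>
    comes from \<open>abs_exp_minus_1_le\<close>, applied to an exponent of size at most
    \<bar>u\<bar> + 1, and from exp(2 \<bar>u\<bar>) \<le> exp(2 u) + exp(-2 u).\<close>
  define A where "A n x = (h (x + t n *\<^sub>R e) - h x) / t n" for n x
  define B where "B n x = h x * ((exp (t n * (x \<bullet> e) - (t n)\<^sup>2 / 2) - 1) / t n)" for n x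
  define w where "w x = C * (exp 2 * (exp (2 * (x \<bullet> e)) + exp (-2 * (x \<bullet> e))))" for x
  have C0: "0 \<le> C" using C(1)[of 0] by linarith
  have w: "integrable gauss w"
    unfolding w_def
    by (intro integrable_mult_right Bochner_Integration.integrable_add integrableI_nonneg)
      (use nn_integral_gauss_exp[OF e, of 2] nn_integral_gauss_exp[OF e, of "-2"] in auto)
  \<comment> \<open>The mean value theorem bounds every difference quotient by the bound on
    \<open>h'\<close>.\<close>
  have Abound: "norm (A n x) \<le> C" for n x
  proof -
    have D': "((\<lambda>s. h (x + s *\<^sub>R e)) has_real_derivative h' (x + s *\<^sub>R e)) (at s)" for s
    proof -
      have "((\<lambda>r. h (x + s *\<^sub>R e + (r + - s) *\<^sub>R e)) has_real_derivative h' (x + s *\<^sub>R e)) (at s)"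
        using D[of "x + s *\<^sub>R e"] DERIV_shift[of "\<lambda>r. h (x + s *\<^sub>R e + r *\<^sub>R e)" _ s "- s"] by simp
      then show ?thesis by (simp add: scaleR_diff_left)
    qed
    obtain z where "h (x + t n *\<^sub>R e) - h (x + 0 *\<^sub>R e) = (t n - 0) * h' (x + z *\<^sub>R e)"
      using MVT2[of 0 "t n" "\<lambda>s. h (x + s *\<^sub>R e)" "\<lambda>s. h' (x + s *\<^sub>R e)"] D' t by blast
    then show ?thesis using t[of n] C(2) by (simp add: A_def)
  qed
  have Bbound: "norm (B n x) \<le> w x" for n x
  proof -
    let ?u = "x \<bullet> e" and ?a = "t n * (x \<bullet> e) - (t n)\<^sup>2 / 2"
    have "(t n)\<^sup>2 \<le> t n" using t[of n] by (simp add: power2_eq_square mult_le_cancel_left1)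
    then have a: "\<bar>?a\<bar> \<le> t n * (\<bar>?u\<bar> + 1)"
      using t[of n] abs_triangle_ineq4[of "t n * ?u" "(t n)\<^sup>2 / 2"] by (simp add: abs_mult algebra_simps)
    also have "\<dots> \<le> 1 * (\<bar>?u\<bar> + 1)" using t[of n] by (intro mult_right_mono) auto
    finally have a1: "\<bar>?a\<bar> \<le> \<bar>?u\<bar> + 1" by simp
    have "\<bar>exp ?a - 1\<bar> \<le> t n * (\<bar>?u\<bar> + 1) * exp (\<bar>?u\<bar> + 1)"
      using abs_exp_minus_1_le[of ?a] a a1 t[of n]
      by (elim order_trans) (intro mult_mono, auto)
    also have "\<dots> \<le> t n * exp (\<bar>?u\<bar> + 1) * exp (\<bar>?u\<bar> + 1)"
      using t[of n] exp_ge_add_one_self[of "\<bar>?u\<bar> + 1"] by (intro mult_right_mono mult_left_mono) auto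
    also have "\<dots> = t n * (exp 2 * exp (2 * \<bar>?u\<bar>))"
      by (simp add: exp_add[symmetric] algebra_simps)
    also have "\<dots> \<le> t n * (exp 2 * (exp (2 * ?u) + exp (- 2 * ?u)))"
      using t[of n] by (intro mult_left_mono) (auto simp: abs_if)
    finally have "\<bar>(exp ?a - 1) / t n\<bar> \<le> exp 2 * (exp (2 * ?u) + exp (- 2 * ?u))"
      using t[of n] by (simp add: field_simps)
    then show ?thesis
      unfolding B_def w_def real_norm_def abs_mult using C(1)[of x] C0 by (intro mult_mono) auto
  qed
  have Alim: "(\<lambda>n. A n x) \<longlonglongrightarrow> h' x" for x
  proof -
    have "((\<lambda>s. (h (x + s *\<^sub>R e) - h (x + 0 *\<^sub>R e)) / (s - 0)) \<longlongrightarrow> h' x) (at 0)"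
      using D[of x] unfolding has_field_derivative_iff .
    from filterlim_compose[OF this t0] show ?thesis by (simp add: A_def)
  qed
  have Blim: "(\<lambda>n. B n x) \<longlonglongrightarrow> (x \<bullet> e) * h x" for x
  proof -
    have "((\<lambda>s. exp (s * (x \<bullet> e) - s\<^sup>2 / 2)) has_real_derivative (x \<bullet> e)) (at 0)"
      by (auto intro!: derivative_eq_intros)
    then have "((\<lambda>s. (exp (s * (x \<bullet> e) - s\<^sup>2 / 2) - 1) / s) \<longlongrightarrow> x \<bullet> e) (at 0)"
      unfolding has_field_derivative_iff by simp
    from tendsto_mult[OF tendsto_const[of "h x"] filterlim_compose[OF this t0]]
    show ?thesis by (simp add: B_def mult.commute)
  qed
  have [measurable]: "A n \<in> borel_measurable borel" "B n \<in> borel_measurable borel" for n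
    unfolding A_def B_def by measurable
  have AB: "(\<integral>x. A n x \<partial>gauss) = (\<integral>x. B n x \<partial>gauss)" for n
  proof -
    have ih: "integrable gauss (\<lambda>x. h (x + t n *\<^sub>R e))" "integrable gauss h"
      by (rule integrable_const_bound[of _ C]; simp add: C)+
    have iB: "integrable gauss (B n)"
      by (rule Bochner_Integration.integrable_bound[OF w]) (auto intro!: AE_I2 order_trans[OF Bbound[simplified] abs_ge_self])
    have hB: "h x * exp (t n * (x \<bullet> e) - (t n)\<^sup>2 / 2) = h x + t n * B n x" for x
      using t[of n] by (simp add: B_def field_simps)
    have "(\<integral>x. h (x + t n *\<^sub>R e) \<partial>gauss) = (\<integral>x. gauss_density x * h (x + t n *\<^sub>R e) \<partial>lborel)"
      unfolding gauss_def by (subst integral_density) auto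
    also have "\<dots> = (\<integral>x. gauss_density (- (t n *\<^sub>R e) + x) * h (- (t n *\<^sub>R e) + x + t n *\<^sub>R e) \<partial>lborel)"
      by (subst lborel_distr_plus[of "- (t n *\<^sub>R e)", symmetric], subst integral_distr) simp_all
    also have "\<dots> = (\<integral>x. gauss_density x * (h x * exp (t n * (x \<bullet> e) - (t n)\<^sup>2 / 2)) \<partial>lborel)"
      by (intro Bochner_Integration.integral_cong) (simp_all add: gauss_density_shift[OF e, symmetric])
    also have "\<dots> = (\<integral>x. h x * exp (t n * (x \<bullet> e) - (t n)\<^sup>2 / 2) \<partial>gauss)"
      unfolding gauss_def by (subst integral_density) auto
    also have "\<dots> = (\<integral>x. h x \<partial>gauss) + t n * (\<integral>x. B n x \<partial>gauss)"
      unfolding hB using ih iB by simp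
    finally show ?thesis
      using t[of n] ih by (simp add: A_def field_simps)
  qed
  have A1: "integrable gauss h'" "(\<lambda>n. \<integral>x. A n x \<partial>gauss) \<longlonglongrightarrow> (\<integral>x. h' x \<partial>gauss)"
    by (rule integrable_dominated_convergence[where s=A and w="\<lambda>_. C"]
        integral_dominated_convergence[where s=A and w="\<lambda>_. C"];
      simp add: Alim Abound[simplified])+
  have B1: "integrable gauss (\<lambda>x. (x \<bullet> e) * h x)"
    "(\<lambda>n. \<integral>x. B n x \<partial>gauss) \<longlonglongrightarrow> (\<integral>x. (x \<bullet> e) * h x \<partial>gauss)"
    by (rule integrable_dominated_convergence[where s=B and w=w]
        integral_dominated_convergence[where s=B and w=w];
      simp add: Blim Bbound[simplified] w)+
  show "integrable gauss (\<lambda>x. (x \<bullet> e) * h x)" "integrable gauss h'" by fact+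
  show "(\<integral>x. (x \<bullet> e) * h x \<partial>gauss) = (\<integral>x. h' x \<partial>gauss)"
    using B1(2) A1(2) unfolding AB by (rule LIMSEQ_unique)
qed

subsection \<open>Inverse matrices by Cramer's rule\<close>

definition adjugate :: "'a::field^'n^'n \<Rightarrow> 'a^'n^'n" where
  "adjugate M = (\<chi> k j. det (\<chi> a b. if b = k then axis j 1 $ a else M $ a $ b))"

text \<open>
  Unlike \<^const>\<open>matrix_inv\<close>, Cramer's formula is visibly a Borel function on all matrices.
  For singular matrices it yields \<open>0\<close>, since \<open>x / 0 = 0\<close>.
\<close>

definition cinv :: "'a::field^'n^'n \<Rightarrow> 'a^'n^'n" where
  "cinv M = (\<chi> k j. inverse (det M) * adjugate M $ k $ j)"

lemma cinv:
  fixes M :: "'a::field^'n^'n"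
  assumes "det M \<noteq> 0"
  shows "M ** cinv M = mat 1" "cinv M ** M = mat 1"
proof -
  have "M *v column j (cinv M) = axis j 1" for j
    unfolding cramer[OF assms] by (simp add: vec_eq_iff column_def cinv_def adjugate_def field_simps)
  then have "(M ** cinv M) $ i $ j = mat 1 $ i $ j" for i j
    by (simp add: vec_eq_iff matrix_vector_mult_def matrix_matrix_mult_def column_def axis_def mat_def)
  then show "M ** cinv M = mat 1" by (simp add: vec_eq_iff)
  then show "cinv M ** M = mat 1" using matrix_left_right_inverse by blast
qed

lemma cinv_unique:
  fixes M :: "'a::field^'n^'n"
  assumes "M ** N = mat 1"
  shows "det M \<noteq> 0" "cinv M = N"
proof -
  have "det M * det N = 1" using assms by (metis det_mul det_I)
  then show d: "det M \<noteq> 0" by auto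
  have "cinv M = cinv M ** (M ** N)" by (simp add: assms)
  also have "\<dots> = N" by (simp add: matrix_mul_assoc cinv[OF d])
  finally show "cinv M = N" .
qed

text \<open>A kernel vector is repeated in every column, so that later arguments stay with matrix
  products and the Frobenius norm.\<close>

lemma singular_matrix_annihilates:
  fixes M :: "'a::field^'n^'n"
  assumes "det M = 0"
  shows "\<exists>X :: 'a^'n^'n. X \<noteq> 0 \<and> M ** X = 0"
proof -
  have "\<not> (\<exists>B. B ** M = mat 1)"
    using assms by (metis det_mul det_I mult_zero_right zero_neq_one)
  then obtain v where v: "v \<noteq> 0" "M *v v = 0"
    unfolding matrix_left_invertible_ker by auto
  show ?thesis
  proof (intro exI conjI)
    show "(\<chi> i j. v $ i) \<noteq> (0 :: 'a^'n^'n)" using v(1) by (simp add: vec_eq_iff)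
    show "M ** (\<chi> i j. v $ i) = 0"
      using v(2) by (simp add: vec_eq_iff matrix_matrix_mult_def matrix_vector_mult_def)
  qed
qed

lemmas continuous_on_vec_nth' = bounded_linear.continuous_on[OF bounded_linear_vec_nth]

lemma continuous_on_det [continuous_intros]:
  fixes f :: "'b::topological_space \<Rightarrow> 'a::rc_field^'n^'n"
  assumes "continuous_on S f"
  shows "continuous_on S (\<lambda>x. det (f x))"
  unfolding det_def
  by (intro continuous_intros continuous_on_vec_nth' assms)

lemma continuous_on_adjugate: "continuous_on S (adjugate :: 'a::rc_field^'n^'n \<Rightarrow> _)"
  unfolding adjugate_def
proof (intro continuous_on_vec_lambda continuous_on_det)
  fix k j a b :: 'n
  show "continuous_on S (\<lambda>M::'a^'n^'n. if b = k then axis j 1 $ a else M $ a $ b)"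
    by (cases "b = k") (simp_all add: continuous_on_vec_nth' continuous_on_id)
qed

lemma continuous_on_mat_scale:
  "continuous_on UNIV (\<lambda>z. (\<chi> k j. fst z * snd z $ k $ j) :: 'a::rc_field^'n^'m)"
  by (intro continuous_intros continuous_on_vec_nth' continuous_on_vec_lambda)

lemma tendsto_cinv:
  fixes f :: "'b \<Rightarrow> 'a::rc_field^'n^'n"
  assumes f: "(f \<longlongrightarrow> M) F" and "det M \<noteq> 0"
  shows "((\<lambda>x. cinv (f x)) \<longlongrightarrow> cinv M) F"
proof -
  have "isCont det M" "isCont adjugate M"
    using continuous_on_det[OF continuous_on_id, of UNIV] continuous_on_adjugate[of UNIV]
    by (auto simp: continuous_on_eq_continuous_at)
  then have d: "((\<lambda>x. det (f x)) \<longlongrightarrow> det M) F" and a: "((\<lambda>x. adjugate (f x)) \<longlongrightarrow> adjugate M) F"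
    using f isCont_tendsto_compose by blast+
  have "((\<lambda>x. (\<chi> k j. inverse (det (f x)) * adjugate (f x) $ k $ j)) \<longlongrightarrow>
      (\<chi> k j. inverse (det M) * adjugate M $ k $ j)) F"
    using assms(2) by (intro tendsto_vec_lambda tendsto_mult tendsto_inverse d tendsto_vec_nth a)
  then show ?thesis by (simp add: cinv_def)
qed

lemma borel_measurable_cinv [measurable]:
  fixes f :: "'b \<Rightarrow> 'a::rc_field^'n^'n"
  assumes [measurable]: "f \<in> borel_measurable M"
  shows "(\<lambda>x. cinv (f x)) \<in> borel_measurable M"
proof -
  have [measurable]: "(det :: 'a^'n^'n \<Rightarrow> 'a) \<in> borel_measurable borel"
    "(adjugate :: 'a^'n^'n \<Rightarrow> _) \<in> borel_measurable borel"
    by (auto intro!: borel_measurable_continuous_onI continuous_intros continuous_on_adjugate)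
  have "(\<lambda>x. (\<chi> k j. inverse (det (f x)) * adjugate (f x) $ k $ j)) \<in> borel_measurable M"
    by (rule borel_measurable_continuous_Pair[OF _ _ continuous_on_mat_scale[unfolded split_def[symmetric]],
          of "\<lambda>x. inverse (det (f x))" M "\<lambda>x. adjugate (f x)", simplified]) measurable
  then show ?thesis by (simp add: cinv_def)
qed

lemma borel_measurable_det [measurable]:
  fixes f :: "'b \<Rightarrow> 'a::rc_field^'n^'n"
  assumes "f \<in> borel_measurable M"
  shows "(\<lambda>x. det (f x)) \<in> borel_measurable M"
  using assms by (rule borel_measurable_continuous_on[OF continuous_on_det[OF continuous_on_id]])

subsection \<open>Sums over the standard basis of a matrix space\<close>

lemma Basis_vec_reindex:
  "inj_on (\<lambda>p. axis (fst p) (snd p) :: 'a::euclidean_space^'n) (UNIV \<times> Basis)"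
  "(Basis :: ('a::euclidean_space^'n) set) = (\<lambda>p. axis (fst p) (snd p)) ` (UNIV \<times> Basis)"
  by (auto simp: inj_on_def axis_eq_axis) (force simp: Basis_vec_def)+

lemma sum_Basis_vec:
  "(\<Sum>e\<in>(Basis :: ('a::euclidean_space^'n) set). F e) = (\<Sum>i\<in>UNIV. \<Sum>u\<in>Basis. F (axis i u))"
  unfolding Basis_vec_reindex(2)
  by (simp add: sum.reindex[OF Basis_vec_reindex(1)] sum.cartesian_product split_def)

lemma prod_Basis_vec:
  "(\<Prod>e\<in>(Basis :: ('a::euclidean_space^'n) set). F e) = (\<Prod>i\<in>UNIV. \<Prod>u\<in>Basis. F (axis i u))"
  unfolding Basis_vec_reindex(2)
  by (simp add: prod.reindex[OF Basis_vec_reindex(1)] prod.cartesian_product split_def)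

lemma matrix_axis_nth:
  fixes b :: "'a::rc_field"
  shows "(X ** axis i (axis j b) ** Y) $ k $ l = X $ k $ i * b * Y $ j $ l"
proof -
  have "(X ** axis i (axis j b)) $ k $ q = (if q = j then X $ k $ i * b else 0)" for q
  proof -
    have "X $ k $ p * axis i (axis j b) $ p $ q = (if p = i then X $ k $ i * axis j b $ q else 0)" for p
      by (cases "p = i") (simp, simp add: axis_def)
    then have "(X ** axis i (axis j b)) $ k $ q = (\<Sum>p\<in>UNIV. if p = i then X $ k $ i * axis j b $ q else 0)"
      by (simp add: matrix_matrix_mult_def)
    then show ?thesis by (simp add: axis_def)
  qed
  then show ?thesis
    by (subst matrix_matrix_mult_def) (simp add: if_distrib[of "\<lambda>t. t * _"] cong: if_cong)
qed

lemma inner_axis_matrix: "inner (axis i (axis j b)) Z = inner b (Z $ i $ j)"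
  by (simp add: inner_axis')

lemma adj_axis: "adj (axis i (axis j (b::'a::conjugatable_field))) = axis j (axis i (conjugate b))"
  by (simp add: vec_eq_iff axis_def)

lemma inner_mat_1_right: "inner X (mat 1 :: 'a::rc_field^'n^'n) = (\<Sum>i\<in>UNIV. inner (X $ i $ i) 1)"
proof -
  have "inner X (mat 1 :: 'a^'n^'n) = (\<Sum>i\<in>UNIV. \<Sum>j\<in>UNIV. if i = j then inner (X $ i $ i) 1 else 0)"
    unfolding inner_vec_def mat_def by (intro sum.cong refl) auto
  then show ?thesis by simp
qed

text \<open>The left side is the real trace of the map E \<mapsto> X E Y. A Hermitian
  \<open>X\<close> has a real diagonal, so every basis scalar contributes the same product of
  diagonal entries.\<close>

lemma sum_Basis_sandwich:
  fixes X :: "'a::rc_field^'s^'s" and Y :: "'a^'m^'m"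
  assumes X: "adj X = X"
  shows "(\<Sum>E\<in>(Basis :: ('a^'m^'s) set). inner E (X ** E ** Y))
    = real DIM('a) * (inner X (mat 1) * inner Y (mat 1))"
proof -
  have "inner b (x * b * y) = inner x 1 * inner y 1"
    if b: "b \<in> Basis" and x: "conjugate x = x" for b x y :: 'a
  proof -
    have "inner b (x * b * y) = inner (b * (inner x 1 *\<^sub>R 1)) (b * y)"
      by (subst self_conj_imp_real[OF x]) simp
    also have "\<dots> = inner x 1 * inner 1 (conjugate b * (b * y))"
      by (simp add: inner_mult_conj)
    also have "conjugate b * (b * y) = y"
      using conj_mult_self[of b] b by (simp add: mult.assoc[symmetric])
    finally show ?thesis by (simp add: inner_commute)
  qed
  moreover have "conjugate (X $ i $ i) = X $ i $ i" for i
    using arg_cong[OF X, of "\<lambda>M. M $ i $ i"] by simp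
  ultimately show ?thesis
    by (simp add: sum_Basis_vec inner_axis_matrix matrix_axis_nth inner_mat_1_right
        sum_distrib_left[symmetric] sum_distrib_right[symmetric])
qed

text \<open>Here the map is antilinear in E: over the complex numbers the contributions of 1 and
  \<i> cancel, over the reals the single one remains.\<close>

lemma sum_Basis_sandwich_adj:
  fixes Z :: "'a::rc_field^'m^'s"
  shows "(\<Sum>E\<in>(Basis :: ('a^'m^'s) set). inner E (Z ** adj E ** Z)) = (2 - real DIM('a)) * (norm Z)\<^sup>2"
proof -
  have "(norm Z)\<^sup>2 = (\<Sum>i\<in>UNIV. \<Sum>j\<in>UNIV. (norm (Z $ i $ j))\<^sup>2)"
    by (simp add: norm_vec_def L2_set_def sum_nonneg)
  then show ?thesis
    by (simp add: sum_Basis_vec inner_axis_matrix matrix_axis_nth adj_axis Basis_sum_conj sum_distrib_left[symmetric])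
qed

text \<open>Squared Hilbert-Schmidt norm of E \<mapsto> X E Y, in the form produced by
  \<open>nn_integral_gauss_affine_sq\<close>.\<close>

lemma sum_Basis_norm_sq:
  fixes X :: "'a::rc_field^'s^'k" and Y :: "'a^'n^'m"
  shows "(\<Sum>E\<in>(Basis :: ('a^'m^'s) set). (norm (X ** E ** Y))\<^sup>2) = real DIM('a) * ((norm X)\<^sup>2 * (norm Y)\<^sup>2)"
proof -
  have "(norm (X ** E ** Y))\<^sup>2 = inner E (adj X ** X ** E ** (Y ** adj Y))" for E :: "'a^'m^'s"
    unfolding power2_norm_eq_inner inner_mult_right[of "X ** E"] inner_mult_left[of X]
    by (simp add: matrix_mul_assoc)
  moreover have "inner (adj X ** X) (mat 1) = (norm X)\<^sup>2" "inner (Y ** adj Y) (mat 1) = (norm Y)\<^sup>2"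
    using inner_mult_left[of "adj X" X "mat 1"] inner_mult_right[of Y "adj Y" "mat 1"]
    by (simp_all add: power2_norm_eq_inner)
  ultimately show ?thesis
    by (simp add: sum_Basis_sandwich adj_mult)
qed

subsection \<open>Regularized least squares\<close>

text \<open>The summand \<open>mat 1 - \<P>\<close> fills the kernel of \<open>\<P>\<close>, so an
  ordinary inverse exists on the whole space as soon as the Gram matrix is invertible on the range
  of \<open>\<P>\<close>. The factor \<open>\<P>\<close> in \<open>resolvent\<close> discards the
  filling afterwards.\<close>

definition pgram :: "real \<Rightarrow> 'a::rc_field^'m^'m \<Rightarrow> 'a^'m^'s \<Rightarrow> 'a^'m^'m" where
  "pgram e \<P> G = adj (G ** \<P>) ** (G ** \<P>) + (mat 1 - \<P>) + e *\<^sub>R mat 1"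

definition resolvent :: "real \<Rightarrow> 'a::rc_field^'m^'m \<Rightarrow> 'a^'m^'s \<Rightarrow> 'a^'m^'m" where
  "resolvent e \<P> G = cinv (pgram e \<P> G) ** \<P>"

text \<open>For \<open>e = 0\<close> this is almost surely the pseudoinverse of \<open>G ** \<P>\<close>.\<close>

definition lsq :: "real \<Rightarrow> 'a::rc_field^'m^'m \<Rightarrow> 'a^'m^'s \<Rightarrow> 'a^'s^'m" where
  "lsq e \<P> G = cinv (pgram e \<P> G) ** adj (G ** \<P>)"

lemma borel_measurable_pgram [measurable]:
  assumes [measurable]: "f \<in> borel_measurable M" "g \<in> borel_measurable M"
  shows "(\<lambda>x. pgram e (f x) (g x)) \<in> borel_measurable M"
  unfolding pgram_def by measurable

lemma borel_measurable_resolvent [measurable]: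
  assumes [measurable]: "f \<in> borel_measurable M" "g \<in> borel_measurable M"
  shows "(\<lambda>x. resolvent e (f x) (g x)) \<in> borel_measurable M"
  unfolding resolvent_def by measurable

lemma borel_measurable_lsq [measurable]:
  assumes [measurable]: "f \<in> borel_measurable M" "g \<in> borel_measurable M"
  shows "(\<lambda>x. lsq e (f x) (g x)) \<in> borel_measurable M"
  unfolding lsq_def by measurable

text \<open>Three nonnegative terms: for e > 0 they make \<open>pgram\<close> definite, for e = 0
  they locate its kernel inside the range of \<open>\<P>\<close>.\<close>

lemma inner_pgram:
  fixes G :: "'a::rc_field^'m^'s"
  assumes P: "projector \<P>"
  shows "inner X (pgram e \<P> G ** X) = (norm (G ** \<P> ** X))\<^sup>2 + (norm (X - \<P> ** X))\<^sup>2 + e * (norm X)\<^sup>2"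
proof -
  have "inner X (adj (G ** \<P>) ** (G ** \<P>) ** X) = (norm (G ** \<P> ** X))\<^sup>2"
    using inner_mult_left[of "G ** \<P>" X "G ** \<P> ** X"] by (simp add: power2_norm_eq_inner matrix_mul_assoc)
  moreover have "inner X (X - \<P> ** X) = (norm (X - \<P> ** X))\<^sup>2"
  proof -
    have "inner (\<P> ** X) (X - \<P> ** X) = 0"
      using projectorD[OF P] by (simp add: inner_mult_left matrix_algebra)
    then show ?thesis by (simp add: power2_norm_eq_inner inner_diff_left)
  qed
  ultimately show ?thesis
    by (simp add: pgram_def matrix_ring_simps inner_add_right power2_norm_eq_inner)
qed

lemma det_pgram_nonzero:
  fixes G :: "'a::rc_field^'m^'s"
  assumes P: "projector \<P>" and "0 < e"
  shows "det (pgram e \<P> G) \<noteq> 0"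
proof
  assume "det (pgram e \<P> G) = 0"
  from singular_matrix_annihilates[OF this] obtain X :: "'a^'m^'m"
    where X: "X \<noteq> 0" "pgram e \<P> G ** X = 0" by auto
  then have "0 = (norm (G ** \<P> ** X))\<^sup>2 + (norm (X - \<P> ** X))\<^sup>2 + e * (norm X)\<^sup>2"
    using inner_pgram[OF P, of X e G] by simp
  moreover have "0 < e * (norm X)\<^sup>2" using assms X by simp
  ultimately show False
    using zero_le_power2[of "norm (G ** \<P> ** X)"] zero_le_power2[of "norm (X - \<P> ** X)"] by linarith
qed

context
  fixes \<P> :: "'a::rc_field^'m^'m" and G :: "'a^'m^'s" and e :: real
  assumes P: "projector \<P>" and nz: "det (pgram e \<P> G) \<noteq> 0"
begin

lemma adj_pgram: "adj (pgram e \<P> G) = pgram e \<P> G"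
  using projectorD[OF P] by (simp add: pgram_def adj_simps matrix_mul_assoc)

lemma pgram_commute: "pgram e \<P> G ** \<P> = \<P> ** pgram e \<P> G"
  using projectorD[OF P] projector_assoc[OF P]
  by (simp add: pgram_def adj_simps matrix_algebra)

lemma adj_cinv_pgram: "adj (cinv (pgram e \<P> G)) = cinv (pgram e \<P> G)"
proof (rule cinv_unique(2)[symmetric])
  show "pgram e \<P> G ** adj (cinv (pgram e \<P> G)) = mat 1"
    using arg_cong[OF cinv(2)[OF nz], of adj] by (simp add: adj_mult adj_pgram)
qed

lemma cinv_pgram_commute: "cinv (pgram e \<P> G) ** \<P> = \<P> ** cinv (pgram e \<P> G)"
proof -
  let ?M = "pgram e \<P> G" and ?C = "cinv (pgram e \<P> G)"
  have "?C ** \<P> = ?C ** (\<P> ** ?M) ** ?C"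
    using cinv(1)[OF nz] by (simp add: matrix_mul_assoc[symmetric])
  also have "\<dots> = (?C ** ?M) ** \<P> ** ?C"
    by (simp only: pgram_commute[symmetric] matrix_mul_assoc)
  finally show ?thesis by (simp add: cinv(2)[OF nz])
qed

lemma resolvent_simps:
  "adj (resolvent e \<P> G) = resolvent e \<P> G"
  "resolvent e \<P> G ** \<P> = resolvent e \<P> G"
  "\<P> ** resolvent e \<P> G = resolvent e \<P> G"
  "lsq e \<P> G = resolvent e \<P> G ** adj G"
proof -
  have c: "resolvent e \<P> G = \<P> ** cinv (pgram e \<P> G)"
    by (simp add: resolvent_def cinv_pgram_commute)
  show "adj (resolvent e \<P> G) = resolvent e \<P> G"
    using c projectorD[OF P] by (simp add: resolvent_def adj_mult adj_cinv_pgram)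
  show "resolvent e \<P> G ** \<P> = resolvent e \<P> G"
    unfolding resolvent_def by (rule projector_assoc[OF P])
  show "\<P> ** resolvent e \<P> G = resolvent e \<P> G"
    unfolding c matrix_mul_assoc projectorD(2)[OF P] ..
  show "lsq e \<P> G = resolvent e \<P> G ** adj G"
    using projectorD[OF P] by (simp add: lsq_def resolvent_def adj_mult matrix_mul_assoc)
qed

text \<open>Cancel the inverse against \<open>pgram e \<P> G ** \<P>\<close>. At e = 0 this makes
  \<open>lsq\<close> a left inverse of \<open>G\<close> on the range of \<open>\<P>\<close>;
  otherwise the defect is e times the resolvent.\<close>

lemma resolvent_gram:
  "resolvent e \<P> G ** adj G ** G ** \<P> = \<P> - e *\<^sub>R resolvent e \<P> G"
proof -
  let ?M = "pgram e \<P> G" and ?C = "cinv (pgram e \<P> G)"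
  have "?M ** \<P> = adj (G ** \<P>) ** G ** \<P> + e *\<^sub>R \<P>"
    using projectorD[OF P] projector_assoc[OF P]
    by (simp add: pgram_def matrix_algebra)
  then have "\<P> = ?C ** (adj (G ** \<P>) ** G ** \<P> + e *\<^sub>R \<P>)"
    using cinv(2)[OF nz] by (metis matrix_mul_assoc matrix_mul_lid)
  also have "\<dots> = resolvent e \<P> G ** adj G ** G ** \<P> + e *\<^sub>R resolvent e \<P> G"
    using projectorD[OF P]
    by (simp add: resolvent_def adj_mult matrix_algebra)
  finally show ?thesis by (simp add: eq_diff_eq)
qed

lemma resolvent_gram_resolvent:
  "resolvent e \<P> G ** adj G ** G ** resolvent e \<P> G
    = resolvent e \<P> G - e *\<^sub>R (resolvent e \<P> G ** resolvent e \<P> G)"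
  using arg_cong[OF resolvent_gram, of "\<lambda>X. X ** resolvent e \<P> G"] resolvent_simps(3)
  by (simp add: matrix_ring_simps matrix_mul_assoc[symmetric])

text \<open>\<open>G ** resolvent e \<P> G\<close> is the adjoint of \<open>lsq e \<P> G\<close>.
  For e > 0 the trace of the resolvent therefore dominates the squared norm of the regularized
  pseudoinverse.\<close>

lemma trace_resolvent:
  "inner (resolvent e \<P> G) (mat 1)
    = (norm (G ** resolvent e \<P> G))\<^sup>2 + e * (norm (resolvent e \<P> G))\<^sup>2"
proof -
  let ?W = "resolvent e \<P> G"
  have "inner (?W ** ?W) (mat 1) = (norm ?W)\<^sup>2"
    using inner_mult_left[of ?W ?W "mat 1"] by (simp add: resolvent_simps(1) power2_norm_eq_inner)
  moreover have "inner (?W ** adj G ** G ** ?W) (mat 1) = (norm (G ** ?W))\<^sup>2"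
    using inner_mult_left[of "?W ** adj G" "G ** ?W" "mat 1"]
    by (simp add: resolvent_simps(1) adj_mult power2_norm_eq_inner matrix_mul_assoc)
  ultimately show ?thesis
    using resolvent_gram_resolvent by (simp add: inner_diff_left)
qed

text \<open>With W the resolvent, G W adj G is a regularized projector onto the range of
  \<open>G ** \<P>\<close>. For e > 0 its trace and its squared norm are at most the trace of
  \<open>\<P>\<close>, uniformly in G.\<close>

lemma inner_resolvent_gram:
  "inner G (G ** resolvent e \<P> G) = inner \<P> (mat 1) - e * inner (resolvent e \<P> G) (mat 1)"
  "inner (G ** resolvent e \<P> G ** adj G) (mat 1) = inner G (G ** resolvent e \<P> G)"
  "inner G (G ** resolvent e \<P> G)
    = (norm (G ** resolvent e \<P> G ** adj G))\<^sup>2 + e * (norm (G ** resolvent e \<P> G))\<^sup>2"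
proof -
  let ?W = "resolvent e \<P> G"
  show "inner (G ** ?W ** adj G) (mat 1) = inner G (G ** ?W)"
    using inner_mult_right[of "G ** ?W" "adj G" "mat 1"] by (simp add: inner_commute)
  have "inner G (G ** ?W) = inner (adj G ** G) ?W"
    by (metis adj_adj inner_mult_left)
  also have "\<dots> = inner (adj G ** G ** \<P>) ?W"
    using inner_mult_right[of "adj G ** G" \<P> ?W] projectorD[OF P] by (simp add: resolvent_simps(2))
  also have "\<dots> = inner (?W ** (adj G ** G ** \<P>)) (mat 1)"
    using inner_mult_left[of ?W "adj G ** G ** \<P>" "mat 1"] by (simp add: resolvent_simps(1))
  also have "?W ** (adj G ** G ** \<P>) = \<P> - e *\<^sub>R ?W"
    using resolvent_gram by (simp add: matrix_mul_assoc)
  finally show "inner G (G ** ?W) = inner \<P> (mat 1) - e * inner ?W (mat 1)"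
    by (simp add: inner_diff_left)
  have "inner G (G ** ?W) = inner (G ** (?W ** adj G ** G ** ?W + e *\<^sub>R (?W ** ?W))) G"
    by (simp add: resolvent_gram_resolvent inner_commute)
  also have "\<dots> = inner (G ** ?W ** adj G ** (G ** ?W)) G + e * inner (G ** ?W ** ?W) G"
    by (simp add: matrix_ring_simps inner_add_left matrix_mul_assoc)
  also have "inner (G ** ?W ** adj G ** (G ** ?W)) G = (norm (G ** ?W ** adj G))\<^sup>2"
    unfolding inner_mult_right[of "G ** ?W ** adj G" "G ** ?W"]
    by (simp add: adj_mult resolvent_simps(1) power2_norm_eq_inner matrix_mul_assoc)
  also have "inner (G ** ?W ** ?W) G = (norm (G ** ?W))\<^sup>2"
    unfolding inner_mult_right[of "G ** ?W" ?W]
    by (simp add: resolvent_simps(1) power2_norm_eq_inner)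
  finally show "inner G (G ** ?W) = (norm (G ** ?W ** adj G))\<^sup>2 + e * (norm (G ** ?W))\<^sup>2" .
qed

end

lemma lsq_zero:
  fixes G :: "'a::rc_field^'m^'s"
  assumes P: "projector \<P>" and nz: "det (pgram 0 \<P> G) \<noteq> 0"
  shows "lsq 0 \<P> G ** G ** \<P> = \<P>" "\<P> ** lsq 0 \<P> G = lsq 0 \<P> G" "adj (G ** lsq 0 \<P> G) = G ** lsq 0 \<P> G"
  using resolvent_gram[OF P nz] resolvent_simps[OF P nz]
  by (simp_all add: matrix_mul_assoc adj_mult)

subsection \<open>The inverse moment bound\<close>

text \<open>The resolvent identity is exact, so the difference quotient is an explicit expression
  whose limit follows from continuity of the inverse. The two subtracted terms come from the two
  factors of the Gram matrix.\<close>

lemma resolvent_field_derivative: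
  fixes G E :: "'a::rc_field^'m^'s"
  assumes P: "projector \<P>" and e: "0 < e"
  defines "W \<equiv> resolvent e \<P>"
  shows "((\<lambda>t. inner E ((G + t *\<^sub>R E) ** W (G + t *\<^sub>R E))) has_real_derivative
    (inner E (E ** W G) - inner E (G ** W G ** adj E ** (G ** W G))
      - inner E (G ** W G ** adj G ** E ** W G))) (at 0)"
proof -
  let ?M = "\<lambda>t. pgram e \<P> (G + t *\<^sub>R E)" and ?W = "\<lambda>t. W (G + t *\<^sub>R E)"
  define K where "K t = adj E ** G + adj G ** E + t *\<^sub>R (adj E ** E)" for t
  have nz: "det (?M t) \<noteq> 0" for t by (rule det_pgram_nonzero[OF P e])
  have nz0: "det (pgram e \<P> G) \<noteq> 0" by (rule det_pgram_nonzero[OF P e])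
  have "?M t - pgram e \<P> G = t *\<^sub>R (\<P> ** K t ** \<P>)" for t
    using projectorD[OF P]
    by (simp add: pgram_def K_def matrix_ring_simps adj_simps matrix_mul_assoc scaleR_add_right)
  then have M: "?M t = pgram e \<P> G + t *\<^sub>R (\<P> ** K t ** \<P>)" for t
    by (metis add.commute diff_add_cancel)
  \<comment> \<open>Resolvent identity: t times \<open>K t\<close>, compressed by
    \<open>\<P>\<close>, is the exact increment of \<open>pgram\<close>.\<close>
  have W: "?W t = W G - t *\<^sub>R (?W t ** K t ** W G)" for t
  proof -
    have "cinv (?M t) ** ?M t ** W G = W G"
      by (simp add: cinv(2)[OF nz])
    then have "W G = cinv (?M t) ** pgram e \<P> G ** (cinv (pgram e \<P> G) ** \<P>)
        + t *\<^sub>R (cinv (?M t) ** \<P> ** K t ** (\<P> ** W G))"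
      unfolding M[of t] by (simp add: matrix_algebra W_def resolvent_def)
    also have "cinv (?M t) ** pgram e \<P> G ** (cinv (pgram e \<P> G) ** \<P>) = ?W t"
      using cinv(1)[OF nz0] by (metis W_def resolvent_def matrix_mul_assoc matrix_mul_rid)
    also have "cinv (?M t) ** \<P> ** K t ** (\<P> ** W G) = ?W t ** K t ** W G"
      unfolding W_def resolvent_simps(3)[OF P nz0] by (simp add: resolvent_def)
    finally show ?thesis by (simp add: eq_diff_eq)
  qed
  have "((\<lambda>t. pgram e \<P> G + t *\<^sub>R (\<P> ** K t ** \<P>)) \<longlongrightarrow> pgram e \<P> G + 0 *\<^sub>R (\<P> ** K 0 ** \<P>)) (at 0)"
    unfolding K_def by (intro tendsto_intros)
  then have "(?M \<longlongrightarrow> pgram e \<P> G) (at 0)"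
    unfolding M by simp
  then have W0: "(?W \<longlongrightarrow> W G) (at 0)"
    unfolding W_def resolvent_def by (intro tendsto_intros tendsto_cinv nz0)
  have "((\<lambda>t. inner E (E ** ?W t) - inner E (G ** (?W t ** K t ** W G)))
      \<longlongrightarrow> inner E (E ** W G) - inner E (G ** (W G ** K 0 ** W G))) (at 0)"
    unfolding K_def by (intro tendsto_intros W0)
  moreover have "\<forall>\<^sub>F t in at 0. inner E (E ** ?W t) - inner E (G ** (?W t ** K t ** W G))
      = (inner E ((G + t *\<^sub>R E) ** ?W t) - inner E ((G + 0 *\<^sub>R E) ** ?W 0)) / (t - 0)"
  proof (rule eventually_at_filter[THEN iffD2], intro always_eventually allI impI)
    fix t :: real assume "t \<noteq> 0"
    have "G ** ?W t = G ** W G - t *\<^sub>R (G ** (?W t ** K t ** W G))"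
      by (subst W) (simp only: matrix_ring_simps)
    then have "(G + t *\<^sub>R E) ** ?W t = G ** W G + t *\<^sub>R (E ** ?W t - G ** (?W t ** K t ** W G))"
      by (simp add: matrix_add_rdistrib' matrix_scaleR_left scaleR_diff_right)
    then have "inner E ((G + t *\<^sub>R E) ** ?W t) - inner E (G ** W G)
      = t * (inner E (E ** ?W t) - inner E (G ** (?W t ** K t ** W G)))"
      by (simp only: inner_add_right inner_scaleR_right inner_diff_right add_diff_cancel_left')
    with \<open>t \<noteq> 0\<close> show "inner E (E ** ?W t) - inner E (G ** (?W t ** K t ** W G))
      = (inner E ((G + t *\<^sub>R E) ** ?W t) - inner E ((G + 0 *\<^sub>R E) ** ?W 0)) / (t - 0)"
      by simp
  qed
  ultimately have "((\<lambda>t. (inner E ((G + t *\<^sub>R E) ** ?W t) - inner E ((G + 0 *\<^sub>R E) ** ?W 0)) / (t - 0))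
      \<longlongrightarrow> inner E (E ** W G) - inner E (G ** (W G ** K 0 ** W G))) (at 0)"
    by (rule Lim_transform_eventually)
  moreover have "inner E (G ** (W G ** K 0 ** W G))
    = inner E (G ** W G ** adj E ** (G ** W G)) + inner E (G ** W G ** adj G ** E ** W G)"
    by (simp add: K_def matrix_ring_simps inner_add_right matrix_mul_assoc)
  ultimately show ?thesis
    unfolding has_field_derivative_iff by (simp add: algebra_simps)
qed

text \<open>
  Integration by parts for the vector field \<open>G \<mapsto> G ** resolvent e \<P> G\<close>: its inner product with
  \<open>G\<close> is at most the trace of \<open>\<P>\<close>, while its divergence controls the trace of the resolvent.
\<close>

lemma trace_resolvent_bound:
  fixes \<P> :: "'a::rc_field^'m^'m"
  assumes P: "projector \<P>" and e: "0 < e"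
  defines "p \<equiv> inner \<P> (mat 1)"
    and "w \<equiv> (\<lambda>G :: 'a^'m^'s. inner (resolvent e \<P> G) (mat 1))"
    and "d \<equiv> real DIM('a) * real CARD('s) - real DIM('a) * inner \<P> (mat 1) + real DIM('a) - 2"
  assumes d: "0 < d"
  shows "(\<integral>\<^sup>+G. ennreal (w G) \<partial>gauss) \<le> ennreal (p / d)"
proof -
  interpret prob_space "gauss :: ('a^'m^'s) measure" by (rule prob_space_gauss)
  define W where "W = (resolvent e \<P> :: 'a^'m^'s \<Rightarrow> _)"
  have [measurable]: "W \<in> borel_measurable borel"
    unfolding W_def by measurable
  have nz: "det (pgram e \<P> G) \<noteq> 0" for G :: "'a^'m^'s"
    by (rule det_pgram_nonzero[OF P e])
  note tr = trace_resolvent[OF P nz, folded W_def] and ip = inner_resolvent_gram[OF P nz, folded W_def p_def]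
  have wW: "w G = inner (W G) (mat 1)" for G by (simp add: w_def W_def)
  have w0: "0 \<le> w G" for G
    using e by (simp add: wW tr)
  have ip0: "0 \<le> inner G (G ** W G)" for G
    unfolding ip(3) using e by simp
  have wp: "e * w G \<le> p" for G
    using ip(1)[of G] ip0[of G] unfolding wW by linarith
  have p0: "0 \<le> p"
    using order_trans[OF _ wp[of 0]] w0[of 0] e by simp
  have w_le: "w G \<le> p / e" for G
    using wp[of G] e by (simp add: field_simps)
  have X0: "0 \<le> e * (norm (W G))\<^sup>2" "0 \<le> e * (norm (G ** W G))\<^sup>2" "0 \<le> e * w G" for G
    using e w0[of G] by simp_all
  have X1: "(norm (G ** W G))\<^sup>2 \<le> p / e" for G
    using tr[of G] w_le[of G] X0(1)[of G] unfolding wW by linarith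
  have X2: "(norm (W G))\<^sup>2 \<le> p / e / e" for G
  proof -
    have "e * (norm (W G))\<^sup>2 \<le> p / e"
      using tr[of G] w_le[of G] zero_le_power2[of "norm (G ** W G)"] unfolding wW by linarith
    then show ?thesis using e by (simp add: field_simps)
  qed
  have X3: "(norm (G ** W G ** adj G))\<^sup>2 \<le> p" for G
    using ip(1)[of G] ip(3)[of G] X0(2,3)[of G] unfolding wW by linarith
  note Y1 = real_le_rsqrt[OF X1] and Y2 = real_le_rsqrt[OF X2] and Y3 = real_le_rsqrt[OF X3]
  \<comment> \<open>Integration by parts asks for one common bound; \<open>C\<close> adds up the
    bound on the field and those on the three terms of its derivative.\<close>
  define C where "C = sqrt (p / e) + (sqrt (p / e / e) + sqrt (p / e) * sqrt (p / e) + sqrt p * sqrt (p / e / e))"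
  define h where "h E G = inner E (G ** W G)" for E G
  define h' where "h' E G = inner E (E ** W G) - inner E (G ** W G ** adj E ** (G ** W G))
      - inner E (G ** W G ** adj G ** E ** W G)" for E G
  have part: "integrable gauss (\<lambda>G. inner G E * h E G) \<and> integrable gauss (h' E) \<and>
      (\<integral>G. inner G E * h E G \<partial>gauss) = (\<integral>G. h' E G \<partial>gauss)" if "E \<in> Basis" for E
  proof -
    have E: "norm E = 1" using that by simp
    have b: "\<bar>inner E Z\<bar> \<le> norm Z" for Z using Cauchy_Schwarz_ineq2[of E Z] E by simp
    have m: "norm (A ** B) \<le> a * b" if "norm A \<le> a" "norm B \<le> b" for A :: "'a^'p^'q" and B :: "'a^'r^'p" and a b
      using norm_matrix_mult[of A B] mult_mono[OF that order_trans[OF norm_ge_zero that(1)] norm_ge_zero]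
      by (rule order_trans)
    have hC: "\<bar>h E G\<bar> \<le> C" for G
    proof -
      have "0 \<le> sqrt (p / e / e) + sqrt (p / e) * sqrt (p / e) + sqrt p * sqrt (p / e / e)"
        using p0 e by (intro add_nonneg_nonneg mult_nonneg_nonneg) auto
      then show ?thesis
        using b[of "G ** W G"] Y1[of G] unfolding h_def C_def by linarith
    qed
    have h'C: "\<bar>h' E G\<bar> \<le> C" for G
    proof -
      have "\<bar>inner E (E ** W G)\<bar> \<le> 1 * sqrt (p / e / e)"
        by (intro order_trans[OF b] m Y1 Y2 Y3) (simp_all add: E)
      moreover have "\<bar>inner E (G ** W G ** adj E ** (G ** W G))\<bar> \<le> sqrt (p / e) * 1 * sqrt (p / e)"
        by (intro order_trans[OF b] m Y1 Y2 Y3) (simp_all add: E)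
      moreover have "\<bar>inner E (G ** W G ** adj G ** E ** W G)\<bar> \<le> sqrt p * 1 * sqrt (p / e / e)"
        by (intro order_trans[OF b] m Y1 Y2 Y3) (simp_all add: E)
      moreover have "0 \<le> sqrt (p / e)" using p0 e by simp
      ultimately show ?thesis unfolding h'_def C_def by linarith
    qed
    have mh: "h E \<in> borel_measurable borel" "h' E \<in> borel_measurable borel"
      unfolding h_def h'_def by measurable
    have D: "((\<lambda>t. h E (G + t *\<^sub>R E)) has_real_derivative h' E G) (at 0)" for G
      unfolding h_def h'_def W_def by (rule resolvent_field_derivative[OF P e])
    show ?thesis
      by (intro conjI gauss_integration_by_parts[OF E mh hC h'C D])
  qed
  have sum_h: "(\<Sum>E\<in>Basis. inner G E * h E G) = p - e * w G" for G
    using euclidean_inner[of G "G ** W G"] ip(1)[of G] by (simp add: h_def wW inner_commute)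
  \<comment> \<open>The divergence of the field. Its middle term carries 2 - \<beta>, which is
    nonnegative, so that term can be estimated by \<open>w\<close>; together with p - e w \<le> p
    this leaves d w below.\<close>
  have sum_h': "(\<Sum>E\<in>Basis. h' E G) = real DIM('a) * real CARD('s) * w G
      - (2 - real DIM('a)) * (norm (G ** W G))\<^sup>2 - real DIM('a) * ((p - e * w G) * w G)" for G
  proof -
    have "(\<Sum>E\<in>(Basis :: ('a^'m^'s) set). inner E (E ** W G)) = (\<Sum>E\<in>(Basis :: ('a^'m^'s) set). inner E (mat 1 ** E ** W G))" by simp
    also have "\<dots> = real DIM('a) * (inner (mat 1 :: 'a^'s^'s) (mat 1) * inner (W G) (mat 1))"
      by (rule sum_Basis_sandwich) simp
    finally have "(\<Sum>E\<in>(Basis :: ('a^'m^'s) set). inner E (E ** W G)) = real DIM('a) * real CARD('s) * w G"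
      by (simp add: inner_mat_1 wW)
    moreover have "(\<Sum>E\<in>Basis. inner E (G ** W G ** adj G ** E ** W G)) = real DIM('a) * ((p - e * w G) * w G)"
    proof (subst sum_Basis_sandwich)
      show "adj (G ** W G ** adj G) = G ** W G ** adj G"
        using resolvent_simps(1)[OF P nz, of G] by (simp add: W_def adj_mult matrix_mul_assoc)
    qed (simp add: ip(1,2) wW)
    ultimately show ?thesis
      unfolding h'_def by (simp add: sum_subtractf sum_Basis_sandwich_adj)
  qed
  have int_w: "integrable gauss w"
  proof (rule integrable_const_bound[of _ "p / e"])
    show "AE x in gauss. norm (w x) \<le> p / e"
      using wp w0 e by (simp add: field_simps)
    show "w \<in> borel_measurable gauss" unfolding wW by measurable
  qed
  have "(\<integral>G. d * w G \<partial>gauss) \<le> (\<integral>G. (\<Sum>E\<in>Basis. h' E G) \<partial>gauss)"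
  proof (rule integral_mono)
    show "integrable gauss (\<lambda>G. d * w G)" using int_w by simp
    show "integrable gauss (\<lambda>G. \<Sum>E\<in>Basis. h' E G)" using part by (intro Bochner_Integration.integrable_sum) auto
    fix G
    have "(norm (G ** W G))\<^sup>2 \<le> w G" using e by (simp add: wW tr)
    then have "(2 - real DIM('a)) * (norm (G ** W G))\<^sup>2 \<le> (2 - real DIM('a)) * w G"
      using card_Basis_le_2[where 'a='a] by (intro mult_left_mono) auto
    moreover have "real DIM('a) * ((p - e * w G) * w G) \<le> real DIM('a) * (p * w G)"
      using e w0[of G] by (intro mult_left_mono mult_right_mono) auto
    ultimately show "d * w G \<le> (\<Sum>E\<in>Basis. h' E G)"
      unfolding sum_h' d_def p_def[symmetric] by (simp add: algebra_simps)
  qed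
  also have "\<dots> = (\<Sum>E\<in>Basis. \<integral>G. h' E G \<partial>gauss)"
    using part by (intro Bochner_Integration.integral_sum) auto
  also have "\<dots> = (\<Sum>E\<in>Basis. \<integral>G. inner G E * h E G \<partial>gauss)"
    using part by (intro sum.cong) auto
  also have "\<dots> = (\<integral>G. (\<Sum>E\<in>Basis. inner G E * h E G) \<partial>gauss)"
    using part by (intro Bochner_Integration.integral_sum[symmetric]) auto
  also have "\<dots> \<le> (\<integral>G. p \<partial>(gauss :: ('a^'m^'s) measure))"
    unfolding sum_h using e w0 int_w by (intro integral_mono) auto
  also have "\<dots> = p" using prob_space by simp
  finally have "(\<integral>G. w G \<partial>gauss) \<le> p / d"
    using d by (simp add: field_simps)
  moreover have "(\<integral>\<^sup>+G. ennreal (w G) \<partial>gauss) = ennreal (\<integral>G. w G \<partial>gauss)"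
    using int_w w0 by (intro nn_integral_eq_integral) auto
  ultimately show ?thesis by (simp add: ennreal_leI)
qed

text \<open>The kernel of \<open>pgram 0\<close> lies in the range of \<open>\<P>\<close> and is an
  eigenspace of \<open>pgram e\<close> with eigenvalue e, so the resolvent has norm at least 1 /
  e.\<close>

lemma trace_resolvent_singular:
  fixes G :: "'a::rc_field^'m^'s"
  assumes P: "projector \<P>" and e: "0 < e" and s: "det (pgram 0 \<P> G) = 0"
  shows "1 / e \<le> inner (resolvent e \<P> G) (mat 1)"
proof -
  have nz: "det (pgram e \<P> G) \<noteq> 0" by (rule det_pgram_nonzero[OF P e])
  let ?W = "resolvent e \<P> G"
  from singular_matrix_annihilates[OF s] obtain X :: "'a^'m^'m"
    where X: "X \<noteq> 0" "pgram 0 \<P> G ** X = 0" by auto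
  have "(norm (X - \<P> ** X))\<^sup>2 \<le> 0"
    using inner_pgram[OF P, of X 0 G] X zero_le_power2[of "norm (G ** \<P> ** X)"] by simp
  then have PX: "\<P> ** X = X" by simp
  have "pgram e \<P> G = pgram 0 \<P> G + e *\<^sub>R mat 1" by (simp add: pgram_def)
  then have MX: "pgram e \<P> G ** X = e *\<^sub>R X" by (simp add: matrix_ring_simps X)
  have "X = cinv (pgram e \<P> G) ** (pgram e \<P> G ** X)"
    by (simp add: matrix_mul_assoc cinv[OF nz])
  also have "\<dots> = e *\<^sub>R (cinv (pgram e \<P> G) ** X)"
    unfolding MX by (simp add: matrix_ring_simps)
  also have "cinv (pgram e \<P> G) ** X = ?W ** X"
    by (simp add: resolvent_def matrix_mul_assoc[symmetric] PX)
  finally have "norm X = e * norm (?W ** X)"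
    using e by (metis abs_of_pos norm_scaleR)
  also have "\<dots> \<le> e * (norm ?W * norm X)"
    using e by (intro mult_left_mono norm_matrix_mult) auto
  finally have "1 / e \<le> norm ?W"
    using X(1) e by (simp add: field_simps)
  then have "e * (1 / e)\<^sup>2 \<le> e * (norm ?W)\<^sup>2"
    using e by (intro mult_left_mono power_mono) auto
  then have "1 / e \<le> e * (norm ?W)\<^sup>2"
    using e by (simp add: power2_eq_square)
  also have "\<dots> \<le> inner ?W (mat 1)"
    unfolding trace_resolvent[OF P nz] by simp
  finally show ?thesis .
qed

text \<open>The expected trace of the resolvent is bounded uniformly in e, while on the singular set
  the trace is at least 1 / e. By Fatou's lemma that set is null.\<close>

lemma AE_pgram_nonsingular:
  fixes \<P> :: "'a::rc_field^'m^'m"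
  assumes P: "projector \<P>"
    and d: "0 < real DIM('a) * real CARD('s) - real DIM('a) * inner \<P> (mat 1) + real DIM('a) - 2"
  shows "AE G in (gauss :: ('a^'m^'s) measure). det (pgram 0 \<P> G) \<noteq> 0"
proof -
  define e where "e n = inverse (real (Suc n))" for n
  have e: "0 < e n" for n by (simp add: e_def)
  let ?w = "\<lambda>n (G :: 'a^'m^'s). inner (resolvent (e n) \<P> G) (mat 1)"
  let ?l = "\<lambda>G. liminf (\<lambda>n. ennreal (?w n G))"
  note bound = trace_resolvent_bound[OF P e d]
  have "(\<integral>\<^sup>+G. ?l G \<partial>gauss) \<le> liminf (\<lambda>n. \<integral>\<^sup>+G. ennreal (?w n G) \<partial>gauss)"
    by (rule nn_integral_liminf) measurable
  also have "\<dots> \<le> limsup (\<lambda>n. \<integral>\<^sup>+G. ennreal (?w n G) \<partial>gauss)"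
    by (rule Liminf_le_Limsup) simp
  also have "\<dots> < \<infinity>"
    by (rule le_less_trans[OF Limsup_bounded[OF always_eventually[OF allI[OF bound]]]]) simp
  finally have "AE G in gauss. ?l G \<noteq> \<infinity>"
    by (intro nn_integral_noteq_infinite) auto
  then show ?thesis
  proof eventually_elim
    fix G :: "'a^'m^'s" assume fin: "?l G \<noteq> \<infinity>"
    show "det (pgram 0 \<P> G) \<noteq> 0"
    proof
      assume s: "det (pgram 0 \<P> G) = 0"
      have "of_nat n \<le> ennreal (?w n G)" for n
      proof -
        have "real n \<le> 1 / e n" by (simp add: e_def divide_inverse)
        also have "\<dots> \<le> ?w n G" by (rule trace_resolvent_singular[OF P e s])
        finally show ?thesis by (simp add: ennreal_of_nat_eq_real_of_nat ennreal_leI)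
      qed
      then have "liminf (\<lambda>n. of_nat n) \<le> ?l G"
        by (intro Liminf_mono always_eventually allI)
      moreover have "liminf (\<lambda>n. of_nat n :: ennreal) = \<infinity>"
        using of_nat_tendsto_top_ennreal lim_imp_Liminf[of sequentially] by fastforce
      ultimately show False using fin by (simp add: top_unique)
    qed
  qed
qed

text \<open>\<open>lsq\<close> sees \<open>G\<close> only through \<open>G ** \<P>\<close>, so it is
  unchanged when the complementary part is replaced by an independent copy.\<close>

lemma lsq_resample:
  assumes "projector \<P>"
  shows "lsq e \<P> (G ** \<P> + (Y - Y ** \<P>)) = lsq e \<P> G"
proof -
  have "(G ** \<P> + (Y - Y ** \<P>)) ** \<P> = G ** \<P>"
    by (simp add: matrix_ring_simps projector_assoc[OF assms])
  then show ?thesis by (simp add: lsq_def pgram_def)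
qed

text \<open>Given \<open>G ** \<P>\<close>, the argument of the norm is affine in an independent
  Gaussian matrix, because \<open>\<P> ** N = 0\<close> hides the conditioned part from the last
  factor. The conditional second moment is \<parallel>c\<parallel>^2 + \<beta> \<parallel>S
  lsq\<parallel>^2 \<parallel>N\<parallel>^2, and the mean of \<parallel>lsq\<parallel>^2 is at most
  p / d.\<close>

lemma nn_integral_regularized_lsq:
  fixes \<P> :: "'a::rc_field^'m^'m" and S :: "'a^'m^'k" and N :: "'a^'q^'m"
  assumes P: "projector \<P>" and e: "0 < e"
    and S: "\<And>X :: 'a^'s^'m. norm (S ** X) \<le> norm X"
    and N: "\<P> ** N = 0"
  defines "d \<equiv> real DIM('a) * real CARD('s) - real DIM('a) * inner \<P> (mat 1) + real DIM('a) - 2"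
  assumes d: "0 < d"
  shows "(\<integral>\<^sup>+G. ennreal ((norm (c + S ** lsq e \<P> (G :: 'a^'m^'s) ** G ** N))\<^sup>2) \<partial>gauss)
    \<le> ennreal ((norm c)\<^sup>2 + real DIM('a) * inner \<P> (mat 1) / d * (norm N)\<^sup>2)"
proof -
  interpret prob_space "gauss :: ('a^'m^'s) measure" by (rule prob_space_gauss)
  let ?f = "\<lambda>G :: 'a^'m^'s. ennreal ((norm (c + S ** lsq e \<P> G ** G ** N))\<^sup>2)"
  let ?w = "\<lambda>G :: 'a^'m^'s. inner (resolvent e \<P> G) (mat 1)"
  let ?b = "real DIM('a) * (norm N)\<^sup>2"
  have nz: "det (pgram e \<P> G) \<noteq> 0" for G :: "'a^'m^'s"
    by (rule det_pgram_nonzero[OF P e])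
  have w0: "0 \<le> ?w G" for G
    unfolding trace_resolvent[OF P nz] using e by simp
  have lin: "linear (\<lambda>G :: 'a^'m^'s. G ** \<P>)"
    by (rule linearI) (simp_all add: matrix_ring_simps)
  have "(\<integral>\<^sup>+G. ?f G \<partial>gauss) = (\<integral>\<^sup>+G. \<integral>\<^sup>+Y. ?f (G ** \<P> + (Y - Y ** \<P>)) \<partial>gauss \<partial>gauss)"
    by (rule nn_integral_gauss_resample[OF lin])
      (simp_all add: projector_assoc[OF P] inner_mult_right projectorD[OF P])
  also have "\<dots> = (\<integral>\<^sup>+G. \<integral>\<^sup>+Y. ennreal ((norm (c + S ** lsq e \<P> (G :: 'a^'m^'s) ** Y ** N))\<^sup>2) \<partial>gauss \<partial>gauss)"
  proof -
    have "S ** lsq e \<P> G ** (G ** \<P> + (Y - Y ** \<P>)) ** N = S ** lsq e \<P> G ** Y ** N" for G Y :: "'a^'m^'s"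
      by (simp add: matrix_ring_simps matrix_mul_assoc[symmetric] N)
    then show ?thesis by (simp add: lsq_resample[OF P])
  qed
  also have "\<dots> \<le> (\<integral>\<^sup>+G. ennreal ((norm c)\<^sup>2) + ennreal ?b * ennreal (?w G) \<partial>gauss)"
  proof (rule nn_integral_mono)
    fix G :: "'a^'m^'s"
    let ?X = "S ** lsq e \<P> G"
    have lin: "linear (\<lambda>Y :: 'a^'m^'s. ?X ** Y ** N)"
      by (rule linearI) (simp_all add: matrix_ring_simps)
    have "(\<integral>\<^sup>+Y. ennreal ((norm (c + ?X ** Y ** N))\<^sup>2) \<partial>(gauss :: ('a^'m^'s) measure))
      = ennreal ((norm c)\<^sup>2 + real DIM('a) * ((norm ?X)\<^sup>2 * (norm N)\<^sup>2))"
      unfolding nn_integral_gauss_affine_sq[OF lin] sum_Basis_norm_sq ..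
    also have "\<dots> \<le> ennreal ((norm c)\<^sup>2 + real DIM('a) * (?w G * (norm N)\<^sup>2))"
    proof -
      have "lsq e \<P> G = adj (G ** resolvent e \<P> G)"
        using resolvent_simps[OF P nz, of G] by (simp add: adj_mult)
      then have "(norm (lsq e \<P> G))\<^sup>2 \<le> ?w G"
        unfolding trace_resolvent[OF P nz] using e by simp
      then have "(norm ?X)\<^sup>2 \<le> ?w G"
        using power_mono[OF S norm_ge_zero, of "lsq e \<P> G" 2] by linarith
      then show ?thesis
        by (intro ennreal_leI add_left_mono mult_left_mono mult_right_mono) simp_all
    qed
    also have "real DIM('a) * (?w G * (norm N)\<^sup>2) = ?b * ?w G" by simp
    also have "ennreal ((norm c)\<^sup>2 + ?b * ?w G) = ennreal ((norm c)\<^sup>2) + ennreal ?b * ennreal (?w G)"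
      using w0[of G] by (simp add: ennreal_mult)
    finally show "(\<integral>\<^sup>+Y. ennreal ((norm (c + ?X ** Y ** N))\<^sup>2) \<partial>(gauss :: ('a^'m^'s) measure))
      \<le> ennreal ((norm c)\<^sup>2) + ennreal ?b * ennreal (?w G)" .
  qed
  also have "\<dots> = ennreal ((norm c)\<^sup>2) + ennreal ?b * (\<integral>\<^sup>+G. ennreal (?w G) \<partial>gauss)"
    using emeasure_space_1 by (simp add: nn_integral_add nn_integral_cmult)
  also have "\<dots> \<le> ennreal ((norm c)\<^sup>2) + ennreal ?b * ennreal (inner \<P> (mat 1) / d)"
    using trace_resolvent_bound[OF P e d[unfolded d_def]] unfolding d_def
    by (intro add_left_mono mult_left_mono) auto
  also have "\<dots> = ennreal ((norm c)\<^sup>2 + ?b * (inner \<P> (mat 1) / d))"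
    using d by (simp add: ennreal_mult[symmetric] ennreal_plus[symmetric] projector_inner_mat_1[OF P]
        del: ennreal_plus)
  finally show ?thesis by (simp add: mult_ac)
qed

text \<open>The regularized bound is uniform in e and the integrands converge off a null set as e
  tends to 0, so Fatou's lemma carries the bound over.\<close>

lemma nn_integral_lsq:
  fixes \<P> :: "'a::rc_field^'m^'m" and S :: "'a^'m^'k" and N :: "'a^'q^'m"
  assumes P: "projector \<P>"
    and S: "\<And>X :: 'a^'s^'m. norm (S ** X) \<le> norm X"
    and N: "\<P> ** N = 0"
  defines "d \<equiv> real DIM('a) * real CARD('s) - real DIM('a) * inner \<P> (mat 1) + real DIM('a) - 2"
  assumes d: "0 < d"
  shows "(\<integral>\<^sup>+G. ennreal ((norm (c + S ** lsq 0 \<P> (G :: 'a^'m^'s) ** G ** N))\<^sup>2) \<partial>gauss)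
    \<le> ennreal ((norm c)\<^sup>2 + real DIM('a) * inner \<P> (mat 1) / d * (norm N)\<^sup>2)"
proof -
  define e where "e n = inverse (real (Suc n))" for n
  have e: "0 < e n" for n by (simp add: e_def)
  have e0: "e \<longlonglongrightarrow> 0"
    unfolding e_def by (rule LIMSEQ_inverse_real_of_nat)
  let ?f = "\<lambda>e (G :: 'a^'m^'s). ennreal ((norm (c + S ** lsq e \<P> G ** G ** N))\<^sup>2)"
  have "AE G in gauss. ?f 0 G = liminf (\<lambda>n. ?f (e n) G)"
    using AE_pgram_nonsingular[OF P d[unfolded d_def]]
  proof eventually_elim
    fix G :: "'a^'m^'s" assume nz: "det (pgram 0 \<P> G) \<noteq> 0"
    have "(\<lambda>n. pgram 0 \<P> G + e n *\<^sub>R mat 1) \<longlonglongrightarrow> pgram 0 \<P> G + 0 *\<^sub>R mat 1"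
      by (intro tendsto_intros e0)
    then have "(\<lambda>n. pgram (e n) \<P> G) \<longlonglongrightarrow> pgram 0 \<P> G"
      by (simp add: pgram_def)
    then have "(\<lambda>n. ?f (e n) G) \<longlonglongrightarrow> ?f 0 G"
      unfolding lsq_def by (intro tendsto_intros tendsto_cinv nz)
    then show "?f 0 G = liminf (\<lambda>n. ?f (e n) G)"
      by (intro lim_imp_Liminf[symmetric]) simp_all
  qed
  then have "(\<integral>\<^sup>+G. ?f 0 G \<partial>gauss) = (\<integral>\<^sup>+G. liminf (\<lambda>n. ?f (e n) G) \<partial>gauss)"
    by (rule nn_integral_cong_AE)
  also have "\<dots> \<le> liminf (\<lambda>n. \<integral>\<^sup>+G. ?f (e n) G \<partial>gauss)"
    by (rule nn_integral_liminf) measurable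
  also have "\<dots> \<le> limsup (\<lambda>n. \<integral>\<^sup>+G. ?f (e n) G \<partial>gauss)"
    by (rule Liminf_le_Limsup) simp
  also have "\<dots> \<le> ennreal ((norm c)\<^sup>2 + real DIM('a) * inner \<P> (mat 1) / d * (norm N)\<^sup>2)"
    unfolding d_def
    by (intro Limsup_bounded always_eventually allI nn_integral_regularized_lsq[OF P e S N] d[unfolded d_def])
  finally show ?thesis .
qed

subsection \<open>Singular value decomposition\<close>

text \<open>The scalar-valued Hermitian form whose real part is \<open>inner\<close>. Orthonormality
  of a frame refers to this form, which over the complex numbers says more than orthogonality for
  \<open>inner\<close>.\<close>

definition hdot :: "'a::conjugatable_field^'n \<Rightarrow> 'a^'n \<Rightarrow> 'a" where
  "hdot u v = (\<Sum>i\<in>UNIV. conjugate (u $ i) * v $ i)"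

definition outer :: "'a::conjugatable_field^'m \<Rightarrow> 'a^'n \<Rightarrow> 'a^'n^'m" where
  "outer u v = (\<chi> i l. u $ i * conjugate (v $ l))"

lemma orthonormal_family_hdot:
  "orthonormal_family q u \<longleftrightarrow> (\<forall>a<q. \<forall>b<q. hdot (u a) (u b) = (if a = b then 1 else 0))"
  by (simp add: orthonormal_family_def hdot_def)

lemma inner_eq_hdot: "inner u v = inner 1 (hdot u (v::'a::rc_field^'n))"
  by (simp add: inner_vec_def hdot_def inner_sum_right inner_mult_conj)

lemma hdot_self: "hdot u u = of_real ((norm (u::'a::rc_field^'n))\<^sup>2)"
proof -
  have "(norm u)\<^sup>2 = (\<Sum>i\<in>UNIV. (norm (u $ i))\<^sup>2)"
    by (simp add: norm_vec_def L2_set_def sum_nonneg)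
  then show ?thesis by (simp add: hdot_def conj_mult_self scaleR_conv_of_real)
qed

lemma hdot_mult: "hdot (A *v x) y = hdot x (adj A *v y)"
  unfolding hdot_def matrix_vector_mult_def
  by (simp add: sum_conjugate conjugate_dist_mul sum_distrib_left sum_distrib_right)
    (subst sum.swap, simp add: mult_ac)

lemma inner_adj_vector: "inner (A *v x) y = inner x (adj A *v (y::'a::rc_field^'m))"
  by (simp add: inner_eq_hdot hdot_mult)

lemma adj_outer: "adj (outer u v) = outer v u"
  by (simp add: vec_eq_iff outer_def conjugate_dist_mul mult.commute)

lemma outer_mult_vector: "outer u v *v x = hdot v x *s u"
  by (simp add: vec_eq_iff outer_def hdot_def matrix_vector_mult_def sum_distrib_left mult_ac)

lemma mult_outer: "A ** outer u v = outer (A *v u) v"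
  by (simp add: vec_eq_iff outer_def matrix_matrix_mult_def matrix_vector_mult_def sum_distrib_right mult.assoc)

lemma outer_mult: "outer u v ** A = outer u (adj A *v v)"
  by (metis adj_adj adj_mult adj_outer mult_outer)

lemma outer_scaleR:
  "outer (r *\<^sub>R u) v = r *\<^sub>R outer u (v::'a::rc_field^'n)" "outer u (r *\<^sub>R v) = r *\<^sub>R outer u (v::'a::rc_field^'n)"
  by (simp_all add: vec_eq_iff outer_def linear_cmul[OF linear_conjugate])

lemma outer_zero [simp]: "outer 0 v = 0" "outer u 0 = 0"
  by (simp_all add: vec_eq_iff outer_def)

lemma matrix_sum_left: "A ** (\<Sum>i\<in>I. f i) = (\<Sum>i\<in>I. A ** (f i :: 'a::rc_field^'n^'m))"
  by (induction I rule: infinite_finite_induct) (simp_all add: matrix_ring_simps)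

lemma matrix_sum_right: "(\<Sum>i\<in>I. f i) ** A = (\<Sum>i\<in>I. f i ** (A :: 'a::rc_field^'n^'m))"
  by (induction I rule: infinite_finite_induct) (simp_all add: matrix_ring_simps)

lemma adj_sum: "adj (\<Sum>i\<in>I. f i) = (\<Sum>i\<in>I. adj (f i :: 'a::rc_field^'n^'m))"
  by (induction I rule: infinite_finite_induct) (simp_all add: adj_simps)

lemma inner_outer: "inner (outer u v) (outer x y) = inner 1 (hdot u x * hdot y (v::'a::rc_field^'n))"
proof -
  have "inner (u $ i * conjugate (v $ l)) (x $ i * conjugate (y $ l))
      = inner 1 ((conjugate (u $ i) * x $ i) * (conjugate (y $ l) * v $ l))" for i l
  proof -
    have "inner 1 ((conjugate (u $ i) * x $ i) * (conjugate (y $ l) * v $ l))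
      = inner 1 (conjugate (u $ i) * (x $ i * (conjugate (y $ l) * v $ l)))"
      by (simp only: mult.assoc)
    also have "\<dots> = inner (u $ i * 1) (x $ i * (conjugate (y $ l) * v $ l))"
      by (rule inner_mult_conj)
    also have "\<dots> = inner (u $ i) (v $ l * (x $ i * conjugate (y $ l)))"
      by (simp add: mult_ac)
    also have "\<dots> = inner (conjugate (v $ l) * u $ i) (x $ i * conjugate (y $ l))"
      by (rule inner_conj_mult[symmetric])
    finally show ?thesis
      by (simp only: mult.commute[of "u $ i" "conjugate (v $ l)"])
  qed
  then show ?thesis
    by (simp add: inner_vec_def outer_def hdot_def sum_product inner_sum_right)
qed

text \<open>Orthonormal right factors make the outer products orthogonal in the Frobenius inner
  product, whatever the left factors are.\<close>

lemma norm_sum_outer: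
  fixes x :: "nat \<Rightarrow> 'a::rc_field^'m" and v :: "nat \<Rightarrow> 'a^'n"
  assumes v: "orthonormal_family q v"
  shows "(norm (\<Sum>j<q. outer (x j) (v j)))\<^sup>2 = (\<Sum>j<q. (norm (x j))\<^sup>2)"
proof -
  have "(norm (\<Sum>j<q. outer (x j) (v j)))\<^sup>2
    = (\<Sum>i<q. \<Sum>j<q. inner (outer (x i) (v i)) (outer (x j) (v j)))"
    by (simp only: power2_norm_eq_inner inner_sum_left) (simp only: inner_sum_right)
  also have "\<dots> = (\<Sum>i<q. \<Sum>j<q. if i = j then (norm (x i))\<^sup>2 else 0)"
  proof (intro sum.cong refl)
    fix i j assume "i \<in> {..<q}" "j \<in> {..<q}"
    then show "inner (outer (x i) (v i)) (outer (x j) (v j)) = (if i = j then (norm (x i))\<^sup>2 else 0)"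
      using v by (auto simp: inner_outer orthonormal_family_hdot inner_eq_hdot[symmetric] power2_norm_eq_inner)
  qed
  finally show ?thesis by simp
qed

lemma norm_sum_outer':
  fixes u :: "nat \<Rightarrow> 'a::rc_field^'m" and y :: "nat \<Rightarrow> 'a^'n"
  assumes u: "orthonormal_family q u"
  shows "(norm (\<Sum>j<q. outer (u j) (y j)))\<^sup>2 = (\<Sum>j<q. (norm (y j))\<^sup>2)"
  using norm_sum_outer[OF u, of y] norm_adj[of "\<Sum>j<q. outer (u j) (y j)"]
  by (simp add: adj_sum adj_outer)

lemma orthonormal_family_norm:
  fixes u :: "nat \<Rightarrow> 'a::rc_field^'n"
  assumes "orthonormal_family q u" "j < q"
  shows "norm (u j) = 1"
proof -
  have "hdot (u j) (u j) = 1"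
    using assms by (simp add: orthonormal_family_hdot)
  then have "(of_real ((norm (u j))\<^sup>2) :: 'a) = of_real 1"
    unfolding hdot_self of_real_1 .
  then have "(norm (u j))\<^sup>2 = 1" by (simp only: of_real_eq_iff)
  then show ?thesis by (simp add: abs_square_eq_1)
qed

lemma matrix_vector_scaleR: "A *v (c *\<^sub>R x) = c *\<^sub>R (A *v (x::'a::rc_field^'n))"
  by (rule linear_cmul[OF matrix_vector_mul_linear])

section \<open>Projectors of orthonormal frames and the construction of an SVD\<close>

definition frame_projector :: "nat \<Rightarrow> (nat \<Rightarrow> 'a::rc_field^'n) \<Rightarrow> 'a^'n^'n" where
  "frame_projector q u = (\<Sum>j<q. outer (u j) (u j))"

lemma frame_projector_mult:
  assumes u: "orthonormal_family q u" and "j < q'" "q \<le> q'" "orthonormal_family q' u"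
  shows "frame_projector q u *v u j = (if j < q then u j else 0)"
proof -
  have "frame_projector q u *v u j = (\<Sum>i<q. outer (u i) (u i) *v u j)"
    unfolding frame_projector_def
    by (induction q) (simp_all add: matrix_vector_mult_add_rdistrib)
  also have "\<dots> = (\<Sum>i<q. if i = j then u j else 0)"
    using assms by (intro sum.cong refl) (auto simp: outer_mult_vector orthonormal_family_hdot)
  finally show ?thesis by (simp add: sum.delta)
qed

lemma projector_frame_projector:
  assumes u: "orthonormal_family q u"
  shows "projector (frame_projector q u)" "inner (frame_projector q u) (mat 1) = real q"
proof -
  have "frame_projector q u ** frame_projector q u = (\<Sum>j<q. outer (frame_projector q u *v u j) (u j))"
    by (subst (2) frame_projector_def) (simp add: matrix_sum_left mult_outer)
  also have "\<dots> = frame_projector q u"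
    unfolding frame_projector_def[of q u, symmetric]
    by (subst (2) frame_projector_def) (intro sum.cong refl, simp add: frame_projector_mult[OF u _ order_refl u])
  finally show P: "projector (frame_projector q u)"
    by (simp add: projector_def frame_projector_def adj_sum adj_outer)
  have "(norm (frame_projector q u))\<^sup>2 = real q"
    unfolding frame_projector_def by (simp add: norm_sum_outer[OF u] orthonormal_family_norm[OF u])
  then show "inner (frame_projector q u) (mat 1) = real q"
    using projector_inner_mat_1[OF P] by simp
qed

lemma projector_eq_mat_1:
  fixes P :: "'a::rc_field^'n^'n"
  assumes P: "projector P" and "inner P (mat 1) = real CARD('n)"
  shows "P = mat 1"
proof -
  have "(norm (mat 1 - P))\<^sup>2 = inner (mat 1 - P) (mat 1)"
    using projector_inner_mat_1[OF projector_compl[OF P]] by simp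
  also have "\<dots> = 0" by (simp add: inner_diff_left inner_mat_1 assms)
  finally show ?thesis by simp
qed

lemma projector_kernel_unit:
  fixes P :: "'a::rc_field^'n^'n"
  assumes P: "projector P" and "P \<noteq> mat 1"
  shows "\<exists>x. P *v x = 0 \<and> norm x = 1"
proof -
  obtain z where z: "P *v z \<noteq> z"
    using assms(2) by (metis matrix_eq matrix_vector_mul_lid)
  let ?y = "z - P *v z"
  have "P *v ?y = 0"
    using projectorD(2)[OF P] by (simp add: matrix_vector_mult_diff_distrib matrix_vector_mul_assoc)
  then have "P *v ((1 / norm ?y) *\<^sub>R ?y) = 0"
    by (simp add: matrix_vector_scaleR)
  moreover have "norm ((1 / norm ?y) *\<^sub>R ?y) = 1" using z by simp
  ultimately show ?thesis by blast
qed

lemma projector_vector: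
  fixes P :: "'a::rc_field^'n^'n"
  assumes P: "projector P"
  shows "norm (P *v x) \<le> norm x"
proof -
  have "inner (P *v x) (x - P *v x) = 0"
    using projectorD[OF P] by (simp add: inner_adj_vector matrix_vector_mult_diff_distrib matrix_vector_mul_assoc)
  then have "(norm (P *v x + (x - P *v x)))\<^sup>2 = (norm (P *v x))\<^sup>2 + (norm (x - P *v x))\<^sup>2"
    by (rule norm_add_Pythagorean[unfolded orthogonal_def])
  then have "(norm (P *v x))\<^sup>2 \<le> (norm x)\<^sup>2" by simp
  then show ?thesis by (rule power2_le_imp_le) simp
qed

lemma continuous_on_matrix_vector: "continuous_on S ((*v) (A::'a::rc_field^'n^'m))"
  by (rule linear_continuous_on) (simp add: linear_conv_bounded_linear[symmetric])

text \<open>Maximize the real part of the form (x, A y) over unit vectors of the two kernels, a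
  compact set. Since \<open>P ** A = A ** R\<close>, \<open>A\<close> maps the kernel of
  \<open>R\<close> to that of \<open>P\<close> and its adjoint maps back, so the maximum bounds the
  norms of \<open>A *v y\<close> and \<open>adj A *v x\<close>.\<close>

lemma singular_pair:
  fixes A :: "'a::rc_field^'n^'m"
  assumes P: "projector P" "P \<noteq> mat 1" and R: "projector R" "R \<noteq> mat 1" and PA: "P ** A = A ** R"
  shows "\<exists>\<sigma> x y. 0 \<le> \<sigma> \<and> P *v x = 0 \<and> R *v y = 0 \<and> norm x = 1 \<and> norm y = 1
    \<and> A *v y = \<sigma> *\<^sub>R x \<and> adj A *v x = \<sigma> *\<^sub>R y
    \<and> (\<forall>x' y'. P *v x' = 0 \<longrightarrow> R *v y' = 0 \<longrightarrow> norm x' = 1 \<longrightarrow> norm y' = 1 \<longrightarrow> inner x' (A *v y') \<le> \<sigma>)"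
proof -
  define K where "K = (sphere 0 1 \<inter> {x. P *v x = 0}) \<times> (sphere 0 1 \<inter> {y. R *v y = 0})"
  have "closed {x. P *v x = 0}" "closed {y. R *v y = 0}"
    by (intro closed_Collect_eq continuous_on_matrix_vector continuous_on_const)+
  then have K: "compact K"
    unfolding K_def by (intro compact_Times compact_Int_closed compact_sphere)
  have K0: "K \<noteq> {}"
    using projector_kernel_unit[OF P] projector_kernel_unit[OF R] by (auto simp: K_def)
  have cont: "continuous_on K (\<lambda>z. inner (fst z) (A *v snd z))"
    by (intro continuous_intros continuous_on_compose2[OF continuous_on_matrix_vector[of UNIV]]) auto
  from continuous_attains_sup[OF K K0 cont]
  obtain z where z: "z \<in> K" and max: "\<And>z'. z' \<in> K \<Longrightarrow> inner (fst z') (A *v snd z') \<le> inner (fst z) (A *v snd z)"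
    by blast
  obtain x y where xy: "z = (x, y)" by (cases z)
  define \<sigma> where "\<sigma> = inner x (A *v y)"
  have x: "P *v x = 0" "norm x = 1" and y: "R *v y = 0" "norm y = 1"
    using z by (auto simp: xy K_def)
  have max': "inner x' (A *v y') \<le> \<sigma>" if "P *v x' = 0" "R *v y' = 0" "norm x' = 1" "norm y' = 1" for x' y'
    using max[of "(x', y')"] that by (simp add: xy \<sigma>_def K_def)
  have "P *v (- x) = 0"
    using x matrix_vector_mult_diff_distrib[of P 0 x] by simp
  then have \<sigma>: "0 \<le> \<sigma>"
    using max'[of "- x" y] x y by (simp add: \<sigma>_def)
  \<comment> \<open>Equality case of Cauchy-Schwarz, which turns the two norm bounds into the
    singular vector equations.\<close>
  have small: "b = \<sigma> *\<^sub>R a" if "norm a = 1" "inner a b = \<sigma>" "norm b \<le> \<sigma>" for a b :: "'a^'p"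
  proof -
    have "(norm (b - \<sigma> *\<^sub>R a))\<^sup>2 = (norm b)\<^sup>2 - \<sigma>\<^sup>2"
      using that(1,2) unfolding power2_norm_eq_inner
      by (simp add: inner_diff_left inner_diff_right norm_eq_1
          inner_commute power2_eq_square algebra_simps)
    also have "\<dots> \<le> 0" using power_mono[OF that(3) norm_ge_zero, of 2] by simp
    finally show ?thesis by simp
  qed
  have "norm (A *v y) \<le> \<sigma>"
  proof (cases "A *v y = 0")
    case False
    have "P *v (A *v y) = 0"
      using y by (simp add: matrix_vector_mul_assoc PA) (simp add: matrix_vector_mul_assoc[symmetric])
    then have "P *v ((1 / norm (A *v y)) *\<^sub>R (A *v y)) = 0"
      by (simp add: matrix_vector_scaleR)
    from max'[OF this y(1) _ y(2)] False show ?thesis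
      by (simp add: power2_norm_eq_inner[symmetric] power2_eq_square)
  qed (simp add: \<sigma>)
  then have Ay: "A *v y = \<sigma> *\<^sub>R x"
    by (intro small x) (simp_all add: \<sigma>_def)
  have "norm (adj A *v x) \<le> \<sigma>"
  proof (cases "adj A *v x = 0")
    case False
    have "R ** adj A = adj A ** P"
      using arg_cong[OF PA, of adj] projectorD(1)[OF P(1)] projectorD(1)[OF R(1)] by (simp add: adj_mult)
    then have "R *v (adj A *v x) = 0"
      using x by (simp add: matrix_vector_mul_assoc) (simp add: matrix_vector_mul_assoc[symmetric])
    then have Ry: "R *v ((1 / norm (adj A *v x)) *\<^sub>R (adj A *v x)) = 0"
      by (simp add: matrix_vector_scaleR)
    show ?thesis
    proof -
      have "inner x (A *v (adj A *v x)) = norm (adj A *v x) * norm (adj A *v x)"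
        using inner_adj_vector[of "adj A" x "adj A *v x"]
        by (simp add: power2_norm_eq_inner[symmetric] power2_eq_square)
      then show ?thesis
        using max'[OF x(1) Ry x(2)] False
        by (simp add: matrix_vector_scaleR)
    qed
  qed (simp add: \<sigma>)
  then have Ax: "adj A *v x = \<sigma> *\<^sub>R y"
    using inner_adj_vector[of "adj A" x y]
    by (intro small y) (simp_all add: \<sigma>_def inner_commute)
  show ?thesis
    using \<sigma> x y Ay Ax max' by blast
qed

text \<open>Deflation: each new pair is found in the kernels of the projectors onto the earlier
  frames. The last conjunct, that the remaining form stays below every earlier value, is carried
  along to obtain the decreasing order.\<close>

lemma partial_svd:
  fixes A :: "'a::rc_field^'n^'m"
  assumes "q \<le> min CARD('m) CARD('n)"
  shows "\<exists>\<sigma> u v. orthonormal_family q u \<and> orthonormal_family q v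
    \<and> (\<forall>j<q. 0 \<le> \<sigma> j \<and> A *v v j = \<sigma> j *\<^sub>R u j \<and> adj A *v u j = \<sigma> j *\<^sub>R v j)
    \<and> (\<forall>i<q. \<forall>j<q. i \<le> j \<longrightarrow> \<sigma> j \<le> \<sigma> i)
    \<and> (\<forall>x y. frame_projector q u *v x = 0 \<longrightarrow> frame_projector q v *v y = 0 \<longrightarrow> norm x = 1 \<longrightarrow> norm y = 1 \<longrightarrow>
        (\<forall>j<q. inner x (A *v y) \<le> (\<sigma> j :: real)))"
  using assms
proof (induction q)
  case 0
  then show ?case by (simp add: orthonormal_family_def)
next
  case (Suc q)
  from Suc.IH[OF Suc_leD[OF Suc.prems]]
  obtain \<sigma> u v where u: "orthonormal_family q u" and v: "orthonormal_family q v"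
    and sv: "\<forall>j<q. 0 \<le> \<sigma> j \<and> A *v v j = \<sigma> j *\<^sub>R u j \<and> adj A *v u j = \<sigma> j *\<^sub>R v j"
    and dec: "\<forall>i<q. \<forall>j<q. i \<le> j \<longrightarrow> \<sigma> j \<le> \<sigma> i"
    and bound: "\<forall>x y. frame_projector q u *v x = 0 \<longrightarrow> frame_projector q v *v y = 0 \<longrightarrow> norm x = 1 \<longrightarrow>
      norm y = 1 \<longrightarrow> (\<forall>j<q. inner x (A *v y) \<le> (\<sigma> j :: real))"
    by (elim exE conjE) (rule that)
  let ?P = "frame_projector q u" and ?R = "frame_projector q v"
  note P = projector_frame_projector[OF u] and R = projector_frame_projector[OF v]
  \<comment> \<open>The equations for \<open>A\<close> and for its adjoint together make the two
    projectors intertwine with \<open>A\<close>, as \<open>singular_pair\<close> demands.\<close>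
  have PA: "?P ** A = A ** ?R"
    unfolding frame_projector_def matrix_sum_left matrix_sum_right outer_mult mult_outer
    by (intro sum.cong refl) (simp add: sv outer_scaleR)
  have P1: "?P \<noteq> mat 1" and R1: "?R \<noteq> mat 1"
    using P(2) R(2) Suc.prems by (auto simp: inner_mat_1)
  from singular_pair[OF P(1) P1 R(1) R1 PA]
  obtain s x y where s: "0 \<le> s" and x: "?P *v x = 0" "norm x = 1" and y: "?R *v y = 0" "norm y = 1"
    and Ay: "A *v y = s *\<^sub>R x" and Ax: "adj A *v x = s *\<^sub>R y"
    and max: "\<And>x' y'. ?P *v x' = 0 \<Longrightarrow> ?R *v y' = 0 \<Longrightarrow> norm x' = 1 \<Longrightarrow> norm y' = 1 \<Longrightarrow> inner x' (A *v y') \<le> s"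
    by blast
  have ext: "orthonormal_family (Suc q) (w(q := z))"
    if w: "orthonormal_family q w" and z: "frame_projector q w *v z = 0" "norm z = 1"
    for w :: "nat \<Rightarrow> 'a^'p" and z
  proof -
    have wz: "hdot (w j) z = 0" if "j < q" for j
    proof -
      have "hdot (w j) z = hdot (frame_projector q w *v w j) z"
        using frame_projector_mult[OF w that order_refl w] that by simp
      also have "\<dots> = 0"
        using projectorD(1)[OF projector_frame_projector(1)[OF w]] z by (simp add: hdot_mult) (simp add: hdot_def)
      finally show ?thesis .
    qed
    have zw: "hdot z (w j) = 0" if "j < q" for j
    proof -
      have "hdot z (w j) = conjugate (hdot (w j) z)"
        by (simp add: hdot_def sum_conjugate conjugate_dist_mul mult.commute)
      then show ?thesis by (simp add: wz[OF that])
    qed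
    show ?thesis
      using w by (auto simp: orthonormal_family_hdot wz zw hdot_self z less_Suc_eq)
  qed
  have fr: "frame_projector (Suc q) (w(q := z)) = frame_projector q w + outer z z" for w :: "nat \<Rightarrow> 'a^'p" and z
    unfolding frame_projector_def by simp
  have sub: "frame_projector q w *v a = 0"
    if w: "orthonormal_family q w" and z: "frame_projector q w *v z = 0"
      and a: "frame_projector (Suc q) (w(q := z)) *v a = 0" for w :: "nat \<Rightarrow> 'a^'p" and z a
  proof -
    have "frame_projector q w *v ((frame_projector q w + outer z z) *v a) = 0"
      using a by (simp add: fr)
    moreover have "frame_projector q w ** (frame_projector q w + outer z z) = frame_projector q w"
      using projectorD(2)[OF projector_frame_projector(1)[OF w]]
      by (simp add: matrix_ring_simps mult_outer z)
    ultimately show ?thesis by (simp add: matrix_vector_mul_assoc)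
  qed
  have sle: "s \<le> \<sigma> j" if "j < q" for j
  proof -
    have "inner x (A *v y) = s" using x(2) by (simp add: Ay power2_norm_eq_inner[symmetric])
    then show ?thesis using bound x y that by auto
  qed
  have "inner x' (A *v y') \<le> (\<sigma>(q := s)) j"
    if "frame_projector (Suc q) (u(q := x)) *v x' = 0" "frame_projector (Suc q) (v(q := y)) *v y' = 0"
      "norm x' = 1" "norm y' = 1" "j < Suc q" for x' y' j
    using max[OF sub[OF u x(1) that(1)] sub[OF v y(1) that(2)] that(3,4)] sle[of j] that(5)
    by (auto simp: less_Suc_eq)
  moreover have "(\<sigma>(q := s)) j \<le> (\<sigma>(q := s)) i" if "i < Suc q" "j < Suc q" "i \<le> j" for i j
    using that dec sle[of i] by (auto simp: less_Suc_eq)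
  moreover have "0 \<le> (\<sigma>(q := s)) j \<and> A *v (v(q := y)) j = (\<sigma>(q := s)) j *\<^sub>R (u(q := x)) j
      \<and> adj A *v (u(q := x)) j = (\<sigma>(q := s)) j *\<^sub>R (v(q := y)) j" if "j < Suc q" for j
    using that sv s Ax Ay by (auto simp: less_Suc_eq)
  ultimately show ?case
    using ext[OF u x] ext[OF v y] by (intro exI[of _ "\<sigma>(q := s)"] exI[of _ "u(q := x)"] exI[of _ "v(q := y)"]) blast
qed

lemma is_svd_outer:
  fixes u :: "nat \<Rightarrow> 'a::rc_field^'m" and v :: "nat \<Rightarrow> 'a^'n"
  shows "(\<chi> i l. \<Sum>j<q. of_real (\<sigma> j) * u j $ i * conjugate (v j $ l)) = (\<Sum>j<q. outer (u j) (\<sigma> j *\<^sub>R v j) :: 'a^'n^'m)"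
  unfolding outer_scaleR
  by (simp add: vec_eq_iff outer_def, simp add: scaleR_conv_of_real mult.assoc)

lemma svd_exists: "\<exists>\<sigma> u v. is_svd (A::'a::rc_field^'n^'m) \<sigma> u v"
proof -
  let ?q = "min CARD('m) CARD('n)"
  from partial_svd[of ?q, OF order_refl, of A]
  obtain \<sigma> u v where u: "orthonormal_family ?q u" and v: "orthonormal_family ?q v"
    and sv: "\<forall>j<?q. 0 \<le> \<sigma> j \<and> A *v v j = \<sigma> j *\<^sub>R u j \<and> adj A *v u j = \<sigma> j *\<^sub>R v j"
    and dec: "\<forall>i<?q. \<forall>j<?q. i \<le> j \<longrightarrow> \<sigma> j \<le> (\<sigma> i :: real)"
    by (elim exE conjE) (rule that)
  define s where "s j = (if j < ?q then \<sigma> j else 0)" for j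
  note P = projector_frame_projector[OF u] and R = projector_frame_projector[OF v]
  have AR: "A ** frame_projector ?q v = (\<Sum>j<?q. outer (u j) (s j *\<^sub>R v j))"
    unfolding frame_projector_def matrix_sum_left mult_outer
    by (intro sum.cong refl) (simp add: sv s_def outer_scaleR)
  have PA: "frame_projector ?q u ** A = (\<Sum>j<?q. outer (u j) (s j *\<^sub>R v j))"
    unfolding frame_projector_def matrix_sum_right outer_mult
    by (intro sum.cong refl) (simp add: sv s_def outer_scaleR)
  \<comment> \<open>With as many vectors as the smaller dimension, one of the frames is complete,
    and then one of the two truncations is \<open>A\<close> itself.\<close>
  have "frame_projector ?q u = mat 1 \<or> frame_projector ?q v = mat 1"
    using projector_eq_mat_1[OF P(1)] projector_eq_mat_1[OF R(1)] P(2) R(2) by (auto simp: min_def)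
  then have "A = (\<Sum>j<?q. outer (u j) (s j *\<^sub>R v j))"
    using AR PA by auto
  then have "is_svd A s u v"
    unfolding is_svd_def is_svd_outer
    using u v sv dec by (auto simp: s_def decseq_def not_less)
  then show ?thesis by blast
qed

text \<open>The left vectors stay orthonormal when \<open>R\<close> acts on the right. The identity
  gives the Frobenius norm, a low-rank \<open>R\<close> the energy that it captures.\<close>

lemma is_svd_norm:
  fixes A :: "'a::rc_field^'n^'m"
  assumes "is_svd A \<sigma> u v" and R: "projector R"
  shows "(norm (A ** R))\<^sup>2 = (\<Sum>j<min CARD('m) CARD('n). (\<sigma> j)\<^sup>2 * (norm (R *v v j))\<^sup>2)"
proof -
  have u: "orthonormal_family (min CARD('m) CARD('n)) u"
    and A: "A = (\<Sum>j<min CARD('m) CARD('n). outer (u j) (\<sigma> j *\<^sub>R v j))"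
    using assms(1) unfolding is_svd_def is_svd_outer by blast+
  have "A ** R = (\<Sum>j<min CARD('m) CARD('n). outer (u j) (\<sigma> j *\<^sub>R (R *v v j)))"
    by (subst A) (simp add: matrix_sum_right outer_mult projectorD[OF R] matrix_vector_scaleR)
  then show ?thesis
    by (simp add: norm_sum_outer'[OF u] power_mult_distrib)
qed

lemma schatten_norm_2: "schatten_norm 2 (A::'a::rc_field^'n^'m) = norm A"
proof -
  obtain u v where svd: "is_svd A (singular_value A) u v"
    unfolding singular_value_def using someI_ex[OF svd_exists[of A]] by blast
  then have v: "orthonormal_family (min CARD('m) CARD('n)) v" and \<sigma>: "0 \<le> singular_value A j" for j
    unfolding is_svd_def by blast+
  have "(norm A)\<^sup>2 = (\<Sum>j<min CARD('m) CARD('n). (singular_value A j)\<^sup>2)"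
    using is_svd_norm[OF svd, of "mat 1"] orthonormal_family_norm[OF v] by (simp add: projector_def)
  moreover have "singular_value A j powr 2 = (singular_value A j)\<^sup>2" for j
    using \<sigma>[of j] by (cases "singular_value A j = 0") (simp_all add: powr_numeral)
  ultimately have "schatten_norm 2 A = ((norm A)\<^sup>2) powr (1 / 2)"
    by (simp add: schatten_norm_def)
  then show ?thesis by (simp add: powr_half_sqrt)
qed

subsection \<open>Tail energy\<close>

text \<open>Gram-Schmidt: a vector not yet fixed adds the projector onto its normalized residual and
  raises the trace by 1.\<close>

lemma projector_fixing_finite_set:
  fixes S :: "('a::rc_field^'n) set"
  assumes "finite S"
  shows "\<exists>P. projector P \<and> (\<forall>x\<in>S. P *v x = x) \<and> inner P (mat 1) \<le> real (card S)"
  using assms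
proof (induction S)
  case empty
  show ?case by (rule exI[of _ 0]) (simp add: projector_def)
next
  case (insert z S)
  then obtain P where P: "projector P" and fixS: "\<And>x. x \<in> S \<Longrightarrow> P *v x = x" and tr: "inner P (mat 1) \<le> real (card S)"
    by blast
  show ?case
  proof (cases "P *v z = z")
    case True
    then show ?thesis using P fixS tr insert.hyps by (intro exI[of _ P]) auto
  next
    case False
    define u where "u = (1 / norm (z - P *v z)) *\<^sub>R (z - P *v z)"
    have Pu: "P *v u = 0"
      using projectorD(2)[OF P]
      by (simp add: u_def matrix_vector_scaleR matrix_vector_mult_diff_distrib matrix_vector_mul_assoc)
    have nu: "norm u = 1" using False by (simp add: u_def)
    have uP: "hdot u (P *v a) = 0" for a
      using hdot_mult[of P u a] Pu projectorD(1)[OF P] by (simp add: hdot_def)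
    define Q where "Q = P + outer u u"
    have uu: "outer u u ** outer u u = outer u u"
      by (simp add: mult_outer outer_mult_vector hdot_self nu)
    have uP0: "outer u u ** P = 0"
      using projectorD(1)[OF P] Pu by (simp add: outer_mult)
    have Q: "projector Q"
      using projectorD[OF P] Pu
      by (simp add: Q_def projector_def adj_simps adj_outer matrix_ring_simps uu uP0) (simp add: mult_outer)
    have "Q *v x = x" if "x \<in> S" for x
      using fixS[OF that] uP[of x] by (simp add: Q_def matrix_vector_mult_add_rdistrib outer_mult_vector)
    moreover have "Q *v z = z"
    proof -
      have "z = P *v z + norm (z - P *v z) *\<^sub>R u" using False by (simp add: u_def)
      then have "hdot u z = hdot u (P *v z + norm (z - P *v z) *\<^sub>R u)" by simp
      also have "\<dots> = hdot u (P *v z) + norm (z - P *v z) *\<^sub>R hdot u u"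
        by (simp add: hdot_def sum.distrib distrib_left scaleR_sum_right)
      finally have "hdot u z = of_real (norm (z - P *v z))"
        by (simp add: uP hdot_self nu scaleR_conv_of_real)
      moreover have "(of_real (norm (z - P *v z)) :: 'a) *s u = z - P *v z"
      proof -
        have "(of_real c :: 'a) *s x = c *\<^sub>R x" for c and x :: "'a^'n"
          by (simp add: vec_eq_iff) (simp add: scaleR_conv_of_real)
        then show ?thesis using False by (simp add: u_def)
      qed
      ultimately show ?thesis
        by (simp add: Q_def matrix_vector_mult_add_rdistrib outer_mult_vector)
    qed
    moreover have "inner Q (mat 1) \<le> real (card (insert z S))"
    proof -
      have "inner (outer u u) (mat 1) = (norm (outer u u))\<^sup>2"
        by (rule projector_inner_mat_1) (simp add: projector_def adj_outer uu)
      also have "\<dots> = 1" by (simp add: power2_norm_eq_inner inner_outer hdot_self nu) (simp add: power2_norm_eq_inner[symmetric])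
      finally show ?thesis using tr insert.hyps by (simp add: Q_def inner_add_left)
    qed
    ultimately show ?thesis using Q by (intro exI[of _ Q]) auto
  qed
qed

text \<open>A projector fixing a basis of the row span fixes every row. Acting with \<open>P\<close>
  on the rows is right multiplication by \<open>transpose P\<close>, without conjugation.\<close>

lemma projector_for_rank:
  fixes B :: "'a::rc_field^'n^'m"
  shows "\<exists>R. projector R \<and> B ** R = B \<and> inner R (mat 1) \<le> real (rank B)"
proof -
  obtain S where S: "S \<subseteq> rows B" "rows B \<subseteq> vec.span S" "card S = vec.dim (rows B)"
    by (rule vec.basis_exists[of "rows B"])
  have "finite (rows B)" by (simp add: rows_def full_SetCompr_eq)
  then have "finite S" using S(1) finite_subset by blast
  from projector_fixing_finite_set[OF this] obtain P where P: "projector P"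
    and fixS: "\<And>x. x \<in> S \<Longrightarrow> P *v x = x" and tr: "inner P (mat 1) \<le> real (card S)" by blast
  have "P *v x = x" if "x \<in> vec.span S" for x
    using that
  proof (induction rule: vec.span_induct_alt)
    case base
    show ?case by simp
  next
    case (step c x y)
    then show ?case
      using fixS[of x] by (simp add: matrix_vector_right_distrib vector_scalar_commute)
  qed
  then have row: "P *v row i B = row i B" for i
    using S(2) by (auto simp: rows_def)
  have "B ** transpose P = B"
  proof -
    have "(B ** transpose P) $ i $ l = B $ i $ l" for i l
      using arg_cong[OF row[of i], of "\<lambda>x. x $ l"]
      by (simp add: matrix_matrix_mult_def matrix_vector_mult_def transpose_def row_def mult.commute)
    then show ?thesis by (simp add: vec_eq_iff)
  qed
  moreover have "projector (transpose P)"
    using projectorD[OF P]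
    by (simp add: projector_def matrix_transpose_mul[symmetric]) (simp add: vec_eq_iff transpose_def)
  moreover have "inner (transpose P) (mat 1) = inner P (mat 1)"
    by (simp add: inner_mat_1_right transpose_def)
  ultimately show ?thesis
    using tr S(3) by (intro exI[of _ "transpose P"]) (simp add: row_rank_def_gen)
qed

text \<open>Bathtub principle: after subtracting the threshold \<open>s \<rho>\<close>, the best
  weights are 1 on the first \<rho> indices and 0 beyond, and the threshold itself is paid for by
  the total weight.\<close>

lemma weighted_sum_le_leading_terms:
  fixes s w :: "nat \<Rightarrow> real"
  assumes dec: "decseq s" and s0: "\<And>j. 0 \<le> s j" and w: "\<And>j. j < q \<Longrightarrow> 0 \<le> w j" "\<And>j. j < q \<Longrightarrow> w j \<le> 1"
    and sw: "(\<Sum>j<q. w j) \<le> real \<rho>" and "\<rho> \<le> q"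
  shows "(\<Sum>j<q. s j * w j) \<le> (\<Sum>j<\<rho>. s j)"
proof -
  have "(\<Sum>j<q. (s j - s \<rho>) * w j) \<le> (\<Sum>j<q. if j < \<rho> then s j - s \<rho> else 0)"
  proof (rule sum_mono)
    fix j assume j: "j \<in> {..<q}"
    show "(s j - s \<rho>) * w j \<le> (if j < \<rho> then s j - s \<rho> else 0)"
    proof (cases "j < \<rho>")
      case True
      then have "s \<rho> \<le> s j" using decseqD[OF dec, of j \<rho>] by simp
      then show ?thesis using True w(2)[of j] j by (simp add: mult_left_le)
    next
      case False
      then have "s j \<le> s \<rho>" using decseqD[OF dec, of \<rho> j] by simp
      then show ?thesis using False w(1)[of j] j by (simp add: mult_nonpos_nonneg)
    qed
  qed
  also have "\<dots> = (\<Sum>j\<in>{..<q} \<inter> {j. j < \<rho>}. s j - s \<rho>)"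
    by (simp add: sum.inter_restrict)
  also have "{..<q} \<inter> {j. j < \<rho>} = {..<\<rho>}" using \<open>\<rho> \<le> q\<close> by auto
  also have "(\<Sum>j<\<rho>. s j - s \<rho>) = (\<Sum>j<\<rho>. s j) - real \<rho> * s \<rho>" by (simp add: sum_subtractf)
  finally have "(\<Sum>j<q. s j * w j) \<le> (\<Sum>j<\<rho>. s j) - real \<rho> * s \<rho> + s \<rho> * (\<Sum>j<q. w j)"
    by (simp add: left_diff_distrib sum_subtractf sum_distrib_left[symmetric])
  moreover have "s \<rho> * (\<Sum>j<q. w j) \<le> s \<rho> * real \<rho>"
    by (rule mult_left_mono[OF sw s0])
  ultimately show ?thesis by (simp add: mult.commute)
qed

lemma rank_zero: "rank (0::'a::field^'n^'m) = 0"
proof -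
  have "rows (0::'a^'n^'m) \<subseteq> {0}" by (auto simp: rows_def row_def vec_eq_iff)
  then show ?thesis by (simp add: row_rank_def_gen vec.dim_eq_0)
qed

lemma rank_less_nonempty: "{B :: 'a::field^'n^'m. rank B < j + 1} \<noteq> {}"
  using rank_zero by (metis (mono_tags) add_gr_0 empty_iff mem_Collect_eq zero_less_one)

text \<open>The Eckart-Young bound. A competitor \<open>B\<close> is replaced by a projector
  \<open>S\<close> with \<open>B ** S = B\<close>: the residual \<open>A - A ** S\<close> is no
  larger than \<open>A - B\<close>, and \<open>S\<close> captures at most the \<rho> leading
  squares. The intertwining pair serves the range and the co-range alike.\<close>

lemma tail_projectors:
  fixes A :: "'a::rc_field^'n^'m"
  assumes \<rho>: "\<rho> \<le> min CARD('m) CARD('n)"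
  shows "\<exists>P R. projector P \<and> projector R \<and> P ** A = A ** R
    \<and> inner P (mat 1) = real \<rho> \<and> inner R (mat 1) = real \<rho>
    \<and> (norm (A - A ** R))\<^sup>2 \<le> tail_energy_sq (\<rho> + 1) A"
proof -
  let ?q = "min CARD('m) CARD('n)"
  obtain \<sigma> u v where svd: "is_svd A \<sigma> u v" using svd_exists by blast
  then have u: "orthonormal_family ?q u" and v: "orthonormal_family ?q v"
    and \<sigma>: "\<And>j. 0 \<le> \<sigma> j" "decseq \<sigma>" and A: "A = (\<Sum>j<?q. outer (u j) (\<sigma> j *\<^sub>R v j))"
    unfolding is_svd_def is_svd_outer by blast+
  have u': "orthonormal_family \<rho> u" and v': "orthonormal_family \<rho> v"
    using u v \<rho> unfolding orthonormal_family_def by (meson less_le_trans)+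
  let ?P = "frame_projector \<rho> u" and ?R = "frame_projector \<rho> v"
  note P = projector_frame_projector[OF u'] and R = projector_frame_projector[OF v']
  have "?P ** A = (\<Sum>j<?q. outer (?P *v u j) (\<sigma> j *\<^sub>R v j))"
    by (subst A) (simp add: matrix_sum_left mult_outer)
  moreover have "A ** ?R = (\<Sum>j<?q. outer (u j) (\<sigma> j *\<^sub>R (?R *v v j)))"
    by (subst A) (simp add: matrix_sum_right outer_mult projectorD[OF R(1)] matrix_vector_scaleR)
  moreover have "outer (?P *v u j) (\<sigma> j *\<^sub>R v j) = outer (u j) (\<sigma> j *\<^sub>R (?R *v v j))" if "j < ?q" for j
    using frame_projector_mult[OF u' that \<rho> u] frame_projector_mult[OF v' that \<rho> v] by simp
  ultimately have PA: "?P ** A = A ** ?R" by (metis (no_types, lifting) lessThan_iff sum.cong)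
  have AR: "(norm (A ** ?R))\<^sup>2 = (\<Sum>j<\<rho>. (\<sigma> j)\<^sup>2)"
  proof -
    have "(norm (A ** ?R))\<^sup>2 = (\<Sum>j<?q. if j < \<rho> then (\<sigma> j)\<^sup>2 else 0)"
      unfolding is_svd_norm[OF svd R(1)]
      by (intro sum.cong refl) (simp add: frame_projector_mult[OF v' _ \<rho> v] orthonormal_family_norm[OF v])
    also have "\<dots> = (\<Sum>j\<in>{..<?q} \<inter> {j. j < \<rho>}. (\<sigma> j)\<^sup>2)" by (simp add: sum.inter_restrict)
    also have "{..<?q} \<inter> {j. j < \<rho>} = {..<\<rho>}" using \<rho> by auto
    finally show ?thesis .
  qed
  have "(norm (A - A ** ?R))\<^sup>2 \<le> (norm (A - B))\<^sup>2" if B: "rank B < \<rho> + 1" for B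
  proof -
    obtain S where S: "projector S" "B ** S = B" "inner S (mat 1) \<le> real (rank B)"
      using projector_for_rank[of B] by blast
    \<comment> \<open>The weights sum to at most the trace of \<open>S\<close>, hence to at most
      \<rho>.\<close>
    have "(\<Sum>j<?q. (norm (S *v v j))\<^sup>2) = (norm (S ** frame_projector ?q v))\<^sup>2"
      unfolding frame_projector_def matrix_sum_left mult_outer by (rule norm_sum_outer[OF v, symmetric])
    also have "\<dots> \<le> (norm S)\<^sup>2"
      by (intro power_mono projector_norm_le_right projector_frame_projector(1)[OF v]) simp
    also have "\<dots> \<le> real \<rho>" using S(3) B projector_inner_mat_1[OF S(1)] by simp
    finally have sw: "(\<Sum>j<?q. (norm (S *v v j))\<^sup>2) \<le> real \<rho>" .
    have "norm (S *v v j) \<le> 1" if "j < ?q" for j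
      using projector_vector[OF S(1), of "v j"] orthonormal_family_norm[OF v that] by simp
    then have "(norm (A ** S))\<^sup>2 \<le> (norm (A ** ?R))\<^sup>2"
      unfolding is_svd_norm[OF svd S(1)] AR using \<sigma>
      by (intro weighted_sum_le_leading_terms[OF _ _ _ _ sw \<rho>])
        (auto simp: decseq_def power_mono power_le_one)
    then have "(norm (A - A ** ?R))\<^sup>2 \<le> (norm (A - A ** S))\<^sup>2"
      using norm_sq_split_right[OF S(1), of A] norm_sq_split_right[OF R(1), of A] by linarith
    also have "A - A ** S = (A - B) - (A - B) ** S" by (simp add: matrix_ring_simps S(2))
    also have "(norm \<dots>)\<^sup>2 \<le> (norm (A - B))\<^sup>2"
      using norm_sq_split_right[OF S(1), of "A - B"] by simp
    finally show ?thesis .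
  qed
  moreover have "{B :: 'a^'n^'m. rank B < \<rho> + 1} \<noteq> {}"
    by (rule rank_less_nonempty)
  ultimately have "(norm (A - A ** ?R))\<^sup>2 \<le> tail_energy_sq (\<rho> + 1) A"
    unfolding tail_energy_sq_def by (intro cINF_greatest) auto
  with P R PA show ?thesis by blast
qed

lemma tail_energy_sq_nonneg: "0 \<le> tail_energy_sq (j + 1) (A::'a::rc_field^'n^'m)"
proof -
  have "{B :: 'a^'n^'m. rank B < j + 1} \<noteq> {}"
    by (rule rank_less_nonempty)
  then show ?thesis unfolding tail_energy_sq_def by (intro cINF_greatest) auto
qed

lemma truncation_error:
  fixes A :: "'a::rc_field^'n^'m"
  assumes B: "best_rank_approx r H B"
  shows "norm (A - B) \<le> tail_energy (r + 1) A + 2 * norm (A - H)"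
proof -
  \<comment> \<open>The maximum with 0 permits squaring, since the tail energy is defined through an
    infimum of squares.\<close>
  have "max 0 (norm (A - B) - 2 * norm (A - H)) \<le> norm (A - B')" if "rank B' < r + 1" for B'
  proof -
    have "norm (H - B) \<le> norm (H - B')"
    proof -
      have "(1::ereal) \<le> 2" by simp
      then have "schatten_norm 2 (H - B) \<le> schatten_norm 2 (H - B')"
        using B that unfolding best_rank_approx_def by simp
      then show ?thesis by (simp only: schatten_norm_2)
    qed
    also have "\<dots> \<le> norm (A - H) + norm (A - B')"
      using norm_triangle_ineq4[of "A - B'" "A - H"] by simp
    finally show ?thesis
      using norm_triangle_ineq[of "A - H" "H - B"] by simp
  qed
  then have "(max 0 (norm (A - B) - 2 * norm (A - H)))\<^sup>2 \<le> (norm (A - B'))\<^sup>2" if "rank B' < r + 1" for B'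
    using that by (intro power_mono) auto
  moreover have "{B :: 'a^'n^'m. rank B < r + 1} \<noteq> {}"
    by (rule rank_less_nonempty)
  ultimately have "(max 0 (norm (A - B) - 2 * norm (A - H)))\<^sup>2 \<le> tail_energy_sq (r + 1) A"
    unfolding tail_energy_sq_def by (intro cINF_greatest) auto
  then have "max 0 (norm (A - B) - 2 * norm (A - H)) \<le> tail_energy (r + 1) A"
    unfolding tail_energy_def by (rule real_le_rsqrt)
  then show ?thesis by simp
qed

subsection \<open>The joint law of the test matrices\<close>

lemma mem_box_vec: "x \<in> box l u \<longleftrightarrow> (\<forall>i. x $ i \<in> box (l $ i) (u $ i))"
  for x :: "'a::euclidean_space^'n"
  by (auto simp: box_def Basis_vec_def inner_axis)

lemma borel_measurable_vecI:
  fixes f :: "'w \<Rightarrow> 'a::euclidean_space^'n"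
  assumes "\<And>i. (\<lambda>x. f x $ i) \<in> borel_measurable M"
  shows "f \<in> borel_measurable M"
proof (rule borel_measurable_euclidean_space[THEN iffD2], rule ballI)
  fix b :: "'a^'n" assume "b \<in> Basis"
  then obtain i u where "b = axis i u" by (auto simp: Basis_vec_def)
  then show "(\<lambda>x. f x \<bullet> b) \<in> borel_measurable M"
    using assms[of i] by (simp add: inner_axis)
qed

context prob_space
begin

lemma std_normal_box:
  fixes g :: "'a \<Rightarrow> 'b::euclidean_space"
  assumes g: "std_normal M g"
  shows "emeasure M (g -` box l u \<inter> space M) =
    (\<Prod>b\<in>Basis. \<integral>\<^sup>+t. ennreal (std_normal_density t) * indicator {l \<bullet> b<..<u \<bullet> b} t \<partial>lborel)"
proof -
  let ?X = "\<lambda>b \<omega>. g \<omega> \<bullet> b" and ?A = "\<lambda>b. {l \<bullet> b<..<u \<bullet> b}"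
  have ind: "indep_vars (\<lambda>_. borel) ?X Basis"
    using g by (simp add: std_normal_def)
  have "g -` box l u \<inter> space M = (\<Inter>b\<in>Basis. ?X b -` ?A b \<inter> space M)"
    by (auto simp: box_def)
  also have "prob \<dots> = (\<Prod>b\<in>Basis. prob (?X b -` ?A b \<inter> space M))"
    by (rule indep_varsD_finite[OF ind]) auto
  finally have "prob (g -` box l u \<inter> space M) = (\<Prod>b\<in>Basis. prob (?X b -` ?A b \<inter> space M))" .
  then have "emeasure M (g -` box l u \<inter> space M) = (\<Prod>b\<in>Basis. emeasure M (?X b -` ?A b \<inter> space M))"
    by (simp add: emeasure_eq_measure prod_ennreal)
  also have "\<dots> = (\<Prod>b\<in>Basis. \<integral>\<^sup>+t. ennreal (std_normal_density t) * indicator (?A b) t \<partial>lborel)"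
    using g by (intro prod.cong refl distributed_emeasure) (auto simp: std_normal_def)
  finally show ?thesis .
qed

lemma std_normal_matrix_box:
  fixes G :: "'a \<Rightarrow> 'b::euclidean_space^'n^'m"
  assumes G: "std_normal_matrix M G"
  shows "emeasure M (G -` box l u \<inter> space M) = emeasure gauss (box l u)"
proof -
  let ?X = "\<lambda>(i, j) \<omega>. G \<omega> $ i $ j" and ?A = "\<lambda>(i, j). box (l $ i $ j) (u $ i $ j)"
  have ind: "indep_vars (\<lambda>_. borel) ?X UNIV"
    using G by (simp add: std_normal_matrix_def)
  have "G -` box l u \<inter> space M = (\<Inter>p\<in>UNIV. ?X p -` ?A p \<inter> space M)"
    by (auto simp: mem_box_vec)
  also have "prob \<dots> = (\<Prod>p\<in>UNIV. prob (?X p -` ?A p \<inter> space M))"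
    by (rule indep_varsD_finite[OF ind]) auto
  finally have "prob (G -` box l u \<inter> space M) = (\<Prod>p\<in>UNIV. prob (?X p -` ?A p \<inter> space M))" .
  then have "emeasure M (G -` box l u \<inter> space M) = (\<Prod>p\<in>UNIV. emeasure M (?X p -` ?A p \<inter> space M))"
    by (simp add: emeasure_eq_measure prod_ennreal)
  also have "\<dots> = (\<Prod>p\<in>UNIV \<times> UNIV. emeasure M (?X p -` ?A p \<inter> space M))"
    by simp
  also have "\<dots> = (\<Prod>i\<in>UNIV. \<Prod>j\<in>UNIV. emeasure M ((\<lambda>\<omega>. G \<omega> $ i $ j) -` box (l $ i $ j) (u $ i $ j) \<inter> space M))"
    by (subst prod.cartesian_product) (simp add: split_def)
  also have "\<dots> = emeasure gauss (box l u)"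
    unfolding emeasure_gauss_box prod_Basis_vec
    using G by (intro prod.cong refl) (simp add: std_normal_box std_normal_matrix_def inner_axis)
  finally show ?thesis .
qed

lemma std_normal_matrix_measurable:
  assumes "std_normal_matrix M (G :: 'a \<Rightarrow> 'b::euclidean_space^'n^'m)"
  shows "G \<in> borel_measurable M"
proof (intro borel_measurable_vecI)
  fix i j
  show "(\<lambda>\<omega>. G \<omega> $ i $ j) \<in> borel_measurable M"
    using assms by (auto simp: std_normal_matrix_def indep_vars_def)
qed

end

lemma box_Pair: "box (a, b) (c, d) = box a c \<times> box b d"
  by (auto simp: box_def Basis_prod_def ball_Un)

lemma emeasure_gauss_Times:
  assumes [measurable]: "A \<in> sets borel" "B \<in> sets borel"
  shows "emeasure gauss (A \<times> B) = emeasure gauss A * emeasure gauss B"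
proof -
  have [measurable]: "A \<times> B \<in> sets borel"
    unfolding borel_prod[symmetric] by measurable
  have "emeasure gauss (A \<times> B) = (\<integral>\<^sup>+z. indicator (A \<times> B) z \<partial>gauss)" by simp
  also have "\<dots> = (\<integral>\<^sup>+x. \<integral>\<^sup>+y. indicator A x * indicator B y \<partial>gauss \<partial>gauss)"
    by (subst nn_integral_gauss_Pair) (simp_all add: indicator_times)
  also have "\<dots> = emeasure gauss A * emeasure gauss B"
    by (simp add: nn_integral_cmult nn_integral_multc)
  finally show ?thesis .
qed

lemma AE_gauss_Pair:
  fixes Q :: "'a::euclidean_space \<times> 'b::euclidean_space \<Rightarrow> bool"
  assumes m: "{z. Q z} \<in> sets borel" and AE: "AE x in gauss. AE y in gauss. Q (x, y)"
  shows "AE z in gauss. Q z"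
proof (rule AE_I')
  have [measurable]: "{z. \<not> Q z} \<in> sets borel"
    using sets.compl_sets[OF m] by (simp add: Compl_eq_Diff_UNIV[symmetric] Collect_neg_eq)
  have "emeasure gauss {z. \<not> Q z} = (\<integral>\<^sup>+z. indicator {z. \<not> Q z} z \<partial>gauss)" by simp
  also have "\<dots> = (\<integral>\<^sup>+x. \<integral>\<^sup>+y. indicator {z. \<not> Q z} (x, y) \<partial>gauss \<partial>gauss)"
    by (rule nn_integral_gauss_Pair) simp
  also have "\<dots> = (\<integral>\<^sup>+(x::'a). 0 \<partial>gauss)"
    using AE
  proof (intro nn_integral_cong_AE, eventually_elim)
    fix x assume "AE y in gauss. Q (x, y)"
    then have "AE y in gauss. (indicator {z. \<not> Q z} (x, y) :: ennreal) = 0"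
      by eventually_elim simp
    then have "(\<integral>\<^sup>+y. indicator {z. \<not> Q z} (x, y) \<partial>gauss) = (\<integral>\<^sup>+(y::'b). 0 \<partial>gauss)"
      by (rule nn_integral_cong_AE)
    then show "(\<integral>\<^sup>+y. indicator {z. \<not> Q z} (x, y) \<partial>gauss) = 0" by simp
  qed
  finally show "{z. \<not> Q z} \<in> null_sets gauss" by (simp add: null_sets_def)
  show "{z \<in> space gauss. \<not> Q z} \<subseteq> {z. \<not> Q z}" by simp
qed

text \<open>\<open>\<Psi>\<close> precedes \<open>\<Phi>\<close> in the tuple so that the iterated
  integrals come in the order in which they are estimated: \<open>\<Phi>\<close> innermost, then
  \<open>\<Psi>\<close>, \<open>\<Omega>\<close> and \<open>\<Upsilon>\<close>.\<close>

lemma joint_law_gauss: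
  fixes \<Upsilon> :: "'w \<Rightarrow> 'a::euclidean_space^'m^'k" and \<Omega> :: "'w \<Rightarrow> 'a^'n^'k"
    and \<Phi> :: "'w \<Rightarrow> 'a^'m^'s" and \<Psi> :: "'w \<Rightarrow> 'a^'n^'s"
  assumes M: "prob_space M" and G: "indep_std_normal_matrices M \<Upsilon> \<Omega> \<Phi> \<Psi>"
  shows "distr M borel (\<lambda>\<omega>. (\<Upsilon> \<omega>, \<Omega> \<omega>, \<Psi> \<omega>, \<Phi> \<omega>)) = gauss"
    and "(\<lambda>\<omega>. (\<Upsilon> \<omega>, \<Omega> \<omega>, \<Psi> \<omega>, \<Phi> \<omega>)) \<in> borel_measurable M"
proof -
  interpret prob_space M by fact
  let ?Z = "\<lambda>\<omega>. (\<Upsilon> \<omega>, \<Omega> \<omega>, \<Psi> \<omega>, \<Phi> \<omega>)"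
  have n: "std_normal_matrix M \<Upsilon>" "std_normal_matrix M \<Omega>" "std_normal_matrix M \<Phi>" "std_normal_matrix M \<Psi>"
    and ind: "indep_sets (\<lambda>i. [generated_events M \<Upsilon>, generated_events M \<Omega>,
             generated_events M \<Phi>, generated_events M \<Psi>] ! i) {..<4::nat}"
    using G by (auto simp: indep_std_normal_matrices_def)
  note [measurable] = n[THEN std_normal_matrix_measurable]
  have "?Z \<in> measurable M (borel \<Otimes>\<^sub>M (borel \<Otimes>\<^sub>M (borel \<Otimes>\<^sub>M borel)))"
    by measurable
  then show Z [measurable]: "?Z \<in> borel_measurable M"
    by (simp only: borel_prod)
  show "distr M borel ?Z = gauss"
  proof (rule gauss_eqI)
    fix l u :: "('a^'m^'k) \<times> ('a^'n^'k) \<times> ('a^'n^'s) \<times> ('a^'m^'s)"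
    obtain l1 l2 l3 l4 u1 u2 u3 u4 where l: "l = (l1, l2, l3, l4)" and u: "u = (u1, u2, u3, u4)"
      by (metis prod_cases4)
    let ?A = "\<lambda>i. [\<Upsilon> -` box l1 u1 \<inter> space M, \<Omega> -` box l2 u2 \<inter> space M, \<Phi> -` box l4 u4 \<inter> space M, \<Psi> -` box l3 u3 \<inter> space M] ! i"
    have four: "{..<4::nat} = {0, 1, 2, 3}" by auto
    have "\<forall>i\<in>{..<4}. ?A i \<in> [generated_events M \<Upsilon>, generated_events M \<Omega>,
             generated_events M \<Phi>, generated_events M \<Psi>] ! i"
      unfolding four by (auto simp: generated_events_def)
    then have "prob (\<Inter>i\<in>{..<4}. ?A i) = (\<Prod>i\<in>{..<4}. prob (?A i))"
      by (intro indep_setsD[OF ind]) (auto simp: four)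
    moreover have "(\<Inter>i\<in>{..<4}. ?A i) = ?Z -` box l u \<inter> space M"
      unfolding four by (auto simp: l u box_Pair)
    ultimately have "emeasure M (?Z -` box l u \<inter> space M) = (\<Prod>i\<in>{..<4}. emeasure M (?A i))"
      by (simp add: emeasure_eq_measure prod_ennreal)
    moreover have "box l3 u3 \<times> box l4 u4 \<in> sets borel" "box l2 u2 \<times> box l3 u3 \<times> box l4 u4 \<in> sets borel"
      by (simp_all flip: box_Pair)
    then have "(\<Prod>i\<in>{..<4}. emeasure M (?A i)) = emeasure gauss (box l u)"
      unfolding four by (simp add: l u box_Pair emeasure_gauss_Times std_normal_matrix_box n mult_ac)
    ultimately show "emeasure (distr M borel ?Z) (box l u) = emeasure gauss (box l u)"
      by (simp add: emeasure_distr)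
  qed simp
qed

subsection \<open>Conditional error bounds\<close>

text \<open>Off the singular set \<open>\<Phi> ** Q\<close> has an explicit left inverse whose
  product in the other order is Hermitian. This yields the Penrose equations and also the uniqueness
  behind the definite description.\<close>

lemma pinv_eq_lsq:
  fixes Q :: "'a::rc_field^'k^'m" and \<Phi> :: "'a^'m^'s"
  assumes Q: "adj Q ** Q = mat 1" and nz: "det (pgram 0 (Q ** adj Q) \<Phi>) \<noteq> 0"
  shows "pinv (\<Phi> ** Q) = adj Q ** lsq 0 (Q ** adj Q) \<Phi>"
proof -
  let ?J = "lsq 0 (Q ** adj Q) \<Phi>" and ?L = "\<Phi> ** Q"
  let ?G = "adj Q ** ?J"
  note J = lsq_zero[OF orthonormal_columns(1)[OF Q] nz]
  have QQ: "Q ** adj Q ** Q = Q" by (metis Q matrix_mul_assoc matrix_mul_rid)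
  have "?J ** \<Phi> ** Q = ?J ** \<Phi> ** (Q ** adj Q) ** Q"
    by (simp add: matrix_mul_assoc[symmetric] Q)
  also have "\<dots> = Q" by (simp only: J(1) QQ)
  finally have GL: "?G ** ?L = mat 1" by (metis Q matrix_mul_assoc)
  have LG: "?L ** ?G = \<Phi> ** ?J"
    using J(2) by (simp add: matrix_mul_assoc[symmetric])
  have "is_pinv ?L ?G"
  proof -
    have "?L ** ?G ** ?L = ?L ** (?G ** ?L)" by (simp only: matrix_mul_assoc)
    then have "?L ** ?G ** ?L = ?L" by (simp only: GL matrix_mul_rid)
    moreover have "?G ** ?L ** ?G = ?G" by (simp only: GL matrix_mul_lid)
    moreover have "adj (?L ** ?G) = ?L ** ?G" by (simp only: LG J(3))
    moreover have "adj (?G ** ?L) = ?G ** ?L" by (simp only: GL adj_mat_1)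
    ultimately show ?thesis unfolding is_pinv_def by blast
  qed
  moreover have "G' = ?G" if "is_pinv ?L G'" for G'
  proof -
    have 1: "?L ** G' ** ?L = ?L" "G' ** ?L ** G' = G'" "adj (?L ** G') = ?L ** G'"
      using that by (auto simp: is_pinv_def)
    \<comment> \<open>\<open>?L ** ?G\<close> and \<open>?L ** G'\<close> are orthogonal projectors
      onto the same range, hence equal; the left inverse then cancels \<open>?L\<close>.\<close>
    have "?L ** ?G = adj (?L ** ?G)" by (simp only: LG J(3))
    also have "\<dots> = adj (?L ** G' ** (?L ** ?G))"
      using 1(1) by (simp only: matrix_mul_assoc)
    also have "\<dots> = ?L ** ?G ** (?L ** G')"
      by (simp only: adj_mult[of "?L ** G'"] 1(3) LG J(3))
    also have "\<dots> = ?L ** (?G ** ?L) ** G'" by (simp only: matrix_mul_assoc)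
    also have "\<dots> = ?L ** G'" by (simp only: GL matrix_mul_rid)
    finally have LL: "?L ** ?G = ?L ** G'" .
    have "G' = ?G ** ?L ** G'" by (simp only: GL matrix_mul_lid)
    also have "\<dots> = ?G ** (?L ** G')" by (simp only: matrix_mul_assoc)
    also have "\<dots> = ?G ** (?L ** ?G)" by (simp only: LL)
    also have "\<dots> = ?G ** ?L ** ?G" by (simp only: matrix_mul_assoc)
    finally show ?thesis by (simp only: GL matrix_mul_lid)
  qed
  ultimately show ?thesis unfolding pinv_def by (rule the_equality)
qed

text \<open>The best core is \<open>adj Q ** A ** P\<close>: its residual is orthogonal to every
  matrix \<open>Q ** X ** adj P\<close>.\<close>

lemma norm_sq_sandwich:
  fixes A :: "'a::rc_field^'n^'m" and Q :: "'a^'k^'m" and P :: "'a^'k^'n"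
  assumes Q: "adj Q ** Q = mat 1" and P: "adj P ** P = mat 1"
  shows "(norm (A - Q ** C ** adj P))\<^sup>2
    = (norm (A - Q ** adj Q ** A ** (P ** adj P)))\<^sup>2 + (norm (C - adj Q ** A ** P))\<^sup>2"
proof -
  let ?D = "A - Q ** adj Q ** A ** (P ** adj P)" and ?X = "adj Q ** A ** P - C"
  have "inner ?D (Q ** ?X ** adj P) = inner (adj Q ** ?D ** P) ?X"
    using inner_mult_left[of "adj Q" "?D ** P" ?X] inner_mult_right[of ?D P "Q ** ?X"]
    by (simp add: matrix_mul_assoc)
  also have "adj Q ** ?D ** P = 0"
  proof -
    have "adj Q ** (Q ** adj Q ** A ** (P ** adj P)) ** P = (adj Q ** Q) ** adj Q ** A ** P ** (adj P ** P)"
      by (simp only: matrix_mul_assoc)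
    then show ?thesis by (simp add: matrix_ring_simps Q P)
  qed
  finally have "(norm (?D + Q ** ?X ** adj P))\<^sup>2 = (norm ?D)\<^sup>2 + (norm (Q ** ?X ** adj P))\<^sup>2"
    by (intro norm_add_Pythagorean) (simp add: orthogonal_def)
  moreover have "?D + Q ** ?X ** adj P = A - Q ** C ** adj P"
    by (simp add: matrix_algebra)
  moreover have "norm (Q ** ?X ** adj P) = norm ?X"
  proof -
    have "norm (Q ** ?X ** adj P) = norm (?X ** adj P)"
      unfolding matrix_mul_assoc[symmetric] by (rule orthonormal_columns(3)[OF Q])
    also have "\<dots> = norm (P ** adj ?X)" by (subst norm_adj[symmetric]) (simp add: adj_mult)
    also have "\<dots> = norm (adj ?X)" by (rule orthonormal_columns(3)[OF P])
    finally show ?thesis by simp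
  qed
  ultimately show ?thesis by (simp add: norm_minus_commute)
qed

text \<open>The core matrix of \<open>initial_approx\<close> with both pseudoinverses in least
  squares form: Borel measurable, and equal to the original wherever \<open>pinv_eq_lsq\<close>
  applies.\<close>

definition core_sketch :: "'a::rc_field^'n^'m \<Rightarrow> 'a^'k^'n \<Rightarrow> 'a^'k^'m \<Rightarrow> 'a^'n^'s \<Rightarrow> 'a^'m^'s \<Rightarrow> 'a^'k^'k" where
  "core_sketch A P Q H G =
    adj Q ** lsq 0 (Q ** adj Q) G ** (G ** A ** adj H) ** adj (adj P ** lsq 0 (P ** adj P) H)"

text \<open>For fixed frames the core differs from the best one by \<open>c H\<close>, which
  involves \<open>\<Psi>\<close> alone, and a term in which \<open>\<Phi>\<close> acts on
  \<open>N H\<close>. Averaging over \<open>\<Phi>\<close> first leaves two expressions in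
  \<open>H\<close>, to which the same mean square bound applies again.\<close>

lemma core_sketch_error:
  fixes A :: "'a::rc_field^'n^'m" and Q :: "'a^'k^'m" and P :: "'a^'k^'n"
  assumes Q: "adj Q ** Q = mat 1" and P: "adj P ** P = mat 1"
  defines "d \<equiv> real DIM('a) * real CARD('s) - real DIM('a) * real CARD('k) + real DIM('a) - 2"
  defines "kap \<equiv> real DIM('a) * real CARD('k) / d"
  assumes d: "0 < d" and kap: "kap \<le> 1"
  shows "(\<integral>\<^sup>+H. \<integral>\<^sup>+G. ennreal ((norm (A - Q ** core_sketch A P Q (H :: 'a^'n^'s) G ** adj P))\<^sup>2) \<partial>gauss \<partial>gauss)
    \<le> ennreal ((1 + kap) * (norm (A - Q ** adj Q ** A ** (P ** adj P)))\<^sup>2)"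
proof -
  define J where "J = Q ** adj Q"
  define K where "K = P ** adj P"
  note pJ = orthonormal_columns[OF Q, folded J_def] and pK = orthonormal_columns[OF P, folded K_def]
  have QJ: "adj Q ** J = adj Q" using Q by (simp add: J_def matrix_mul_assoc)
  have JQ: "J ** Q = Q" using Q by (simp add: J_def matrix_mul_assoc[symmetric])
  have PK: "adj P ** K = adj P" using P by (simp add: K_def matrix_mul_assoc)
  have KP: "K ** P = P" using P by (simp add: K_def matrix_mul_assoc[symmetric])
  have kap0: "0 \<le> kap" using d by (simp add: kap_def)
  have dJ: "0 < real DIM('a) * real CARD('s) - real DIM('a) * inner J (mat 1) + real DIM('a) - 2"
    and dK: "0 < real DIM('a) * real CARD('s) - real DIM('a) * inner K (mat 1) + real DIM('a) - 2"
    using d unfolding pJ(2) pK(2) d_def by simp_all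
  define a where "a = (norm (A - J ** A ** K))\<^sup>2"
  \<comment> \<open>\<open>T H\<close> is an oblique substitute for \<open>adj P\<close>: almost
    surely both agree after multiplication by \<open>K\<close>, so only the part of \<open>A\<close>
    off the range of \<open>P\<close> causes an error.\<close>
  define T where "T H = adj P ** lsq 0 K H ** H" for H :: "'a^'n^'s"
  define c where "c H = adj Q ** A ** (adj (T H) - P)" for H
  define N where "N H = (mat 1 - J) ** A ** adj (T H)" for H
  have [measurable]: "T \<in> borel_measurable borel" "c \<in> borel_measurable borel" "N \<in> borel_measurable borel"
    unfolding T_def c_def N_def by measurable
  have JN: "J ** N H = 0" for H
    using projectorD(2)[OF pJ(1)] by (simp add: N_def matrix_algebra)
  have inner: "(\<integral>\<^sup>+G. ennreal ((norm (A - Q ** core_sketch A P Q H G ** adj P))\<^sup>2) \<partial>gauss)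
    \<le> ennreal a + (ennreal ((norm (c H))\<^sup>2) + ennreal kap * ennreal ((norm (N H))\<^sup>2))" for H :: "'a^'n^'s"
  proof -
    have "(\<integral>\<^sup>+G. ennreal ((norm (A - Q ** core_sketch A P Q H G ** adj P))\<^sup>2) \<partial>gauss)
      = (\<integral>\<^sup>+G. ennreal a + ennreal ((norm (c H + adj Q ** lsq 0 J (G :: 'a^'m^'s) ** G ** N H))\<^sup>2) \<partial>gauss)"
      using AE_pgram_nonsingular[OF pJ(1) dJ]
    proof (intro nn_integral_cong_AE, eventually_elim)
      fix G :: "'a^'m^'s" assume nz: "det (pgram 0 J G) \<noteq> 0"
      have "adj Q ** (lsq 0 J G ** G ** J) = adj Q"
        by (simp add: lsq_zero(1)[OF pJ(1) nz] QJ)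
      then have L: "adj Q ** lsq 0 J G ** G ** J = adj Q"
        by (simp add: matrix_mul_assoc)
      have core: "core_sketch A P Q H G = adj Q ** lsq 0 J G ** G ** A ** adj (T H)"
        by (simp add: core_sketch_def J_def K_def T_def adj_mult matrix_mul_assoc)
      have "core_sketch A P Q H G - adj Q ** A ** P = c H + adj Q ** lsq 0 J G ** G ** N H"
        unfolding core c_def N_def by (simp add: matrix_algebra L)
      then show "ennreal ((norm (A - Q ** core_sketch A P Q H G ** adj P))\<^sup>2)
        = ennreal a + ennreal ((norm (c H + adj Q ** lsq 0 J G ** G ** N H))\<^sup>2)"
        unfolding norm_sq_sandwich[OF Q P] a_def J_def[symmetric] K_def[symmetric] by simp
    qed
    also have "\<dots> = ennreal a + (\<integral>\<^sup>+G. ennreal ((norm (c H + adj Q ** lsq 0 J G ** G ** N H))\<^sup>2)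
        \<partial>(gauss :: ('a^'m^'s) measure))"
      by (subst nn_integral_add) auto
    also have "\<dots> \<le> ennreal a + ennreal ((norm (c H))\<^sup>2 + kap * (norm (N H))\<^sup>2)"
      using nn_integral_lsq[OF pJ(1) pJ(4) JN dJ, of "c H" H] unfolding kap_def d_def pJ(2)
      by (intro add_left_mono)
    also have "\<dots> = ennreal a + (ennreal ((norm (c H))\<^sup>2) + ennreal kap * ennreal ((norm (N H))\<^sup>2))"
      using kap0 by (simp add: ennreal_mult)
    finally show ?thesis .
  qed
  have TK: "AE H in (gauss :: ('a^'n^'s) measure). T H ** K = adj P"
    using AE_pgram_nonsingular[OF pK(1) dK]
  proof eventually_elim
    fix H :: "'a^'n^'s" assume nz: "det (pgram 0 K H) \<noteq> 0"
    have "adj P ** (lsq 0 K H ** H ** K) = adj P"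
      by (simp add: lsq_zero(1)[OF pK(1) nz] PK)
    then show "T H ** K = adj P" by (simp add: T_def matrix_mul_assoc)
  qed
  have T_int: "(\<integral>\<^sup>+H. ennreal ((norm (T (H :: 'a^'n^'s) ** B))\<^sup>2) \<partial>gauss)
      \<le> ennreal ((norm (adj P ** B))\<^sup>2 + kap * (norm (B - K ** B))\<^sup>2)" for B :: "'a^'p^'n"
  proof -
    have KB: "K ** (B - K ** B) = 0"
      using projectorD(2)[OF pK(1)] by (simp add: matrix_algebra)
    have "(\<integral>\<^sup>+H. ennreal ((norm (T (H :: 'a^'n^'s) ** B))\<^sup>2) \<partial>gauss)
      = (\<integral>\<^sup>+H. ennreal ((norm (adj P ** B + adj P ** lsq 0 K (H :: 'a^'n^'s) ** H ** (B - K ** B)))\<^sup>2) \<partial>gauss)"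
      using TK
    proof (intro nn_integral_cong_AE, eventually_elim)
      fix H :: "'a^'n^'s" assume TK: "T H ** K = adj P"
      have "T H ** B = adj P ** B + adj P ** lsq 0 K H ** H ** (B - K ** B)"
        using TK by (simp add: T_def matrix_algebra)
      then show "ennreal ((norm (T H ** B))\<^sup>2)
        = ennreal ((norm (adj P ** B + adj P ** lsq 0 K H ** H ** (B - K ** B)))\<^sup>2)" by simp
    qed
    also have "\<dots> \<le> ennreal ((norm (adj P ** B))\<^sup>2 + kap * (norm (B - K ** B))\<^sup>2)"
      using nn_integral_lsq[OF pK(1) pK(4) KB dK] unfolding kap_def d_def pK(2) .
    finally show ?thesis .
  qed
  \<comment> \<open>The blocks of the compression error: off the range of \<open>P\<close> only, off
    the range of \<open>Q\<close> only, and off both. They cost \<open>kap * x\<close>,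
    \<open>kap * y\<close> and \<open>kap * (kap * z)\<close>.\<close>
  define x where "x = (norm (adj Q ** A - adj Q ** A ** K))\<^sup>2"
  define y where "y = (norm ((A - J ** A) ** K))\<^sup>2"
  define z where "z = (norm ((A - J ** A) - (A - J ** A) ** K))\<^sup>2"
  have c: "(\<integral>\<^sup>+H. ennreal ((norm (c H))\<^sup>2) \<partial>(gauss :: ('a^'n^'s) measure)) \<le> ennreal (kap * x)"
  proof -
    let ?B = "(mat 1 - K) ** (adj A ** Q)"
    have PB: "adj P ** ?B = 0" by (simp add: matrix_algebra PK)
    have KB: "?B - K ** ?B = ?B"
      using projectorD(2)[OF pK(1)] by (simp add: matrix_algebra)
    have "norm ?B = norm (adj ?B)" by simp
    also have "adj ?B = adj Q ** A - adj Q ** A ** K"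
      using projectorD(1)[OF pK(1)] by (simp add: adj_simps matrix_algebra)
    finally have x: "(norm ?B)\<^sup>2 = x" by (simp add: x_def)
    have "(\<integral>\<^sup>+H. ennreal ((norm (c H))\<^sup>2) \<partial>(gauss :: ('a^'n^'s) measure))
      = (\<integral>\<^sup>+H. ennreal ((norm (T H ** ?B))\<^sup>2) \<partial>(gauss :: ('a^'n^'s) measure))"
      using TK
    proof (intro nn_integral_cong_AE, eventually_elim)
      fix H :: "'a^'n^'s" assume TK: "T H ** K = adj P"
      then have "T H ** ?B = (T H - adj P) ** adj A ** Q"
        by (simp add: matrix_algebra)
      also have "\<dots> = adj (c H)"
        by (simp add: c_def adj_simps matrix_mul_assoc)
      finally show "ennreal ((norm (c H))\<^sup>2) = ennreal ((norm (T H ** ?B))\<^sup>2)" by simp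
    qed
    also have "\<dots> \<le> ennreal (kap * x)"
      using T_int[of ?B] by (simp only: PB KB x) simp
    finally show ?thesis .
  qed
  have N: "(\<integral>\<^sup>+H. ennreal ((norm (N H))\<^sup>2) \<partial>(gauss :: ('a^'n^'s) measure)) \<le> ennreal (y + kap * z)"
  proof -
    let ?B = "adj (A - J ** A)"
    have NT: "N H = adj (T H ** ?B)" for H
      by (simp add: N_def adj_mult matrix_ring_simps)
    have "norm (adj P ** ?B) = norm (P ** (adj P ** ?B))"
      by (rule pK(3)[symmetric])
    also have "P ** (adj P ** ?B) = adj ((A - J ** A) ** K)"
      using projectorD(1)[OF pK(1)] by (simp add: adj_mult matrix_mul_assoc K_def[symmetric])
    finally have y: "(norm (adj P ** ?B))\<^sup>2 = y" by (simp add: y_def)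
    have "?B - K ** ?B = adj ((A - J ** A) - (A - J ** A) ** K)"
      using projectorD(1)[OF pK(1)] by (simp add: adj_diff adj_mult[of _ K])
    then have z: "(norm (?B - K ** ?B))\<^sup>2 = z" by (simp add: z_def)
    show ?thesis
      using T_int[of ?B] by (simp add: NT y z)
  qed
  have axyz: "a = x + y + z"
  proof -
    have "a = (norm (J ** A - J ** A ** K))\<^sup>2 + (norm (A - J ** A))\<^sup>2"
    proof -
      have "J ** (A - J ** A ** K) = J ** A - J ** A ** K"
        using projectorD(2)[OF pJ(1)] by (simp add: matrix_algebra)
      then show ?thesis
        unfolding a_def by (subst norm_sq_split_left[OF pJ(1)]) simp
    qed
    also have "norm (J ** A - J ** A ** K) = norm (Q ** (adj Q ** A - adj Q ** A ** K))"
      by (simp add: J_def matrix_algebra)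
    also have "\<dots> = norm (adj Q ** A - adj Q ** A ** K)" by (rule pJ(3))
    also have "(norm (A - J ** A))\<^sup>2 = y + z"
      unfolding y_def z_def by (rule norm_sq_split_right[OF pK(1)])
    finally show ?thesis by (simp add: x_def)
  qed
  have nn: "0 \<le> a" "0 \<le> x" "0 \<le> y" "0 \<le> z" by (simp_all add: a_def x_def y_def z_def)
  have "(\<integral>\<^sup>+H. \<integral>\<^sup>+G. ennreal ((norm (A - Q ** core_sketch A P Q (H :: 'a^'n^'s) G ** adj P))\<^sup>2) \<partial>gauss \<partial>gauss)
    \<le> (\<integral>\<^sup>+H. ennreal a + (ennreal ((norm (c H))\<^sup>2) + ennreal kap * ennreal ((norm (N H))\<^sup>2)) \<partial>(gauss :: ('a^'n^'s) measure))"
    by (rule nn_integral_mono) (rule inner)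
  also have "\<dots> = ennreal a + ((\<integral>\<^sup>+H. ennreal ((norm (c H))\<^sup>2) \<partial>(gauss :: ('a^'n^'s) measure))
      + ennreal kap * (\<integral>\<^sup>+H. ennreal ((norm (N H))\<^sup>2) \<partial>(gauss :: ('a^'n^'s) measure)))"
    by (simp add: nn_integral_add nn_integral_cmult)
  also have "\<dots> \<le> ennreal a + (ennreal (kap * x) + ennreal kap * ennreal (y + kap * z))"
    by (intro add_left_mono add_mono mult_left_mono c N) simp
  also have "\<dots> = ennreal (a + (kap * x + kap * (y + kap * z)))"
    using nn kap0 by (simp add: ennreal_mult[symmetric] ennreal_plus[symmetric] del: ennreal_plus)
  also have "\<dots> \<le> ennreal ((1 + kap) * a)"
  proof (rule ennreal_leI)
    \<comment> \<open>The bound \<open>kap \<le> 1\<close>, that is s \<ge> 2 k + \<alpha>, is spent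
      here.\<close>
    have "kap * (kap * z) \<le> kap * z"
      using kap kap0 nn(4) by (intro mult_left_mono mult_left_le_one_le) auto
    then show "a + (kap * x + kap * (y + kap * z)) \<le> (1 + kap) * a"
      unfolding axyz by (simp add: algebra_simps)
  qed
  finally show ?thesis by (simp only: a_def J_def K_def)
qed

text \<open>Keeping \<open>K U\<close> inside the range error avoids counting \<open>E\<close>
  twice: the range error yields the part of \<open>E\<close> on the range of \<open>K U\<close>, the
  co-range error the part off it, and by Pythagoras they add up to a single
  \<parallel>E\<parallel>^2. Each error adds kap \<parallel>E\<parallel>^2 of its own.\<close>

lemma range_finder_error:
  fixes A :: "'a::rc_field^'n^'m"
    and q :: "'a^'n^'k \<Rightarrow> 'a^'k^'m" and p :: "'a^'m^'k \<Rightarrow> 'a^'k^'n"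
  assumes q: "\<And>V. adj (q V) ** q V = mat 1" "\<And>V. \<exists>R. A ** adj V = q V ** R"
    and p: "\<And>U. adj (p U) ** p U = mat 1" "\<And>U. \<exists>R. adj (U ** A) = p U ** R"
    and [measurable]: "p \<in> borel_measurable borel" "q \<in> borel_measurable borel"
    and \<rho>: "\<rho> \<le> min CARD('m) CARD('n)"
  defines "d \<equiv> real DIM('a) * real CARD('k) - real DIM('a) * real \<rho> + real DIM('a) - 2"
  defines "kap \<equiv> real DIM('a) * real \<rho> / d"
  assumes d: "0 < d"
  shows "(\<integral>\<^sup>+U. \<integral>\<^sup>+V. ennreal ((norm (A - q V ** adj (q V) ** A ** (p U ** adj (p U))))\<^sup>2) \<partial>gauss \<partial>gauss)
    \<le> ennreal ((1 + 2 * kap) * tail_energy_sq (\<rho> + 1) A)"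
proof -
  obtain S R where S: "projector S" "inner S (mat 1) = real \<rho>" and R: "projector R" "inner R (mat 1) = real \<rho>"
    and SA: "S ** A = A ** R" and tail: "(norm (A - A ** R))\<^sup>2 \<le> tail_energy_sq (\<rho> + 1) A"
    using tail_projectors[OF \<rho>, of A] by blast
  define E where "E = A - A ** R"
  have RE: "R ** adj E = 0"
    using projectorD[OF R(1)] by (simp add: E_def adj_simps matrix_algebra)
  have ES: "E = A - S ** A" by (simp add: E_def SA)
  have SE: "S ** E = 0"
    using projectorD[OF S(1)] by (simp add: ES matrix_algebra)
  have kap0: "0 \<le> kap" using d by (simp add: kap_def)
  have dS: "0 < real DIM('a) * real CARD('k) - real DIM('a) * inner S (mat 1) + real DIM('a) - 2"
    and dR: "0 < real DIM('a) * real CARD('k) - real DIM('a) * inner R (mat 1) + real DIM('a) - 2"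
    using d unfolding S(2) R(2) d_def by simp_all
  define K where "K U = p U ** adj (p U)" for U
  have [measurable]: "K \<in> borel_measurable borel"
    unfolding K_def by measurable
  have K: "projector (K U)" for U unfolding K_def by (rule orthonormal_columns(1)[OF p(1)])
  have split: "(norm (A - q V ** adj (q V) ** A ** K U))\<^sup>2
    = (norm (A - A ** K U))\<^sup>2 + (norm ((A - q V ** adj (q V) ** A) ** K U))\<^sup>2" for U V
  proof -
    have "(A - q V ** adj (q V) ** A ** K U) ** K U = (A - q V ** adj (q V) ** A) ** K U"
      using K[of U] by (simp add: matrix_ring_simps projector_assoc)
    then show ?thesis
      by (subst norm_sq_split_right[OF K[of U]]) (simp add: matrix_ring_simps)
  qed
  have inner: "(\<integral>\<^sup>+V. ennreal ((norm (A - q V ** adj (q V) ** A ** K U))\<^sup>2) \<partial>gauss)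
    \<le> ennreal ((norm (A - A ** K U))\<^sup>2) + ennreal ((norm (E ** K U))\<^sup>2 + kap * (norm E)\<^sup>2)" for U
  proof -
    let ?c = "- (K U ** adj E)"
    have "(\<integral>\<^sup>+V. ennreal ((norm (A - q V ** adj (q V) ** A ** K U))\<^sup>2) \<partial>gauss)
      \<le> (\<integral>\<^sup>+V. ennreal ((norm (A - A ** K U))\<^sup>2)
        + ennreal ((norm (?c + K U ** lsq 0 R (V :: 'a^'n^'k) ** V ** adj E))\<^sup>2) \<partial>gauss)"
      using AE_pgram_nonsingular[OF R(1) dR]
    proof (intro nn_integral_mono_AE, eventually_elim)
      fix V :: "'a^'n^'k" assume nz: "det (pgram 0 R V) \<noteq> 0"
      let ?J = "q V ** adj (q V)" and ?X = "lsq 0 R V ** V"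
      note J = orthonormal_columns(1)[OF q(1)[of V]]
      obtain R2 where "A ** adj V = q V ** R2" using q(2) by blast
      moreover have "?J ** q V = q V"
        using q(1)[of V] by (simp add: matrix_mul_assoc[symmetric])
      ultimately have "?J ** (A ** adj V) = A ** adj V" by (simp add: matrix_mul_assoc)
      \<comment> \<open>\<open>A ** adj ?X\<close> lies in the range spanned by \<open>q V\<close>,
        so subtracting it from \<open>A\<close> changes nothing after projecting that range away;
        what is then projected involves \<open>E\<close> only.\<close>
      then have JX: "(A - ?J ** A) ** adj ?X = 0"
        by (simp add: matrix_ring_simps adj_mult matrix_mul_assoc)
      have RX: "R ** adj ?X = R"
        using arg_cong[OF lsq_zero(1)[OF R(1) nz], of adj] projectorD(1)[OF R(1)] by (simp add: adj_mult)
      have AX: "A - A ** adj ?X = E - E ** adj ?X"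
      proof -
        have "A ** R ** adj ?X = A ** R" using RX by (simp add: matrix_mul_assoc[symmetric])
        then show ?thesis by (simp add: E_def matrix_ring_simps)
      qed
      have "A - ?J ** A = (A - ?J ** A) - (A - ?J ** A) ** adj ?X" by (simp only: JX diff_zero)
      also have "\<dots> = (A - A ** adj ?X) - ?J ** (A - A ** adj ?X)"
        by (simp add: matrix_algebra)
      finally have "(A - ?J ** A) ** K U = (E - E ** adj ?X) ** K U - ?J ** ((E - E ** adj ?X) ** K U)"
        unfolding AX by (simp add: matrix_algebra)
      then have "(norm ((A - ?J ** A) ** K U))\<^sup>2 \<le> (norm ((E - E ** adj ?X) ** K U))\<^sup>2"
        using norm_sq_split_left[OF J, of "(E - E ** adj ?X) ** K U"] by simp
      also have "norm ((E - E ** adj ?X) ** K U) = norm (- adj ((E - E ** adj ?X) ** K U))" by simp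
      also have "- adj ((E - E ** adj ?X) ** K U) = ?c + K U ** lsq 0 R V ** V ** adj E"
        using projectorD(1)[OF K[of U]]
        by (simp add: adj_mult[of _ "K U"] adj_diff adj_mult[of E] matrix_algebra)
      finally show "ennreal ((norm (A - ?J ** A ** K U))\<^sup>2) \<le> ennreal ((norm (A - A ** K U))\<^sup>2)
          + ennreal ((norm (?c + K U ** lsq 0 R V ** V ** adj E))\<^sup>2)"
        unfolding split by (simp add: ennreal_plus[symmetric] ennreal_leI del: ennreal_plus)
    qed
    also have "\<dots> = ennreal ((norm (A - A ** K U))\<^sup>2)
        + (\<integral>\<^sup>+V. ennreal ((norm (?c + K U ** lsq 0 R (V :: 'a^'n^'k) ** V ** adj E))\<^sup>2) \<partial>gauss)"
      by (subst nn_integral_add) auto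
    also have "\<dots> \<le> ennreal ((norm (A - A ** K U))\<^sup>2) + ennreal ((norm ?c)\<^sup>2 + kap * (norm (adj E))\<^sup>2)"
      using nn_integral_lsq[OF R(1) projector_norm_le_left[OF K[of U]] RE dR, of ?c]
      unfolding kap_def d_def R(2) by (intro add_left_mono)
    also have "norm ?c = norm (adj (E ** K U))"
      using projectorD(1)[OF K[of U]] by (simp only: norm_minus_cancel adj_mult)
    finally show ?thesis by (simp only: norm_adj)
  qed
  have "(\<integral>\<^sup>+U. \<integral>\<^sup>+V. ennreal ((norm (A - q V ** adj (q V) ** A ** K U))\<^sup>2) \<partial>gauss \<partial>gauss)
    \<le> (\<integral>\<^sup>+U. ennreal ((norm (A - A ** K U))\<^sup>2) + ennreal ((norm (E ** K U))\<^sup>2 + kap * (norm E)\<^sup>2) \<partial>gauss)"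
    by (rule nn_integral_mono) (rule inner)
  also have "\<dots> \<le> (\<integral>\<^sup>+U. ennreal ((1 + kap) * (norm E)\<^sup>2)
      + ennreal ((norm (0 + mat 1 ** lsq 0 S (U :: 'a^'m^'k) ** U ** E))\<^sup>2) \<partial>gauss)"
    using AE_pgram_nonsingular[OF S(1) dS]
  proof (intro nn_integral_mono_AE, eventually_elim)
    fix U :: "'a^'m^'k" assume nz: "det (pgram 0 S U) \<noteq> 0"
    let ?L = "lsq 0 S U"
    obtain R1 where R1: "adj (U ** A) = p U ** R1" using p(2) by blast
    have "K U ** p U = p U"
      using p(1)[of U] by (simp add: K_def matrix_mul_assoc[symmetric])
    then have "K U ** adj (U ** A) = adj (U ** A)" by (simp add: R1 matrix_mul_assoc)
    from arg_cong[OF this, of adj] have UA: "U ** A ** K U = U ** A"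
      using projectorD(1)[OF K[of U]] by (simp add: adj_mult)
    \<comment> \<open>\<open>K U\<close> preserves \<open>U ** A\<close>, so the sketched residuals
      of \<open>S ** A\<close> and of \<open>E\<close> cancel; \<open>?L\<close> then recovers the
      residual of \<open>S ** A\<close> from that of \<open>E\<close>.\<close>
    have UE: "U ** S ** A - U ** S ** A ** K U = - (U ** E - U ** E ** K U)"
      by (simp add: ES matrix_algebra UA)
    have "S ** A - S ** A ** K U = ?L ** U ** S ** A - ?L ** U ** S ** A ** K U"
      by (simp only: lsq_zero(1)[OF S(1) nz])
    also have "\<dots> = ?L ** (U ** S ** A - U ** S ** A ** K U)"
      by (simp add: matrix_algebra)
    also have "\<dots> = - (?L ** U ** E - ?L ** U ** E ** K U)"
      unfolding UE by (simp add: matrix_algebra)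
    finally have "norm (S ** A - S ** A ** K U) = norm (?L ** U ** E - ?L ** U ** E ** K U)"
      by (simp only: norm_minus_cancel)
    then have 1: "(norm (S ** A - S ** A ** K U))\<^sup>2 \<le> (norm (?L ** U ** E))\<^sup>2"
      using norm_sq_split_right[OF K[of U], of "?L ** U ** E"] by simp
    have 2: "(norm (A - A ** K U))\<^sup>2 = (norm (S ** A - S ** A ** K U))\<^sup>2 + (norm (E - E ** K U))\<^sup>2"
    proof -
      have "A - A ** K U - S ** (A - A ** K U) = E - E ** K U"
        by (simp add: ES matrix_algebra)
      then show ?thesis
        by (subst norm_sq_split_left[OF S(1)]) (simp add: matrix_algebra)
    qed
    have "(norm (A - A ** K U))\<^sup>2 + ((norm (E ** K U))\<^sup>2 + kap * (norm E)\<^sup>2)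
      \<le> (1 + kap) * (norm E)\<^sup>2 + (norm (?L ** U ** E))\<^sup>2"
      using 1 2 norm_sq_split_right[OF K[of U], of E] by (simp add: algebra_simps)
    then show "ennreal ((norm (A - A ** K U))\<^sup>2) + ennreal ((norm (E ** K U))\<^sup>2 + kap * (norm E)\<^sup>2)
      \<le> ennreal ((1 + kap) * (norm E)\<^sup>2) + ennreal ((norm (0 + mat 1 ** ?L ** U ** E))\<^sup>2)"
      using kap0 by (simp add: ennreal_plus[symmetric] ennreal_leI del: ennreal_plus)
  qed
  also have "\<dots> = ennreal ((1 + kap) * (norm E)\<^sup>2)
      + (\<integral>\<^sup>+U. ennreal ((norm (0 + mat 1 ** lsq 0 S (U :: 'a^'m^'k) ** U ** E))\<^sup>2) \<partial>gauss)"
    by (subst nn_integral_add) auto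
  also have "\<dots> \<le> ennreal ((1 + kap) * (norm E)\<^sup>2) + ennreal ((norm (0 :: 'a^'n^'m))\<^sup>2 + kap * (norm E)\<^sup>2)"
    using nn_integral_lsq[OF S(1) _ SE dS, of "mat 1" 0]
    unfolding kap_def d_def S(2) by (intro add_left_mono) simp
  also have "\<dots> = ennreal ((1 + 2 * kap) * (norm E)\<^sup>2)"
    using kap0 by (simp add: ennreal_plus[symmetric] algebra_simps del: ennreal_plus)
  also have "\<dots> \<le> ennreal ((1 + 2 * kap) * tail_energy_sq (\<rho> + 1) A)"
    using tail kap0 by (intro ennreal_leI mult_left_mono) (auto simp: E_def)
  finally show ?thesis by (simp only: K_def)
qed

subsection \<open>The expected error\<close>

lemma borel_measurable_fst_snd_borel [measurable]:
  "fst \<in> borel_measurable (borel :: ('a::euclidean_space \<times> 'b::euclidean_space) measure)"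
  "snd \<in> borel_measurable (borel :: ('a::euclidean_space \<times> 'b::euclidean_space) measure)"
  by (auto intro!: borel_measurable_continuous_onI continuous_intros)

text \<open>Integrability follows from t \<le> 1 + t^2, the bound from the variance being
  nonnegative.\<close>

lemma (in prob_space) expectation_le_sqrt:
  fixes h :: "'a \<Rightarrow> real"
  assumes [measurable]: "h \<in> borel_measurable M" and h: "\<And>x. 0 \<le> h x" and "0 \<le> c"
    and le: "(\<integral>\<^sup>+x. ennreal ((h x)\<^sup>2) \<partial>M) \<le> ennreal c"
  shows "integrable M h" "expectation h \<le> sqrt c"
proof -
  have i2: "integrable M (\<lambda>x. (h x)\<^sup>2)"
    using le by (intro integrableI_nonneg) (auto intro: le_less_trans)
  show i1: "integrable M h"
  proof (rule Bochner_Integration.integrable_bound)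
    show "integrable M (\<lambda>x. 1 + (h x)\<^sup>2)" using i2 by simp
    show "AE x in M. norm (h x) \<le> norm (1 + (h x)\<^sup>2)" by (simp add: abs_le_one_plus_square)
  qed simp
  have "ennreal (expectation (\<lambda>x. (h x)\<^sup>2)) \<le> ennreal c"
    using le i2 by (subst nn_integral_eq_integral[symmetric]) auto
  then have "expectation (\<lambda>x. (h x)\<^sup>2) \<le> c" using \<open>0 \<le> c\<close> by simp
  moreover have "(expectation h)\<^sup>2 \<le> expectation (\<lambda>x. (h x)\<^sup>2)"
    using variance_eq[OF i1 i2] variance_positive[of h] by simp
  ultimately show "expectation h \<le> sqrt c" by (intro real_le_rsqrt) linarith
qed

text \<open>The error contains \<open>pinv\<close>, a definite description. The function
  \<open>h\<close>, built from \<open>core_sketch\<close>, is a measurable representative of it off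
  a null set, to which iterated integration applies.\<close>

lemma initial_approx_error:
  fixes A :: "'a::rc_field^'n^'m"
    and \<Upsilon> :: "'w \<Rightarrow> 'a^'m^'k::{finite,linorder}" and \<Omega> :: "'w \<Rightarrow> 'a^'n^'k::{finite,linorder}"
    and \<Phi> :: "'w \<Rightarrow> 'a^'m^'s" and \<Psi> :: "'w \<Rightarrow> 'a^'n^'s"
  assumes M: "prob_space M" and G: "indep_std_normal_matrices M \<Upsilon> \<Omega> \<Phi> \<Psi>"
    and qrP: "thin_qr qrP" and qrQ: "thin_qr qrQ"
    and \<rho>: "\<rho> \<le> min CARD('m) CARD('n)"
  defines "H \<equiv> \<lambda>\<omega>. initial_approx qrP qrQ (\<Phi> \<omega>) (\<Psi> \<omega>) (\<Upsilon> \<omega> ** A) (A ** adj (\<Omega> \<omega>)) (\<Phi> \<omega> ** A ** adj (\<Psi> \<omega>))"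
    and "d \<equiv> real DIM('a) * real CARD('s) - real DIM('a) * real CARD('k) + real DIM('a) - 2"
    and "d' \<equiv> real DIM('a) * real CARD('k) - real DIM('a) * real \<rho> + real DIM('a) - 2"
  assumes d: "0 < d" and kap: "real DIM('a) * real CARD('k) / d \<le> 1" and d': "0 < d'"
  shows "\<exists>h. h \<in> borel_measurable M \<and> (\<forall>\<omega>. 0 \<le> h \<omega>) \<and> (AE \<omega> in M. norm (A - H \<omega>) = h \<omega>)
    \<and> (\<integral>\<^sup>+\<omega>. ennreal ((h \<omega>)\<^sup>2) \<partial>M) \<le> ennreal ((1 + real DIM('a) * real CARD('k) / d)
        * ((1 + 2 * (real DIM('a) * real \<rho> / d')) * tail_energy_sq (\<rho> + 1) A))"
proof -
  define p where "p U = qrP (adj (U ** A))" for U :: "'a^'m^'k::{finite,linorder}"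
  define q where "q V = qrQ (A ** adj V)" for V :: "'a^'n^'k::{finite,linorder}"
  have p: "adj (p U) ** p U = mat 1" "\<exists>R. adj (U ** A) = p U ** R" for U
    using qrP unfolding thin_qr_def p_def by blast+
  have q: "adj (q V) ** q V = mat 1" "\<exists>R. A ** adj V = q V ** R" for V
    using qrQ unfolding thin_qr_def q_def by blast+
  have [measurable]: "qrP \<in> borel_measurable borel" "qrQ \<in> borel_measurable borel"
    using qrP qrQ by (auto simp: thin_qr_def)
  have [measurable]: "p \<in> borel_measurable borel" "q \<in> borel_measurable borel"
    unfolding p_def q_def by measurable
  define Z where "Z \<omega> = (\<Upsilon> \<omega>, \<Omega> \<omega>, \<Psi> \<omega>, \<Phi> \<omega>)" for \<omega>
  have Z: "distr M borel Z = gauss" and [measurable]: "Z \<in> borel_measurable M"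
    unfolding Z_def using joint_law_gauss[OF M G] by auto
  define F where "F U V T S = norm (A - q V ** core_sketch A (p U) (q V) T S ** adj (p U))"
    for U V and T :: "'a^'n^'s" and S :: "'a^'m^'s"
  define f where "f z = F (fst z) (fst (snd z)) (fst (snd (snd z))) (snd (snd (snd z)))" for z
  have f [measurable]: "f \<in> borel_measurable borel"
    unfolding f_def F_def core_sketch_def by measurable
  have fF: "f (U, V, T, S) = F U V T S" for U V T S by (simp add: f_def)
  \<comment> \<open>Both least squares problems are nonsingular. The frames depend on
    \<open>\<Upsilon>\<close> and \<open>\<Omega>\<close> only, so this holds almost surely section
    by section.\<close>
  define good where "good z \<longleftrightarrow> det (pgram 0 (q (fst (snd z)) ** adj (q (fst (snd z)))) (snd (snd (snd z)))) \<noteq> 0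
      \<and> det (pgram 0 (p (fst z) ** adj (p (fst z))) (fst (snd (snd z)))) \<noteq> 0"
    for z :: "('a^'m^'k::{finite,linorder}) \<times> ('a^'n^'k::{finite,linorder}) \<times> ('a^'n^'s) \<times> ('a^'m^'s)"
  have good_sets: "{z. good z} \<in> sets borel"
  proof -
    have "Measurable.pred borel good"
      unfolding good_def by measurable
    then show ?thesis by (simp add: pred_def)
  qed
  have section_sets: "{z. good (U, z)} \<in> sets borel" "{z. good (U, V, z)} \<in> sets borel" for U V
  proof -
    have "Measurable.pred borel (\<lambda>z. good (U, z))" "Measurable.pred borel (\<lambda>z. good (U, V, z))"
      unfolding good_def fst_conv snd_conv by measurable
    then show "{z. good (U, z)} \<in> sets borel" "{z. good (U, V, z)} \<in> sets borel"
      by (simp_all add: pred_def)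
  qed
  have dp: "0 < real DIM('a) * real CARD('s) - real DIM('a) * inner (p U ** adj (p U)) (mat 1) + real DIM('a) - 2"
    and dq: "0 < real DIM('a) * real CARD('s) - real DIM('a) * inner (q V ** adj (q V)) (mat 1) + real DIM('a) - 2" for U V
    using d unfolding d_def orthonormal_columns(2)[OF p(1)] orthonormal_columns(2)[OF q(1)] by simp_all
  have "AE z in gauss. good z"
  proof (rule AE_gauss_Pair[OF good_sets], rule AE_I2, rule AE_gauss_Pair[OF section_sets(1)], rule AE_I2,
      rule AE_gauss_Pair[OF section_sets(2)])
    fix U V
    have "AE T in (gauss :: ('a^'n^'s) measure). det (pgram 0 (p U ** adj (p U)) T) \<noteq> 0"
      by (rule AE_pgram_nonsingular[OF orthonormal_columns(1)[OF p(1)] dp])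
    then show "AE T in gauss. AE S in gauss. good (U, V, T, S)"
    proof eventually_elim
      fix T :: "'a^'n^'s" assume T: "det (pgram 0 (p U ** adj (p U)) T) \<noteq> 0"
      have "AE S in (gauss :: ('a^'m^'s) measure). det (pgram 0 (q V ** adj (q V)) S) \<noteq> 0"
        by (rule AE_pgram_nonsingular[OF orthonormal_columns(1)[OF q(1)] dq])
      then show "AE S in gauss. good (U, V, T, S)"
        by eventually_elim (simp add: good_def T)
    qed
  qed
  then have "AE z in distr M borel Z. good z" unfolding Z .
  then have "AE \<omega> in M. good (Z \<omega>)" by (rule AE_distrD[rotated]) measurable
  then have AE: "AE \<omega> in M. norm (A - H \<omega>) = f (Z \<omega>)"
  proof eventually_elim
    fix \<omega> assume "good (Z \<omega>)"
    then have "pinv (\<Phi> \<omega> ** q (\<Omega> \<omega>)) = adj (q (\<Omega> \<omega>)) ** lsq 0 (q (\<Omega> \<omega>) ** adj (q (\<Omega> \<omega>))) (\<Phi> \<omega>)"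
      and "pinv (\<Psi> \<omega> ** p (\<Upsilon> \<omega>)) = adj (p (\<Upsilon> \<omega>)) ** lsq 0 (p (\<Upsilon> \<omega>) ** adj (p (\<Upsilon> \<omega>))) (\<Psi> \<omega>)"
      by (auto simp: good_def Z_def pinv_eq_lsq p q)
    then show "norm (A - H \<omega>) = f (Z \<omega>)"
      unfolding H_def initial_approx_def Let_def p_def[symmetric] q_def[symmetric]
      by (simp only: Z_def fF F_def core_sketch_def)
  qed
  have "(\<integral>\<^sup>+\<omega>. ennreal ((f (Z \<omega>))\<^sup>2) \<partial>M) = (\<integral>\<^sup>+z. ennreal ((f z)\<^sup>2) \<partial>gauss)"
    unfolding Z[symmetric] by (rule nn_integral_distr[symmetric]) measurable
  also have "\<dots> = (\<integral>\<^sup>+U. \<integral>\<^sup>+V. \<integral>\<^sup>+T. \<integral>\<^sup>+S. ennreal ((F U V T S)\<^sup>2) \<partial>gauss \<partial>gauss \<partial>gauss \<partial>gauss)"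
  proof -
    have "(\<integral>\<^sup>+z. ennreal ((f z)\<^sup>2) \<partial>gauss) = (\<integral>\<^sup>+U. \<integral>\<^sup>+z. ennreal ((f (U, z))\<^sup>2) \<partial>gauss \<partial>gauss)"
      by (rule nn_integral_gauss_Pair) measurable
    also have "\<dots> = (\<integral>\<^sup>+U. \<integral>\<^sup>+V. \<integral>\<^sup>+z. ennreal ((f (U, V, z))\<^sup>2) \<partial>gauss \<partial>gauss \<partial>gauss)"
      by (intro nn_integral_cong nn_integral_gauss_Pair) (unfold f_def F_def core_sketch_def fst_conv snd_conv, measurable)
    also have "\<dots> = (\<integral>\<^sup>+U. \<integral>\<^sup>+V. \<integral>\<^sup>+T. \<integral>\<^sup>+S. ennreal ((f (U, V, T, S))\<^sup>2) \<partial>gauss \<partial>gauss \<partial>gauss \<partial>gauss)"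
      by (intro nn_integral_cong nn_integral_gauss_Pair) (unfold f_def F_def core_sketch_def fst_conv snd_conv, measurable)
    finally show ?thesis by (simp only: fF)
  qed
  \<comment> \<open>For fixed U and V the frames are constant, so the two inner integrals are an
    instance of \<open>core_sketch_error\<close>; what remains is the compression error of random
    frames.\<close>
  also have "\<dots> \<le> (\<integral>\<^sup>+U. \<integral>\<^sup>+V. ennreal (1 + real DIM('a) * real CARD('k) / d)
      * ennreal ((norm (A - q V ** adj (q V) ** A ** (p U ** adj (p U))))\<^sup>2) \<partial>gauss \<partial>gauss)"
    unfolding F_def using d
    by (intro nn_integral_mono order_trans[OF core_sketch_error[OF q(1) p(1) d[unfolded d_def] kap[unfolded d_def]]])
      (simp add: ennreal_mult d_def)
  also have "\<dots> = ennreal (1 + real DIM('a) * real CARD('k) / d)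
      * (\<integral>\<^sup>+U. \<integral>\<^sup>+V. ennreal ((norm (A - q V ** adj (q V) ** A ** (p U ** adj (p U))))\<^sup>2) \<partial>gauss \<partial>gauss)"
  proof -
    interpret V: prob_space "gauss :: ('a^'n^'k::{finite,linorder}) measure" by (rule prob_space_gauss)
    have [measurable]: "(\<lambda>U. \<integral>\<^sup>+V. ennreal ((norm (A - q V ** adj (q V) ** A ** (p U ** adj (p U))))\<^sup>2) \<partial>gauss)
        \<in> borel_measurable borel"
      by measurable
    show ?thesis by (simp add: nn_integral_cmult)
  qed
  also have "\<dots> \<le> ennreal (1 + real DIM('a) * real CARD('k) / d)
      * ennreal ((1 + 2 * (real DIM('a) * real \<rho> / d')) * tail_energy_sq (\<rho> + 1) A)"
    unfolding d'_def
    by (intro mult_left_mono range_finder_error q p \<rho> d'[unfolded d'_def]) measurable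
  also have "\<dots> = ennreal ((1 + real DIM('a) * real CARD('k) / d)
        * ((1 + 2 * (real DIM('a) * real \<rho> / d')) * tail_energy_sq (\<rho> + 1) A))"
    using d by (intro ennreal_mult'[symmetric]) simp
  finally have "(\<integral>\<^sup>+\<omega>. ennreal ((f (Z \<omega>))\<^sup>2) \<partial>M) \<le> \<dots>" .
  moreover have "(\<lambda>\<omega>. f (Z \<omega>)) \<in> borel_measurable M" by measurable
  moreover have "0 \<le> f (Z \<omega>)" for \<omega> by (simp add: f_def F_def)
  ultimately show ?thesis using AE by (intro exI[of _ "\<lambda>\<omega>. f (Z \<omega>)"]) blast
qed

lemma truncated_approx_error:
  fixes A :: "'a::rc_field^'n^'m"
    and \<Upsilon> :: "'w \<Rightarrow> 'a^'m^'k::{finite,linorder}" and \<Omega> :: "'w \<Rightarrow> 'a^'n^'k::{finite,linorder}"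
    and \<Phi> :: "'w \<Rightarrow> 'a^'m^'s" and \<Psi> :: "'w \<Rightarrow> 'a^'n^'s"
  assumes M: "prob_space M" and G: "indep_std_normal_matrices M \<Upsilon> \<Omega> \<Phi> \<Psi>"
    and qr: "thin_qr qrP" "thin_qr qrQ"
    and B: "\<forall>\<omega>\<in>space M. best_rank_approx r
          (initial_approx qrP qrQ (\<Phi> \<omega>) (\<Psi> \<omega>)
             (\<Upsilon> \<omega> ** A) (A ** adj (\<Omega> \<omega>)) (\<Phi> \<omega> ** A ** adj (\<Psi> \<omega>))) (B \<omega>)"
    and [measurable]: "(\<lambda>\<omega>. norm (A - B \<omega>)) \<in> borel_measurable M"
    and \<rho>: "\<rho> \<le> min CARD('m) CARD('n)"
  defines "d \<equiv> real DIM('a) * real CARD('s) - real DIM('a) * real CARD('k) + real DIM('a) - 2"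
    and "d' \<equiv> real DIM('a) * real CARD('k) - real DIM('a) * real \<rho> + real DIM('a) - 2"
  assumes d: "0 < d" and kap: "real DIM('a) * real CARD('k) / d \<le> 1" and d': "0 < d'"
  shows "integrable M (\<lambda>\<omega>. norm (A - B \<omega>)) \<and>
    prob_space.expectation M (\<lambda>\<omega>. norm (A - B \<omega>))
      \<le> tail_energy (r + 1) A + 2 * sqrt ((1 + real DIM('a) * real CARD('k) / d)
        * ((1 + 2 * (real DIM('a) * real \<rho> / d')) * tail_energy_sq (\<rho> + 1) A))"
proof -
  interpret prob_space M by fact
  let ?c = "(1 + real DIM('a) * real CARD('k) / d) * ((1 + 2 * (real DIM('a) * real \<rho> / d')) * tail_energy_sq (\<rho> + 1) A)"
  have c: "0 \<le> ?c" using d d' tail_energy_sq_nonneg[of \<rho> A] by simp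
  obtain h where [measurable]: "h \<in> borel_measurable M" and h0: "\<And>\<omega>. 0 \<le> h \<omega>"
    and hH: "AE \<omega> in M. norm (A - initial_approx qrP qrQ (\<Phi> \<omega>) (\<Psi> \<omega>)
             (\<Upsilon> \<omega> ** A) (A ** adj (\<Omega> \<omega>)) (\<Phi> \<omega> ** A ** adj (\<Psi> \<omega>))) = h \<omega>"
    and hc: "(\<integral>\<^sup>+\<omega>. ennreal ((h \<omega>)\<^sup>2) \<partial>M) \<le> ennreal ?c"
    using initial_approx_error[OF M G qr \<rho> d[unfolded d_def] kap[unfolded d_def] d'[unfolded d'_def]]
    unfolding d_def d'_def by blast
  note h = expectation_le_sqrt[OF _ h0 c hc]
  have le: "AE \<omega> in M. norm (A - B \<omega>) \<le> tail_energy (r + 1) A + 2 * h \<omega>"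
    using hH AE_space
  proof eventually_elim
    case (elim \<omega>)
    then show ?case using truncation_error[OF B[rule_format, OF elim(2)], of A] by simp
  qed
  have i: "integrable M (\<lambda>\<omega>. tail_energy (r + 1) A + 2 * h \<omega>)" using h by simp
  have iB: "integrable M (\<lambda>\<omega>. norm (A - B \<omega>))"
    by (rule Bochner_Integration.integrable_bound[OF i]) (use le in \<open>auto elim!: eventually_mono\<close>)
  have "expectation (\<lambda>\<omega>. norm (A - B \<omega>)) \<le> expectation (\<lambda>\<omega>. tail_energy (r + 1) A + 2 * h \<omega>)"
    by (rule integral_mono_AE[OF iB i le])
  also have "\<dots> = tail_energy (r + 1) A + 2 * expectation h" using h(1) by (simp add: prob_space)
  also have "\<dots> \<le> tail_energy (r + 1) A + 2 * sqrt ?c" using h(2) by simp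
  finally show ?thesis using iB by simp
qed

(* Field = real, alpha = 1 (first conjunct); field = complex, alpha = 0 (second conjunct).
   For real scalars and k = 1 the minimum ranges over the empty set, so the bound carries no
   information; this is the reason for the assumption 1 < k there. *)
theorem corollary5p5:
  fixes M :: "'w measure" and r :: nat
  assumes "prob_space M"
    and "1 \<le> CARD('k::{finite,linorder})" "CARD('k) \<le> CARD('s::finite)"
    and "CARD('s) \<le> min CARD('m::finite) CARD('n::finite)"
    and "1 \<le> r"
  shows "(\<forall>(A :: real^'n^'m) \<Upsilon> \<Omega> \<Phi> \<Psi> qrP qrQ B.
       1 < CARD('k) \<longrightarrow>
       2 * CARD('k) + 1 \<le> CARD('s) \<longrightarrow>
       indep_std_normal_matrices M
         (\<Upsilon> :: 'w \<Rightarrow> real^'m^'k::{finite,linorder}) (\<Omega> :: 'w \<Rightarrow> real^'n^'k::{finite,linorder})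
         (\<Phi> :: 'w \<Rightarrow> real^'m^'s) (\<Psi> :: 'w \<Rightarrow> real^'n^'s) \<longrightarrow>
       thin_qr qrP \<longrightarrow> thin_qr qrQ \<longrightarrow>
       (\<forall>\<omega>\<in>space M. best_rank_approx r
          (initial_approx qrP qrQ (\<Phi> \<omega>) (\<Psi> \<omega>)
             (\<Upsilon> \<omega> ** A) (A ** adj (\<Omega> \<omega>)) (\<Phi> \<omega> ** A ** adj (\<Psi> \<omega>)))
          (B \<omega>)) \<longrightarrow>
       (\<lambda>\<omega>. norm (A - B \<omega>)) \<in> borel_measurable M \<longrightarrow>
       integrable M (\<lambda>\<omega>. norm (A - B \<omega>)) \<and>
       prob_space.expectation M (\<lambda>\<omega>. norm (A - B \<omega>))
         \<le> tail_energy (r + 1) A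
           + 2 * sqrt ((real CARD('s) - 1) / (real CARD('s) - real CARD('k) - 1) *
               Min ((\<lambda>\<rho>. (real CARD('k) + real \<rho> - 1) / (real CARD('k) - real \<rho> - 1)
                         * tail_energy_sq (\<rho> + 1) A) ` {\<rho>::nat. \<rho> + 1 < CARD('k)})))
   \<and>
   (\<forall>(A :: complex^'n^'m) \<Upsilon> \<Omega> \<Phi> \<Psi> qrP qrQ B.
       2 * CARD('k) \<le> CARD('s) \<longrightarrow>
       indep_std_normal_matrices M
         (\<Upsilon> :: 'w \<Rightarrow> complex^'m^'k::{finite,linorder}) (\<Omega> :: 'w \<Rightarrow> complex^'n^'k::{finite,linorder})
         (\<Phi> :: 'w \<Rightarrow> complex^'m^'s) (\<Psi> :: 'w \<Rightarrow> complex^'n^'s) \<longrightarrow>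
       thin_qr qrP \<longrightarrow> thin_qr qrQ \<longrightarrow>
       (\<forall>\<omega>\<in>space M. best_rank_approx r
          (initial_approx qrP qrQ (\<Phi> \<omega>) (\<Psi> \<omega>)
             (\<Upsilon> \<omega> ** A) (A ** adj (\<Omega> \<omega>)) (\<Phi> \<omega> ** A ** adj (\<Psi> \<omega>)))
          (B \<omega>)) \<longrightarrow>
       (\<lambda>\<omega>. norm (A - B \<omega>)) \<in> borel_measurable M \<longrightarrow>
       integrable M (\<lambda>\<omega>. norm (A - B \<omega>)) \<and>
       prob_space.expectation M (\<lambda>\<omega>. norm (A - B \<omega>))
         \<le> tail_energy (r + 1) A
           + 2 * sqrt ((real CARD('s)) / (real CARD('s) - real CARD('k)) *
               Min ((\<lambda>\<rho>. (real CARD('k) + real \<rho>) / (real CARD('k) - real \<rho>)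
                         * tail_energy_sq (\<rho> + 1) A) ` {\<rho>::nat. \<rho> < CARD('k)})))"
proof (intro conjI allI impI)
  fix A :: "real^'n^'m" and \<Upsilon> :: "'w \<Rightarrow> real^'m^'k::{finite,linorder}" and \<Omega> :: "'w \<Rightarrow> real^'n^'k::{finite,linorder}"
    and \<Phi> :: "'w \<Rightarrow> real^'m^'s" and \<Psi> :: "'w \<Rightarrow> real^'n^'s" and qrP qrQ B
  assume k: "1 < CARD('k)" and s: "2 * CARD('k) + 1 \<le> CARD('s)"
    and hyps: "indep_std_normal_matrices M \<Upsilon> \<Omega> \<Phi> \<Psi>" "thin_qr qrP" "thin_qr qrQ"
      "\<forall>\<omega>\<in>space M. best_rank_approx r
          (initial_approx qrP qrQ (\<Phi> \<omega>) (\<Psi> \<omega>)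
             (\<Upsilon> \<omega> ** A) (A ** adj (\<Omega> \<omega>)) (\<Phi> \<omega> ** A ** adj (\<Psi> \<omega>))) (B \<omega>)"
      "(\<lambda>\<omega>. norm (A - B \<omega>)) \<in> borel_measurable M"
  let ?g = "\<lambda>\<rho>. (real CARD('k) + real \<rho> - 1) / (real CARD('k) - real \<rho> - 1) * tail_energy_sq (\<rho> + 1) A"
  have fin: "finite {\<rho>. \<rho> + 1 < CARD('k)}"
    by (rule finite_subset[of _ "{..<CARD('k)}"]) auto
  \<comment> \<open>The minimum is attained because 1 < k admits \<rho> = 0. Its minimizer lies
    below k, hence below both dimensions of \<open>A\<close>, as the spectral projectors
    require.\<close>
  have "Min (?g ` {\<rho>. \<rho> + 1 < CARD('k)}) \<in> ?g ` {\<rho>. \<rho> + 1 < CARD('k)}"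
    by (intro Min_in finite_imageI fin) (use k in auto)
  then obtain \<rho> where \<rho>: "\<rho> + 1 < CARD('k)" and min: "Min (?g ` {\<rho>. \<rho> + 1 < CARD('k)}) = ?g \<rho>" by auto
  have r: "real \<rho> + 1 < real CARD('k)" "2 * real CARD('k) + 1 \<le> real CARD('s)"
    using \<rho> s by linarith+
  \<comment> \<open>The case \<beta> = 1, where d = s - k - 1 and d' = k - \<rho> - 1.\<close>
  have "(1 + real CARD('k) / (real CARD('s) - real CARD('k) - 1)) * ((1 + 2 * (real \<rho> / (real CARD('k) - real \<rho> - 1))) * tail_energy_sq (\<rho> + 1) A)
    = (real CARD('s) - 1) / (real CARD('s) - real CARD('k) - 1) * ?g \<rho>"
  proof -
    have "1 + real CARD('k) / (real CARD('s) - real CARD('k) - 1) = (real CARD('s) - 1) / (real CARD('s) - real CARD('k) - 1)"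
      "1 + 2 * (real \<rho> / (real CARD('k) - real \<rho> - 1)) = (real CARD('k) + real \<rho> - 1) / (real CARD('k) - real \<rho> - 1)"
      using r by (simp_all add: field_simps)
    then show ?thesis by (simp only:)
  qed
  then show "integrable M (\<lambda>\<omega>. norm (A - B \<omega>))"
    "prob_space.expectation M (\<lambda>\<omega>. norm (A - B \<omega>)) \<le> tail_energy (r + 1) A
      + 2 * sqrt ((real CARD('s) - 1) / (real CARD('s) - real CARD('k) - 1) * Min (?g ` {\<rho>. \<rho> + 1 < CARD('k)}))"
    using truncated_approx_error[OF assms(1) hyps, of \<rho>] r \<rho> assms(3,4) unfolding min by simp_all
next
  fix A :: "complex^'n^'m" and \<Upsilon> :: "'w \<Rightarrow> complex^'m^'k::{finite,linorder}" and \<Omega> :: "'w \<Rightarrow> complex^'n^'k::{finite,linorder}"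
    and \<Phi> :: "'w \<Rightarrow> complex^'m^'s" and \<Psi> :: "'w \<Rightarrow> complex^'n^'s" and qrP qrQ B
  assume s: "2 * CARD('k) \<le> CARD('s)"
    and hyps: "indep_std_normal_matrices M \<Upsilon> \<Omega> \<Phi> \<Psi>" "thin_qr qrP" "thin_qr qrQ"
      "\<forall>\<omega>\<in>space M. best_rank_approx r
          (initial_approx qrP qrQ (\<Phi> \<omega>) (\<Psi> \<omega>)
             (\<Upsilon> \<omega> ** A) (A ** adj (\<Omega> \<omega>)) (\<Phi> \<omega> ** A ** adj (\<Psi> \<omega>))) (B \<omega>)"
      "(\<lambda>\<omega>. norm (A - B \<omega>)) \<in> borel_measurable M"
  let ?g = "\<lambda>\<rho>. (real CARD('k) + real \<rho>) / (real CARD('k) - real \<rho>) * tail_energy_sq (\<rho> + 1) A"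
  have k: "0 < CARD('k)" using assms(2) by simp
  have "Min (?g ` {\<rho>. \<rho> < CARD('k)}) \<in> ?g ` {\<rho>. \<rho> < CARD('k)}"
    by (intro Min_in finite_imageI) (use k in \<open>auto intro: exI[of _ 0]\<close>)
  then obtain \<rho> where \<rho>: "\<rho> < CARD('k)" and min: "Min (?g ` {\<rho>. \<rho> < CARD('k)}) = ?g \<rho>" by auto
  have r: "real \<rho> < real CARD('k)" "2 * real CARD('k) \<le> real CARD('s)" "0 < real CARD('k)"
    using \<rho> s k by linarith+
  \<comment> \<open>The case \<beta> = 2: the constant \<beta> - 2 vanishes from d and d', and the
    common factor 2 cancels.\<close>
  have "(1 + 2 * real CARD('k) / (2 * real CARD('s) - 2 * real CARD('k))) * ((1 + 2 * (2 * real \<rho> / (2 * real CARD('k) - 2 * real \<rho>))) * tail_energy_sq (\<rho> + 1) A)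
    = real CARD('s) / (real CARD('s) - real CARD('k)) * ?g \<rho>"
  proof -
    have "1 + 2 * real CARD('k) / (2 * real CARD('s) - 2 * real CARD('k)) = real CARD('s) / (real CARD('s) - real CARD('k))"
      "1 + 2 * (2 * real \<rho> / (2 * real CARD('k) - 2 * real \<rho>)) = (real CARD('k) + real \<rho>) / (real CARD('k) - real \<rho>)"
      using r by (simp_all add: field_simps)
    then show ?thesis by (simp only:)
  qed
  then show "integrable M (\<lambda>\<omega>. norm (A - B \<omega>))"
    "prob_space.expectation M (\<lambda>\<omega>. norm (A - B \<omega>)) \<le> tail_energy (r + 1) A
      + 2 * sqrt (real CARD('s) / (real CARD('s) - real CARD('k)) * Min (?g ` {\<rho>. \<rho> < CARD('k)}))"
    using truncated_approx_error[OF assms(1) hyps, of \<rho>] r \<rho> assms(3,4) unfolding min by simp_all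
qed

end
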